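(* Let $\{\mathcal T_h\}_{h\in(0,h_0)}$ be conforming triangulations of $\Omega$ and let $\alpha_0<\pi$ be independent of $h$. For each $h$ let $\{\mathscr C_i\}_{i=1}^{N_{\mathscr C}}$ be a set of clusters of elements of $\mathcal T_h$ such that every $K\in\mathcal T_h$ not contained in any cluster satisfies the maximum angle condition $\alpha_K\le\alpha_0$. Let $r_{\mathscr C_i}=\operatorname{diam}\mathscr C_i$ and assume that, with a constant $C$ independent of $h$, (i) $\sum_{i=1}^{N_{\mathscr C}}r_{\mathscr C_i}^2\le Ch$; (ii) $\operatorname{dist}(\mathscr C_i,\mathscr C_j)\ge2(r_{\mathscr C_i}+r_{\mathscr C_j})$ for $i,j=1,\dots,N_{\mathscr C}$, $i\ne j$. Then $|u-U|_{H^1(\Omega)}\le C(u)h$ for all $u\in W^{2,\infty}(\Omega)$, where $C(u)$ is independent of $h$.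
   Context: $\Omega\subset\mathbb R^2$ is a bounded polygonal domain with Lipschitz boundary; $h$ is the maximal diameter of elements of $\mathcal T_h$; $X_h\subset H^1(\Omega)$ is the space of globally continuous functions that are linear on every $K\in\mathcal T_h$. $\alpha_K$ is the maximum angle of $K$. A cluster $\mathscr C$ is a simply connected union of elements $K\in\mathcal T_h$ containing at least one element with $\alpha_K>\alpha_0$. $U\in X_h$ is the discrete (finite element) approximation of $u$, understood through Céa's lemma as the best approximation of $u$ in the discrete space: $|u-U|_{H^1(\Omega)}=\inf_{v_h\in X_h}|u-v_h|_{H^1(\Omega)}$. *)

theory Defs
  imports "HOL-Analysis.Analysis"
begin

text \<open>Polygonal domains with Lipschitz boundary: near each boundary point the domain is, in
  suitable orthonormal coordinates, the part of the plane above the graph of a Lipschitz function.\<close>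

definition lipschitz_boundary :: "(real^2) set \<Rightarrow> bool" where
  "lipschitz_boundary \<Omega> \<longleftrightarrow>
     (\<forall>x\<in>frontier \<Omega>. \<exists>r>0. \<exists>R :: real^2 \<Rightarrow> real^2. \<exists>g :: real \<Rightarrow> real. \<exists>L.
        orthogonal_transformation R \<and> L-lipschitz_on UNIV g \<and>
        \<Omega> \<inter> ball x r = {y \<in> ball x r. g (R y $ 1) < R y $ 2})"

definition polygonal_lipschitz_domain :: "(real^2) set \<Rightarrow> bool" where
  "polygonal_lipschitz_domain \<Omega> \<longleftrightarrow>
     open \<Omega> \<and> connected \<Omega> \<and> \<Omega> \<noteq> {} \<and> bounded \<Omega> \<and>
     (\<exists>S. finite S \<and> (\<forall>s\<in>S. \<exists>a b. s = closed_segment a b) \<and> frontier \<Omega> = \<Union>S) \<and>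
     lipschitz_boundary \<Omega>"

text \<open>Elements are closed nondegenerate triangles. The library notion \<^const>\<open>triangulation\<close>
  already contains conformity: any two elements meet in a common (possibly empty) face.\<close>

definition conforming_triangulation :: "(real^2) set \<Rightarrow> (real^2) set set \<Rightarrow> bool" where
  "conforming_triangulation \<Omega> T \<longleftrightarrow>
     triangulation T \<and> (\<forall>K\<in>T. 2 simplex K) \<and> \<Union>T = closure \<Omega>"

definition mesh_size :: "(real^2) set set \<Rightarrow> real" where
  "mesh_size T = Max (diameter ` T)"

definition angle_at :: "real^2 \<Rightarrow> real^2 \<Rightarrow> real^2 \<Rightarrow> real" where
  "angle_at a b c = arccos (((b - a) \<bullet> (c - a)) / (norm (b - a) * norm (c - a)))"

text \<open>The extreme points of a triangle are its three vertices.\<close>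

definition max_angle :: "(real^2) set \<Rightarrow> real" where
  "max_angle K = Max {angle_at a b c | a b c.
     a extreme_point_of K \<and> b extreme_point_of K \<and> c extreme_point_of K \<and>
     a \<noteq> b \<and> a \<noteq> c \<and> b \<noteq> c}"

definition is_cluster :: "(real^2) set set \<Rightarrow> real \<Rightarrow> (real^2) set \<Rightarrow> bool" where
  "is_cluster T \<alpha>0 C \<longleftrightarrow>
     (\<exists>S\<subseteq>T. C = \<Union>S \<and> simply_connected C \<and> (\<exists>K\<in>S. max_angle K > \<alpha>0))"

text \<open>Weak derivatives. A list of coordinate indices plays the role of a multi-index: its length is
  the order. If all iterated partial derivatives of \<open>f\<close> are Frechet differentiable, they are
  in particular continuous, so \<open>smooth\<close> is the class of infinitely differentiable functions.\<close>

definition partial :: "2 \<Rightarrow> (real^2 \<Rightarrow> real) \<Rightarrow> real^2 \<Rightarrow> real" where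
  "partial i f x = frechet_derivative f (at x) (axis i 1)"

definition partials :: "2 list \<Rightarrow> (real^2 \<Rightarrow> real) \<Rightarrow> real^2 \<Rightarrow> real" where
  "partials is f = foldr partial is f"

definition smooth :: "(real^2 \<Rightarrow> real) \<Rightarrow> bool" where
  "smooth f \<longleftrightarrow> (\<forall>is x. partials is f differentiable (at x))"

definition test_function :: "(real^2) set \<Rightarrow> (real^2 \<Rightarrow> real) \<Rightarrow> bool" where
  "test_function \<Omega> \<phi> \<longleftrightarrow>
     smooth \<phi> \<and> compact (closure {x. \<phi> x \<noteq> 0}) \<and> closure {x. \<phi> x \<noteq> 0} \<subseteq> \<Omega>"

definition locally_integrable :: "(real^2) set \<Rightarrow> (real^2 \<Rightarrow> real) \<Rightarrow> bool" where
  "locally_integrable \<Omega> f \<longleftrightarrow> (\<forall>K. compact K \<and> K \<subseteq> \<Omega> \<longrightarrow> set_integrable lebesgue K f)"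

definition weak_derivative ::
    "(real^2) set \<Rightarrow> 2 list \<Rightarrow> (real^2 \<Rightarrow> real) \<Rightarrow> (real^2 \<Rightarrow> real) \<Rightarrow> bool" where
  "weak_derivative \<Omega> is u g \<longleftrightarrow>
     locally_integrable \<Omega> u \<and> locally_integrable \<Omega> g \<and>
     (\<forall>\<phi>. test_function \<Omega> \<phi> \<longrightarrow>
        (LINT x:\<Omega>|lebesgue. u x * partials is \<phi> x) =
        (-1) ^ length is * (LINT x:\<Omega>|lebesgue. g x * \<phi> x))"

text \<open>Lebesgue and Sobolev spaces consist of functions (not classes) on the whole plane; the values
  outside \<open>\<Omega>\<close> and on null sets are irrelevant.\<close>

definition L2 :: "(real^2) set \<Rightarrow> (real^2 \<Rightarrow> real) set" where
  "L2 \<Omega> = {f. set_borel_measurable lebesgue \<Omega> f \<and> set_integrable lebesgue \<Omega> (\<lambda>x. (f x)\<^sup>2)}"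

definition Linf :: "(real^2) set \<Rightarrow> (real^2 \<Rightarrow> real) set" where
  "Linf \<Omega> = {f. set_borel_measurable lebesgue \<Omega> f \<and>
                (\<exists>M. AE x in lebesgue. x \<in> \<Omega> \<longrightarrow> \<bar>f x\<bar> \<le> M)}"

definition sobolev ::
    "nat \<Rightarrow> (real^2 \<Rightarrow> real) set \<Rightarrow> (real^2) set \<Rightarrow> (real^2 \<Rightarrow> real) set" where
  "sobolev k F \<Omega> = {u \<in> F. \<forall>is. length is \<le> k \<longrightarrow> (\<exists>g\<in>F. weak_derivative \<Omega> is u g)}"

abbreviation W2inf :: "(real^2) set \<Rightarrow> (real^2 \<Rightarrow> real) set" where
  "W2inf \<Omega> \<equiv> sobolev 2 (Linf \<Omega>) \<Omega>"

abbreviation H1 :: "(real^2) set \<Rightarrow> (real^2 \<Rightarrow> real) set" where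
  "H1 \<Omega> \<equiv> sobolev 1 (L2 \<Omega>) \<Omega>"

text \<open>A weak derivative is unique up to null sets, so the choice below does not affect
  the seminorm. Both are meaningful only when the weak derivatives exist.\<close>

definition weak_partial :: "(real^2) set \<Rightarrow> 2 \<Rightarrow> (real^2 \<Rightarrow> real) \<Rightarrow> real^2 \<Rightarrow> real" where
  "weak_partial \<Omega> i u = (SOME g. weak_derivative \<Omega> [i] u g)"

definition H1_seminorm :: "(real^2) set \<Rightarrow> (real^2 \<Rightarrow> real) \<Rightarrow> real" where
  "H1_seminorm \<Omega> w = sqrt (LINT x:\<Omega>|lebesgue. (\<Sum>i\<in>UNIV. (weak_partial \<Omega> i w x)\<^sup>2))"

definition fe_space :: "(real^2) set \<Rightarrow> (real^2) set set \<Rightarrow> (real^2 \<Rightarrow> real) set" where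
  "fe_space \<Omega> T = {v \<in> H1 \<Omega>. continuous_on (closure \<Omega>) v \<and>
     (\<forall>K\<in>T. \<exists>a b. \<forall>x\<in>K. v x = a \<bullet> x + b)}"

definition fe_approximation ::
    "(real^2) set \<Rightarrow> (real^2) set set \<Rightarrow> (real^2 \<Rightarrow> real) \<Rightarrow> (real^2 \<Rightarrow> real) \<Rightarrow> bool" where
  "fe_approximation \<Omega> T u U \<longleftrightarrow> U \<in> fe_space \<Omega> T \<and>
     H1_seminorm \<Omega> (\<lambda>x. u x - U x) = (INF v\<in>fe_space \<Omega> T. H1_seminorm \<Omega> (\<lambda>x. u x - v x))"

end

theory Submission
  imports Defs
begin

text \<open>A function \<open>u\<close> in \<open>W2inf\<close> agrees almost everywhere with a function \<open>v\<close> whose gradient is Lipschitz.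
  Because the boundary is locally a Lipschitz graph, nearby points are joined by three segments of comparable
  length inside the domain, so \<open>v\<close> satisfies first-order Taylor estimates for all pairs of points.

  Fix a point \<open>z\<close> of each cluster, let \<open>r\<close> be the diameter of the cluster, and use a cutoff at scale \<open>r\<close> to replace
  \<open>v\<close> near the cluster by its Taylor polynomial at \<open>z\<close>. The gradient of the resulting function \<open>v'\<close> is Lipschitz
  with a constant independent of \<open>r\<close>, and it differs from the gradient of \<open>v\<close> by \<open>O(r)\<close> on a disc of radius \<open>2 * r\<close>;
  by the separation hypothesis these discs are disjoint. The Lagrange interpolant of \<open>v'\<close> is exact on the clusters
  and has gradient error \<open>O(h)\<close> on all other triangles. Hence the squared error is at most a constant times
  \<open>h\<^sup>2\<close> plus the sum of the \<open>r ^ 4\<close>, and that sum is at most the square of the sum of the \<open>r\<^sup>2\<close>.\<close>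

section \<open>Test functions\<close>

text \<open>Interpolating \<open>u\<close> itself fails on triangles with an angle near pi: there
  the gradient error is not controlled by the diameter. Only affine data are safe, so the function
  is altered before it is interpolated. The price is a gradient change of order r on an area of
  order r^2, hence r^4 in the squared seminorm; hypothesis (i) controls the sum of the r^2, and its
  square returns h^2. Clusters may touch the boundary, where the segment between two points of
  \<Omega> may leave \<Omega>. The Taylor estimate is therefore needed for all pairs of points, and
  the corrections are estimated by comparing pairs directly. The base point of a cluster must lie in
  \<Omega> itself, where the gradient exists; the graph condition excludes slits, so that interiors
  of elements lie in \<Omega>. The seminorm refers to chosen weak derivatives. Pointwise gradients
  enter through two facts: weak derivatives are unique almost everywhere, and a function that is
  Lipschitz along segments has its almost everywhere gradient as weak gradient.\<close>

coinductive smooth1 :: "(real \<Rightarrow> real) \<Rightarrow> bool" where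
  smooth1I: "(\<And>t. (f has_real_derivative f' t) (at t)) \<Longrightarrow> smooth1 f' \<Longrightarrow> smooth1 f"

text \<open>Infinite differentiability is a greatest fixed point here: a function is smooth as soon
  as it lies in some class whose members all have a derivative in the same class. Closure properties
  then need only a suitable class, with no induction on the order of the derivative.\<close>

lemma smooth1_coinduct:
  assumes "P f" "\<And>f. P f \<Longrightarrow> \<exists>f'. (\<forall>t. (f has_real_derivative f' t) (at t)) \<and> P f'"
  shows "smooth1 f"
  using assms(1) by (coinduction arbitrary: f rule: smooth1.coinduct) (metis assms(2))

lemma smooth1E:
  assumes "smooth1 f"
  obtains f' where "\<And>t. (f has_real_derivative f' t) (at t)" "smooth1 f'"
  using assms by (cases rule: smooth1.cases) auto

lemma smooth1_continuous: "smooth1 f \<Longrightarrow> continuous_on A f"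
  by (metis smooth1E DERIV_isCont continuous_at_imp_continuous_on)

lemma smooth1_affine:
  assumes "smooth1 f"
  shows "smooth1 (\<lambda>t. f (a * t + b))"
\<comment> \<open>The constant factor \<open>c\<close> keeps the class stable: each differentiation
  brings out another factor \<open>a\<close>.\<close>
proof (rule smooth1_coinduct[where P = "\<lambda>g. \<exists>f c. smooth1 f \<and> g = (\<lambda>t. c * f (a * t + b))"])
  show "\<exists>f' c. smooth1 f' \<and> (\<lambda>t. f (a * t + b)) = (\<lambda>t. c * f' (a * t + b))"
    using assms by (intro exI[of _ f] exI[of _ 1]) auto
next
  fix g assume "\<exists>f c. smooth1 f \<and> g = (\<lambda>t. c * f (a * t + b))"
  then obtain f c where f: "smooth1 f" and g: "g = (\<lambda>t. c * f (a * t + b))" by blast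
  obtain f' where f': "\<And>t. (f has_real_derivative f' t) (at t)" "smooth1 f'"
    using f by (rule smooth1E) blast
  have "(g has_real_derivative (c * a) * f' (a * t + b)) (at t)" for t
  proof -
    have "((\<lambda>t. a * t + b) has_real_derivative a) (at t)"
      by (auto intro!: derivative_eq_intros)
    from DERIV_cmult[OF DERIV_chain2[OF f'(1) this], of c] show ?thesis
      unfolding g by (simp add: mult_ac)
  qed
  then show "\<exists>f'. (\<forall>t. (g has_real_derivative f' t) (at t)) \<and>
      (\<exists>f c. smooth1 f \<and> f' = (\<lambda>t. c * f (a * t + b)))"
    using f'(2) by (intro exI[of _ "\<lambda>t. (c * a) * f' (a * t + b)"]) auto
qed

lemma smooth1_diff:
  assumes "smooth1 f" "smooth1 g"
  shows "smooth1 (\<lambda>t. f t - g t)"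
proof (rule smooth1_coinduct[where P = "\<lambda>h. \<exists>f g. smooth1 f \<and> smooth1 g \<and> h = (\<lambda>t. f t - g t)"])
  show "\<exists>f' g'. smooth1 f' \<and> smooth1 g' \<and> (\<lambda>t. f t - g t) = (\<lambda>t. f' t - g' t)"
    using assms by blast
next
  fix h assume "\<exists>f g. smooth1 f \<and> smooth1 g \<and> h = (\<lambda>t. f t - g t)"
  then obtain f g where *: "smooth1 f" "smooth1 g" "h = (\<lambda>t. f t - g t)" by blast
  obtain f' where f': "\<And>t. (f has_real_derivative f' t) (at t)" "smooth1 f'"
    using *(1) by (rule smooth1E) blast
  obtain g' where g': "\<And>t. (g has_real_derivative g' t) (at t)" "smooth1 g'"
    using *(2) by (rule smooth1E) blast
  have "(h has_real_derivative f' t - g' t) (at t)" for t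
    unfolding * by (intro derivative_intros f' g')
  then show "\<exists>h'. (\<forall>t. (h has_real_derivative h' t) (at t)) \<and>
      (\<exists>f g. smooth1 f \<and> smooth1 g \<and> h' = (\<lambda>t. f t - g t))"
    using f'(2) g'(2) by (intro exI[of _ "\<lambda>t. f' t - g' t"]) auto
qed

text \<open>Single products are not stable under differentiation, but finite sums of products of
  smooth functions are, by the Leibniz rule. This span is the class used for the coinduction on
  products.\<close>

inductive prod_span :: "(real \<Rightarrow> real) \<Rightarrow> bool" where
  prod_span_mult: "smooth1 f \<Longrightarrow> smooth1 g \<Longrightarrow> prod_span (\<lambda>t. f t * g t)"
| prod_span_add: "prod_span f \<Longrightarrow> prod_span g \<Longrightarrow> prod_span (\<lambda>t. f t + g t)"

lemma prod_span_deriv: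
  "prod_span f \<Longrightarrow> \<exists>f'. (\<forall>t. (f has_real_derivative f' t) (at t)) \<and> prod_span f'"
proof (induction rule: prod_span.induct)
  case (prod_span_mult f g)
  obtain f' where f': "\<And>t. (f has_real_derivative f' t) (at t)" "smooth1 f'"
    using prod_span_mult(1) by (rule smooth1E) blast
  obtain g' where g': "\<And>t. (g has_real_derivative g' t) (at t)" "smooth1 g'"
    using prod_span_mult(2) by (rule smooth1E) blast
  have "((\<lambda>t. f t * g t) has_real_derivative f' t * g t + g' t * f t) (at t)" for t
    by (rule DERIV_mult[OF f'(1) g'(1)])
  moreover have "prod_span (\<lambda>t. f' t * g t + g' t * f t)"
    by (intro prod_span.intros f' g' prod_span_mult)
  ultimately show ?case
    by (intro exI[of _ "\<lambda>t. f' t * g t + g' t * f t"]) blast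
next
  case (prod_span_add f g)
  then obtain f' g' where "\<forall>t. (f has_real_derivative f' t) (at t)" "prod_span f'"
     "\<forall>t. (g has_real_derivative g' t) (at t)" "prod_span g'" by blast
  then show ?case
    by (intro exI[of _ "\<lambda>t. f' t + g' t"] conjI allI DERIV_add prod_span.prod_span_add) auto
qed

lemma smooth1_mult: "smooth1 f \<Longrightarrow> smooth1 g \<Longrightarrow> smooth1 (\<lambda>t. f t * g t)"
  by (rule smooth1_coinduct[where P = prod_span]) (auto intro: prod_span_mult prod_span_deriv)

text \<open>The classical function exp (-1/t), extended by 0 to t <= 0, with a polynomial in 1/t in
  front. The polynomial makes the family closed under differentiation.\<close>

definition flat_exp :: "real poly \<Rightarrow> real \<Rightarrow> real" where
  "flat_exp p t = (if t > 0 then poly p (1 / t) * exp (- (1 / t)) else 0)"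

text \<open>The power \<open>x ^ k\<close> is there for the induction: in \<open>pCons c p\<close>
  the tail is multiplied by \<open>x\<close>, which raises \<open>k\<close> by one, and the constant
  coefficient leaves a pure power against the exponential.\<close>

lemma poly_exp_decay: "((\<lambda>x::real. x ^ k * poly p x * exp (- x)) \<longlongrightarrow> 0) at_top"
proof (induction p arbitrary: k)
  case 0
  then show ?case by simp
next
  case (pCons c p)
  have "((\<lambda>x::real. c * (x ^ k / exp x)) \<longlongrightarrow> c * 0) at_top"
    by (intro tendsto_mult_left tendsto_power_div_exp_0)
  moreover have "((\<lambda>x. x ^ Suc k * poly p x * exp (- x)) \<longlongrightarrow> 0) at_top"
    by (rule pCons.IH)
  ultimately have "((\<lambda>x::real. c * (x ^ k / exp x) + x ^ Suc k * poly p x * exp (- x)) \<longlongrightarrow> c * 0 + 0) at_top"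
    by (rule tendsto_add)
  moreover have "x ^ k * poly (pCons c p) x * exp (- x) = c * (x ^ k / exp x) + x ^ Suc k * poly p x * exp (- x)" for x :: real
    by (simp add: distrib_left distrib_right exp_minus divide_inverse mult_ac)
  ultimately show ?case by simp
qed

text \<open>With s = 1/t one has ds/dt = - s^2, so p(s) exp (-s) has the derivative s^2 (p(s) -
  p'(s)) exp (-s); this is the origin of the new polynomial.\<close>

lemma flat_exp_deriv:
  "(flat_exp p has_real_derivative flat_exp (monom 1 2 * (p - pderiv p)) t) (at t)"
proof (cases t "0::real" rule: linorder_cases)
  case less
  have "(flat_exp p has_real_derivative 0) (at t)"
    by (rule has_field_derivative_transform_within_open[of "\<lambda>_. 0" _ _ "{..<0}"])
      (use less in \<open>auto simp: flat_exp_def\<close>)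
  then show ?thesis
    using less by (simp add: flat_exp_def)
next
  case greater
  have "((\<lambda>t. poly p (1 / t) * exp (- (1 / t))) has_real_derivative
      flat_exp (monom 1 2 * (p - pderiv p)) t) (at t)"
  proof -
    have d: "((\<lambda>t. 1 / t) has_real_derivative - (1 / t\<^sup>2)) (at t)"
      using greater by (auto intro!: derivative_eq_intros simp: power2_eq_square)
    have "((\<lambda>t. poly p (1 / t) * exp (- (1 / t))) has_real_derivative
        (poly (pderiv p) (1 / t) * (- (1 / t\<^sup>2))) * exp (- (1 / t)) +
        (exp (- (1 / t)) * (- (- (1 / t\<^sup>2)))) * poly p (1 / t)) (at t)"
      by (intro DERIV_mult DERIV_chain2[OF poly_DERIV d] DERIV_chain2[OF DERIV_exp] DERIV_minus[OF d])
    moreover have "(poly (pderiv p) (1 / t) * (- (1 / t\<^sup>2))) * exp (- (1 / t)) +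
        (exp (- (1 / t)) * (- (- (1 / t\<^sup>2)))) * poly p (1 / t) = flat_exp (monom 1 2 * (p - pderiv p)) t"
      using greater by (simp add: flat_exp_def poly_monom power_one_over algebra_simps)
    ultimately show ?thesis by simp
  qed
  then show ?thesis
    by (rule has_field_derivative_transform_within_open[where S = "{0<..}"])
      (use greater in \<open>auto simp: flat_exp_def\<close>)
next
  case equal
  have 1: "((\<lambda>h. flat_exp p h / h) \<longlongrightarrow> 0) (at_right 0)"
  proof -
    \<comment> \<open>Dividing by \<open>h\<close> multiplies the polynomial by 1/h, that is,
      replaces \<open>p\<close> by \<open>pCons 0 p\<close>; the substitution x = 1/h turns the
      limit into one at infinity.\<close>
    have "((\<lambda>h. poly (pCons 0 p) (1 / h) * exp (- (1 / h))) \<longlongrightarrow> 0) (at_right 0)"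
      using poly_exp_decay[of 0 "pCons 0 p"]
      by (intro filterlim_compose[OF _ filterlim_inverse_at_top_right[unfolded inverse_eq_divide]]) simp
    then show ?thesis
      by (rule tendsto_cong[THEN iffD1, rotated])
        (auto simp: eventually_at_right_field flat_exp_def intro!: exI[of _ 1])
  qed
  have 2: "((\<lambda>h. flat_exp p h / h) \<longlongrightarrow> 0) (at_left 0)"
    by (rule tendsto_cong[THEN iffD1, OF _ tendsto_const])
      (auto simp: eventually_at_left_field flat_exp_def intro!: exI[of _ "-1"])
  have "((\<lambda>h. flat_exp p h / h) \<longlongrightarrow> 0) (at 0)"
    using 1 2 by (simp add: filterlim_split_at_real)
  then show ?thesis
    using equal by (simp add: DERIV_def flat_exp_def)
qed

lemma smooth1_flat_exp: "smooth1 (flat_exp p)"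
  by (rule smooth1_coinduct[where P = "\<lambda>f. \<exists>p. f = flat_exp p"]) (auto intro: flat_exp_deriv)

text \<open>The product of exp (-1/s) at s = (n+1)(t-a) and at s = (n+1)(b-t) vanishes outside the
  interval; inside, both arguments grow with n and both factors tend to 1.\<close>

lemma smooth1_bumps:
  obtains f :: "nat \<Rightarrow> real \<Rightarrow> real" where
    "\<And>n. smooth1 (f n)" "\<And>n t. 0 \<le> f n t" "\<And>n t. f n t \<le> 1"
    "\<And>n t. t \<notin> {a<..<b} \<Longrightarrow> f n t = 0"
    "\<And>t. (\<lambda>n. f n t) \<longlonglongrightarrow> indicator {a<..<b} t"
proof
  define f where "f = (\<lambda>n t. flat_exp 1 (real (Suc n) * t + - real (Suc n) * a) *
    flat_exp 1 (- real (Suc n) * t + real (Suc n) * b))"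
  show "smooth1 (f n)" for n
    unfolding f_def by (intro smooth1_mult smooth1_affine smooth1_flat_exp)
  show "0 \<le> f n t" "f n t \<le> 1" for n t
    unfolding f_def by (auto simp: flat_exp_def intro!: mult_le_one)
  have pos: "- (real (Suc n) * t) + real (Suc n) * b > 0 \<longleftrightarrow> t < b"
    "real (Suc n) * t + - (real (Suc n) * a) > 0 \<longleftrightarrow> a < t" for n t
    by (simp_all del: of_nat_Suc)
  show 0: "f n t = 0" if "t \<notin> {a<..<b}" for n t
    using that pos[of n t] unfolding f_def flat_exp_def by (auto simp del: of_nat_Suc)
  show "(\<lambda>n. f n t) \<longlonglongrightarrow> indicator {a<..<b} t" for t
  proof (cases "t \<in> {a<..<b}")
    case False
    then show ?thesis by (simp add: 0)
  next
    case True
    have *: "f n t = exp (- (1 / (t - a) * inverse (real (Suc n)))) * exp (- (1 / (b - t) * inverse (real (Suc n))))" for n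
      using pos[of n t] True by (auto simp del: of_nat_Suc simp: f_def flat_exp_def divide_inverse algebra_simps
         simp flip: inverse_mult_distrib)
    have "(\<lambda>n. f n t) \<longlonglongrightarrow> exp (- (1 / (t - a) * 0)) * exp (- (1 / (b - t) * 0))"
      unfolding * by (intro tendsto_intros LIMSEQ_inverse_real_of_nat)
    then show ?thesis using True by simp
  qed
qed

section \<open>Test functions in the plane as tensor products\<close>

definition tensor :: "(real \<Rightarrow> real) \<Rightarrow> (real \<Rightarrow> real) \<Rightarrow> real^2 \<Rightarrow> real" where
  "tensor f g x = f (x $ 1) * g (x $ 2)"

lemma tensor_has_derivative:
  assumes "(f has_real_derivative f') (at (x $ 1))" "(g has_real_derivative g') (at (x $ 2))"
  shows "(tensor f g has_derivative (\<lambda>v. v $ 1 * (f' * g (x $ 2)) + v $ 2 * (f (x $ 1) * g'))) (at x)"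
proof -
  have "((\<lambda>x. f (x $ 1)) has_derivative (\<lambda>v. v $ 1 * f')) (at x)"
    using assms(1) by (rule DERIV_compose_FDERIV) (intro bounded_linear_imp_has_derivative bounded_linear_vec_nth)
  moreover have "((\<lambda>x. g (x $ 2)) has_derivative (\<lambda>v. v $ 2 * g')) (at x)"
    using assms(2) by (rule DERIV_compose_FDERIV) (intro bounded_linear_imp_has_derivative bounded_linear_vec_nth)
  ultimately have "((\<lambda>x. f (x $ 1) * g (x $ 2)) has_derivative
      (\<lambda>v. f (x $ 1) * (v $ 2 * g') + v $ 1 * f' * g (x $ 2))) (at x)"
    by (rule has_derivative_mult)
  then show ?thesis
    by (simp add: tensor_def[abs_def] algebra_simps)
qed

lemma partial_tensor:
  assumes "\<And>t. (f has_real_derivative f' t) (at t)" "\<And>t. (g has_real_derivative g' t) (at t)"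
  shows "partial 1 (tensor f g) = tensor f' g" "partial 2 (tensor f g) = tensor f g'"
proof -
  have *: "frechet_derivative (tensor f g) (at x) =
      (\<lambda>v. v $ 1 * (f' (x $ 1) * g (x $ 2)) + v $ 2 * (f (x $ 1) * g' (x $ 2)))" for x
    by (rule frechet_derivative_at[OF tensor_has_derivative, symmetric]) (rule assms)+
  show "partial 1 (tensor f g) = tensor f' g" "partial 2 (tensor f g) = tensor f g'"
    by (auto simp: fun_eq_iff partial_def * tensor_def axis_def)
qed

text \<open>Each partial derivative of a tensor product of smooth functions is again such a product,
  so smoothness in the plane reduces to that of the factors.\<close>

lemma smooth_tensor:
  assumes "smooth1 f" "smooth1 g"
  shows "smooth (tensor f g)"
proof -
  have *: "\<exists>f' g'. smooth1 f' \<and> smooth1 g' \<and> partials is (tensor f g) = tensor f' g'" for "is"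
  proof (induction "is")
    case Nil
    then show ?case using assms by (auto simp: partials_def)
  next
    case (Cons i "is")
    then obtain p q where pq: "smooth1 p" "smooth1 q" "partials is (tensor f g) = tensor p q" by blast
    obtain p' where p': "\<And>t. (p has_real_derivative p' t) (at t)" "smooth1 p'"
      using pq(1) by (rule smooth1E) blast
    obtain q' where q': "\<And>t. (q has_real_derivative q' t) (at t)" "smooth1 q'"
      using pq(2) by (rule smooth1E) blast
    have "partials (i # is) (tensor f g) = partial i (tensor p q)"
      using pq(3) by (simp add: partials_def)
    then show ?case
      using partial_tensor[OF p'(1) q'(1)] p' q' pq exhaust_2[of i] by metis
  qed
  then show ?thesis
    unfolding smooth_def
  proof (intro allI)
    fix "is" x
    obtain p q where pq: "smooth1 p" "smooth1 q" "partials is (tensor f g) = tensor p q"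
      using * by blast
    obtain p' where "\<And>t. (p has_real_derivative p' t) (at t)" "smooth1 p'"
      using pq(1) by (rule smooth1E) blast
    moreover obtain q' where "\<And>t. (q has_real_derivative q' t) (at t)" "smooth1 q'"
      using pq(2) by (rule smooth1E) blast
    ultimately show "partials is (tensor f g) differentiable at x"
      unfolding pq(3) by (meson tensor_has_derivative differentiableI)
  qed
qed

lemma test_function_tensor:
  assumes "smooth1 f" "smooth1 g" "\<And>x. x \<notin> cbox a b \<Longrightarrow> tensor f g x = 0" "cbox a b \<subseteq> \<Omega>"
  shows "test_function \<Omega> (tensor f g)"
proof -
  have "closure {x. tensor f g x \<noteq> 0} \<subseteq> cbox a b"
    using assms(3) by (intro closure_minimal) auto
  then show ?thesis
    using assms smooth_tensor unfolding test_function_def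
    by (meson bounded_cbox bounded_subset closed_closure compact_eq_bounded_closed subset_trans)
qed

lemma test_functions_box:
  fixes a b :: "real^2"
  obtains \<phi> :: "nat \<Rightarrow> real^2 \<Rightarrow> real" where
    "\<And>\<Omega> n. cbox a b \<subseteq> \<Omega> \<Longrightarrow> test_function \<Omega> (\<phi> n)"
    "\<And>n x. \<bar>\<phi> n x\<bar> \<le> 1" "\<And>n x. x \<notin> cbox a b \<Longrightarrow> \<phi> n x = 0"
    "\<And>x. (\<lambda>n. \<phi> n x) \<longlonglongrightarrow> indicator (box a b) x"
proof -
  obtain f where f: "\<And>n. smooth1 (f n)" "\<And>n t. 0 \<le> f n t" "\<And>n t. f n t \<le> 1"
    "\<And>n t. t \<notin> {a$1<..<b$1} \<Longrightarrow> f n t = 0" "\<And>t. (\<lambda>n. f n t) \<longlonglongrightarrow> indicator {a$1<..<b$1} t"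
    using smooth1_bumps[of "a$1" "b$1"] by blast
  obtain g where g: "\<And>n. smooth1 (g n)" "\<And>n t. 0 \<le> g n t" "\<And>n t. g n t \<le> 1"
    "\<And>n t. t \<notin> {a$2<..<b$2} \<Longrightarrow> g n t = 0" "\<And>t. (\<lambda>n. g n t) \<longlonglongrightarrow> indicator {a$2<..<b$2} t"
    using smooth1_bumps[of "a$2" "b$2"] by blast
  show thesis
  proof
    show 0: "tensor (f n) (g n) x = 0" if "x \<notin> cbox a b" for n x
      using that f(4)[of "x$1" n] g(4)[of "x$2" n] by (force simp: tensor_def mem_box_cart forall_2)
    show "test_function \<Omega> (tensor (f n) (g n))" if "cbox a b \<subseteq> \<Omega>" for \<Omega> n
      by (rule test_function_tensor[OF f(1) g(1) 0 that])
    show "\<bar>tensor (f n) (g n) x\<bar> \<le> 1" for n x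
      using f(2,3)[of n "x$1"] g(2,3)[of n "x$2"] by (auto simp: tensor_def abs_mult intro!: mult_le_one)
    show "(\<lambda>n. tensor (f n) (g n) x) \<longlonglongrightarrow> indicator (box a b) x" for x
    proof -
      have "indicat_real (box a b) x = indicator {a$1<..<b$1} (x$1) * indicator {a$2<..<b$2} (x$2)"
        by (auto simp: indicator_def mem_box_cart forall_2)
      then show ?thesis
        using tendsto_mult[OF f(5)[of "x$1"] g(5)[of "x$2"]] by (simp add: tensor_def)
    qed
  qed
qed

text \<open>If Q is an antiderivative of a bump, take F(t) = Q(t) - Q(t - s). Its derivative is the
  bump minus its translate by \<open>s\<close>, so in the limit it compares an interval with its
  translate. Since Q rises monotonically by at most b - a, the bound on F does not depend on
  \<open>s\<close>, and the two terms cancel outside the swept interval.\<close>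

lemma sweep_profile:
  fixes a b s :: real
  assumes "a \<le> b" "0 \<le> s"
  obtains F F' :: "nat \<Rightarrow> real \<Rightarrow> real" where
    "\<And>n. smooth1 (F n)" "\<And>n t. (F n has_real_derivative F' n t) (at t)"
    "\<And>n t. \<bar>F n t\<bar> \<le> b - a" "\<And>n t. \<bar>F' n t\<bar> \<le> 1" "\<And>n t. t \<notin> {a..b + s} \<Longrightarrow> F n t = 0"
    "\<And>t. (\<lambda>n. F' n t) \<longlonglongrightarrow> indicator {a<..<b} t - indicator {a + s<..<b + s} t"
proof -
  obtain f where f: "\<And>n. smooth1 (f n)" "\<And>n t. 0 \<le> f n t" "\<And>n t. f n t \<le> 1"
    "\<And>n t. t \<notin> {a<..<b} \<Longrightarrow> f n t = 0" "\<And>t. (\<lambda>n. f n t) \<longlonglongrightarrow> indicator {a<..<b} t"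
    using smooth1_bumps[of a b] by blast
  have "\<exists>Q. \<forall>t. (Q has_real_derivative f n t) (at t)" for n
    using einterval_antiderivative[of "-\<infinity>" "\<infinity>" "f n"] smooth1_continuous[OF f(1), of UNIV n]
    by (simp add: continuous_on_eq_continuous_at has_real_derivative_iff_has_vector_derivative)
  then obtain Q where Q: "\<And>n t. (Q n has_real_derivative f n t) (at t)"
    by metis
  have Q_MVT: "\<exists>z. x < z \<and> z < y \<and> Q n y - Q n x = (y - x) * f n z" if xy: "x < y" for n x y
    using MVT2[OF xy, of "Q n" "f n"] Q by blast
  have Q_diff: "0 \<le> Q n y - Q n x \<and> Q n y - Q n x \<le> y - x" if xy: "x \<le> y" for n x y
  proof (cases "x = y")
    case False
    then obtain z where "Q n y - Q n x = (y - x) * f n z"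
      using Q_MVT[of x y n] xy by auto
    then show ?thesis
      using xy f(2)[of n z] f(3)[of n z] by (simp add: mult_left_le)
  qed simp
  have Q_left: "Q n t = Q n a" if t: "t \<le> a" for n t
  proof (cases "t = a")
    case False
    then obtain z where "z < a" "Q n a - Q n t = (a - t) * f n z"
      using Q_MVT[of t a n] t by auto
    then show ?thesis using f(4)[of z n] by simp
  qed simp
  have Q_right: "Q n t = Q n b" if t: "b \<le> t" for n t
  proof (cases "t = b")
    case False
    then obtain z where "b < z" "Q n t - Q n b = (t - b) * f n z"
      using Q_MVT[of b t n] t by auto
    then show ?thesis using f(4)[of z n] by simp
  qed simp
  have Q_range: "Q n a \<le> Q n t" "Q n t \<le> Q n b" for n t
    using Q_diff[of a t n] Q_diff[of t b n] Q_left[of t n] Q_right[of t n] Q_diff[of a b n] assms(1)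
    by linarith+
  have Q_smooth: "smooth1 (Q n)" for n
    using Q f(1) by (rule smooth1I)
  show thesis
  proof
    show "smooth1 (\<lambda>t. Q n t - Q n (t - s))" for n
      using smooth1_diff[OF Q_smooth[of n] smooth1_affine[OF Q_smooth[of n], where a = 1 and b = "- s"]] by simp
    show "((\<lambda>t. Q n t - Q n (t - s)) has_real_derivative f n t - f n (t - s)) (at t)" for n t
    proof -
      have "((\<lambda>t. t - s) has_real_derivative 1) (at t)"
        by (auto intro!: derivative_eq_intros)
      from DERIV_diff[OF Q DERIV_chain2[OF Q this]] show ?thesis by simp
    qed
    show "\<bar>Q n t - Q n (t - s)\<bar> \<le> b - a" for n t
      using Q_range[of n t] Q_range[of n "t - s"] Q_diff[of a b n] assms by linarith
    show "\<bar>f n t - f n (t - s)\<bar> \<le> 1" for n t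
      using f(2)[of n t] f(2)[of n "t - s"] f(3)[of n t] f(3)[of n "t - s"] by linarith
    show "Q n t - Q n (t - s) = 0" if "t \<notin> {a..b + s}" for n t
    proof (cases "t < a")
      case True
      then show ?thesis using Q_left[of t n] Q_left[of "t - s" n] assms by simp
    next
      case False
      then show ?thesis using that Q_right[of t n] Q_right[of "t - s" n] assms by simp
    qed
    show "(\<lambda>n. f n t - f n (t - s)) \<longlonglongrightarrow> indicator {a<..<b} t - indicator {a + s<..<b + s} t" for t
    proof -
      have "indicat_real {a<..<b} (t - s) = indicator {a + s<..<b + s} t"
        by (auto simp: indicator_def)
      then show ?thesis
        using tendsto_diff[OF f(5)[of t] f(5)[of "t - s"]] by simp
    qed
  qed
qed

text \<open>These functions turn a weak derivative in direction \<open>i\<close> into the difference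
  of the integrals over a box and over its translate by \<open>s\<close>: their partial derivatives
  tend to the difference of the indicators, while they themselves stay bounded by the side
  length.\<close>

lemma test_functions_sweep:
  fixes a b :: "real^2" and i :: 2 and s :: real
  assumes "a $ i \<le> b $ i" "0 \<le> s"
  obtains \<phi> :: "nat \<Rightarrow> real^2 \<Rightarrow> real" where
    "\<And>\<Omega> n. cbox a (b + s *\<^sub>R axis i 1) \<subseteq> \<Omega> \<Longrightarrow> test_function \<Omega> (\<phi> n)"
    "\<And>n x. \<bar>\<phi> n x\<bar> \<le> b $ i - a $ i"
    "\<And>n x. \<bar>partial i (\<phi> n) x\<bar> \<le> 1"
    "\<And>n x. x \<notin> cbox a (b + s *\<^sub>R axis i 1) \<Longrightarrow> \<phi> n x = 0"
    "\<And>n x. x \<notin> cbox a (b + s *\<^sub>R axis i 1) \<Longrightarrow> partial i (\<phi> n) x = 0"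
    "\<And>x. (\<lambda>n. partial i (\<phi> n) x) \<longlonglongrightarrow>
        indicator (box a b) x - indicator (box (a + s *\<^sub>R axis i 1) (b + s *\<^sub>R axis i 1)) x"
proof -
  obtain F F' where F: "\<And>n. smooth1 (F n)" "\<And>n t. (F n has_real_derivative F' n t) (at t)"
    "\<And>n t. \<bar>F n t\<bar> \<le> b$i - a$i" "\<And>n t. \<bar>F' n t\<bar> \<le> 1" "\<And>n t. t \<notin> {a$i..b$i + s} \<Longrightarrow> F n t = 0"
    "\<And>t. (\<lambda>n. F' n t) \<longlonglongrightarrow> indicator {a$i<..<b$i} t - indicator {a$i + s<..<b$i + s} t"
    using sweep_profile[OF assms] by blast
  have F'0: "F' n t = 0" if "t \<notin> {a$i..b$i + s}" for n t
  proof -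
    have "open (- {a$i..b$i + s})" by auto
    then have "(F n has_real_derivative 0) (at t)"
      using that F(5)
      by (rule_tac has_field_derivative_transform_within_open[of "\<lambda>_. 0" _ _ "- {a$i..b$i + s}"]) auto
    then show ?thesis using F(2) DERIV_unique by blast
  qed
  define j where "j = (if i = 1 then 2 else 1 :: 2)"
  obtain g where g: "\<And>n. smooth1 (g n)" "\<And>n t. 0 \<le> g n t" "\<And>n t. g n t \<le> 1"
    "\<And>n t. t \<notin> {a$j<..<b$j} \<Longrightarrow> g n t = 0" "\<And>t. (\<lambda>n. g n t) \<longlonglongrightarrow> indicator {a$j<..<b$j} t"
    using smooth1_bumps[of "a$j" "b$j"] by blast
  define \<phi> where "\<phi> n = (if i = 1 then tensor (F n) (g n) else tensor (g n) (F n))" for n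
  have \<phi>: "\<phi> n x = F n (x $ i) * g n (x $ j)" for n x
    using exhaust_2[of i] by (auto simp: \<phi>_def tensor_def j_def)
  have partial: "partial i (\<phi> n) x = F' n (x $ i) * g n (x $ j)" for n x
  proof -
    obtain g' where "\<And>t. (g n has_real_derivative g' t) (at t)" "smooth1 g'"
      using g(1) by (rule smooth1E) blast
    note * = partial_tensor[OF F(2)[of n] this(1)] partial_tensor[OF this(1) F(2)[of n]]
    show ?thesis
      using exhaust_2[of i] by (auto simp: \<phi>_def * tensor_def j_def)
  qed
  have smooth: "smooth1 (if i = 1 then F n else g n)" "smooth1 (if i = 1 then g n else F n)" for n
    using F(1) g(1) by auto
  have \<phi>_if: "\<phi> n = tensor (if i = 1 then F n else g n) (if i = 1 then g n else F n)" for n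
    by (simp add: \<phi>_def)
  have mem: "x \<in> cbox a (b + s *\<^sub>R axis i 1) \<longleftrightarrow> x $ i \<in> {a$i..b$i + s} \<and> x $ j \<in> {a$j..b$j}"
     "x \<in> box a b \<longleftrightarrow> x $ i \<in> {a$i<..<b$i} \<and> x $ j \<in> {a$j<..<b$j}"
     "x \<in> box (a + s *\<^sub>R axis i 1) (b + s *\<^sub>R axis i 1) \<longleftrightarrow> x $ i \<in> {a$i + s<..<b$i + s} \<and> x $ j \<in> {a$j<..<b$j}" for x
    using exhaust_2[of i] by (auto simp: mem_box_cart forall_2 j_def axis_def)
  have g0: "g n (x $ j) = 0" if "x $ j \<notin> {a$j..b$j}" for n x
    using that by (intro g(4)) auto
  show thesis
  proof
    show 0: "\<phi> n x = 0" if "x \<notin> cbox a (b + s *\<^sub>R axis i 1)" for n x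
      using that F(5)[of "x$i" n] g0[of x n] unfolding mem \<phi> by (cases "x$i \<in> {a$i..b$i + s}") simp_all
    show "test_function \<Omega> (\<phi> n)" if "cbox a (b + s *\<^sub>R axis i 1) \<subseteq> \<Omega>" for \<Omega> n
      using test_function_tensor[OF smooth[of n] _ that] 0 unfolding \<phi>_if by blast
    show "\<bar>\<phi> n x\<bar> \<le> b $ i - a $ i" for n x
    proof -
      have "\<bar>F n (x $ i)\<bar> * \<bar>g n (x $ j)\<bar> \<le> (b $ i - a $ i) * 1"
        using F(3)[of n "x$i"] g(2,3)[of n "x$j"] assms by (intro mult_mono) auto
      then show ?thesis by (simp add: \<phi> abs_mult)
    qed
    show "\<bar>partial i (\<phi> n) x\<bar> \<le> 1" for n x
      using F(4)[of n "x$i"] g(2,3)[of n "x$j"] unfolding partial abs_mult by (intro mult_le_one) auto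
    show "partial i (\<phi> n) x = 0" if "x \<notin> cbox a (b + s *\<^sub>R axis i 1)" for n x
      using that F'0[of "x$i" n] g0[of x n] unfolding mem partial by (cases "x$i \<in> {a$i..b$i + s}") simp_all
    show "(\<lambda>n. partial i (\<phi> n) x) \<longlonglongrightarrow>
        indicator (box a b) x - indicator (box (a + s *\<^sub>R axis i 1) (b + s *\<^sub>R axis i 1)) x" for x
    proof -
      have "indicat_real (box a b) x - indicator (box (a + s *\<^sub>R axis i 1) (b + s *\<^sub>R axis i 1)) x =
          (indicator {a$i<..<b$i} (x$i) - indicator {a$i + s<..<b$i + s} (x$i)) * indicator {a$j<..<b$j} (x$j)"
        by (simp add: indicator_def mem)
      then show ?thesis
        using tendsto_mult[OF F(6)[of "x$i"] g(5)[of "x$j"]] by (simp add: partial)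
    qed
  qed
qed

section \<open>Weak derivatives and their uniqueness\<close>

lemma partials_Cons: "partials (i # is) f = partial i (partials is f)"
  by (simp add: partials_def)

lemma partials_Nil [simp]: "partials [] f = f"
  by (simp add: partials_def)

lemma smooth_continuous_partials: "smooth f \<Longrightarrow> continuous_on A (partials is f)"
  by (simp add: smooth_def differentiable_imp_continuous_within continuous_at_imp_continuous_on)

lemma partials_zero_outside_support:
  assumes "x \<notin> closure {x. f x \<noteq> 0}"
  shows "partials is f x = 0"
  using assms
proof (induction "is" arbitrary: x)
  case Nil
  then have "x \<notin> {x. f x \<noteq> 0}" using closure_subset by (rule contra_subsetD[rotated])
  then show ?case by simp
next
  case (Cons i "is")
  have "((\<lambda>_. 0) has_derivative (\<lambda>v. 0)) (at x)" by simp
  then have "(partials is f has_derivative (\<lambda>v. 0)) (at x)"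
    by (rule has_derivative_transform_within_open[where s = "- closure {x. f x \<noteq> 0}"])
      (use Cons in \<open>auto simp del: closure_closed\<close>)
  from frechet_derivative_at[OF this] show ?case
    by (simp add: partials_Cons partial_def fun_eq_iff)
qed

lemma test_function_partial:
  assumes "test_function \<Omega> \<phi>"
  shows "test_function \<Omega> (partials is \<phi>)"
proof -
  have sub: "closure {x. partials is \<phi> x \<noteq> 0} \<subseteq> closure {x. \<phi> x \<noteq> 0}"
    using partials_zero_outside_support by (intro closure_minimal) blast+
  moreover have "compact (closure {x. partials is \<phi> x \<noteq> 0})"
    using assms sub unfolding test_function_def
    by (meson bounded_subset closed_closure compact_eq_bounded_closed)
  moreover have "smooth (partials is \<phi>)"
    using assms unfolding test_function_def smooth_def partials_def by (metis foldr_append comp_apply)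
  ultimately show ?thesis
    using assms unfolding test_function_def by blast
qed

lemma test_function_bounded:
  assumes "test_function \<Omega> \<phi>"
  obtains B where "B \<ge> 0" "\<And>x. \<bar>\<phi> x\<bar> \<le> B"
proof -
  let ?S = "closure {x. \<phi> x \<noteq> 0}"
  have "compact (\<phi> ` ?S)"
    using assms smooth_continuous_partials[of \<phi> ?S "[]"]
    by (auto simp: test_function_def intro: compact_continuous_image)
  then obtain B where B: "\<And>x. x \<in> ?S \<Longrightarrow> \<bar>\<phi> x\<bar> \<le> B"
    by (force dest!: compact_imp_bounded simp: bounded_iff)
  have "\<bar>\<phi> x\<bar> \<le> max B 0" for x
    using B[of x] partials_zero_outside_support[of x \<phi> "[]"] by fastforce
  then show thesis using that[of "max B 0"] by simp
qed

lemma test_function_measurable: "test_function \<Omega> \<phi> \<Longrightarrow> \<phi> \<in> borel_measurable borel"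
  using smooth_continuous_partials[of \<phi> UNIV "[]"]
  by (auto simp: test_function_def intro: borel_measurable_continuous_onI)

lemma
  assumes "locally_integrable \<Omega> g" "compact S" "S \<subseteq> \<Omega>" "\<psi> \<in> borel_measurable borel"
    "\<And>x. \<bar>\<psi> x\<bar> \<le> B" "\<And>x. x \<notin> S \<Longrightarrow> \<psi> x = 0"
  shows set_integrable_mult_cutoff: "set_integrable lebesgue \<Omega> (\<lambda>x. g x * \<psi> x)"
    and integrable_mult_cutoff: "integrable lebesgue (\<lambda>x. \<psi> x * (indicator S x * g x))"
    and LINT_mult_cutoff: "(LINT x:\<Omega>|lebesgue. g x * \<psi> x) = (LINT x|lebesgue. \<psi> x * (indicator S x * g x))"
proof -
  have g: "integrable lebesgue (\<lambda>x. indicator S x * g x)"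
    using assms by (auto simp: locally_integrable_def set_integrable_def)
  have "\<psi> \<in> borel_measurable lebesgue"
    using assms(4) by (intro measurable_completion) simp
  then have "(\<lambda>x. \<psi> x * (indicator S x * g x)) \<in> borel_measurable lebesgue"
    by (rule borel_measurable_times) (use g in auto)
  then show *: "integrable lebesgue (\<lambda>x. \<psi> x * (indicator S x * g x))"
    by (rule Bochner_Integration.integrable_bound[OF integrable_mult_right[OF g, of B]])
      (use assms(5) in \<open>auto simp: abs_mult intro!: AE_I2 mult_right_mono order_trans[OF _ abs_ge_self]\<close>)
  have **: "(\<lambda>x. indicator \<Omega> x *\<^sub>R (g x * \<psi> x)) = (\<lambda>x. \<psi> x * (indicator S x * g x))"
    using assms(3,6) by (auto simp: fun_eq_iff indicator_def)
  show "set_integrable lebesgue \<Omega> (\<lambda>x. g x * \<psi> x)"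
    using * unfolding set_integrable_def ** .
  show "(LINT x:\<Omega>|lebesgue. g x * \<psi> x) = (LINT x|lebesgue. \<psi> x * (indicator S x * g x))"
    unfolding set_lebesgue_integral_def ** ..
qed

lemma test_function_mult_integrable:
  assumes "locally_integrable \<Omega> g" "test_function \<Omega> \<phi>"
  shows "set_integrable lebesgue \<Omega> (\<lambda>x. g x * \<phi> x)"
proof -
  obtain B where B: "\<And>x. \<bar>\<phi> x\<bar> \<le> B"
    using test_function_bounded[OF assms(2)] by blast
  have 0: "\<phi> x = 0" if "x \<notin> closure {x. \<phi> x \<noteq> 0}" for x
    using partials_zero_outside_support[OF that, of "[]"] by simp
  have S: "compact (closure {x. \<phi> x \<noteq> 0})" "closure {x. \<phi> x \<noteq> 0} \<subseteq> \<Omega>"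
    using assms(2) by (simp_all add: test_function_def)
  show ?thesis
    by (rule set_integrable_mult_cutoff[OF assms(1) S test_function_measurable[OF assms(2)] B 0])
qed

text \<open>Dominated convergence with B |g| on the compact set \<open>S\<close> as majorant. The
  limit may be discontinuous, which is what lets indicators of boxes replace test functions.\<close>

lemma LINT_mult_cutoff_tendsto:
  assumes "locally_integrable \<Omega> g" "compact S" "S \<subseteq> \<Omega>" "\<And>n. \<psi> n \<in> borel_measurable borel"
    "\<And>n x. \<bar>\<psi> n x\<bar> \<le> B" "\<And>n x. x \<notin> S \<Longrightarrow> \<psi> n x = 0" "\<And>x. (\<lambda>n. \<psi> n x) \<longlonglongrightarrow> \<xi> x"
  shows "(\<lambda>n. LINT x:\<Omega>|lebesgue. g x * \<psi> n x) \<longlonglongrightarrow> (LINT x:\<Omega>|lebesgue. g x * \<xi> x)"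
proof -
  have "\<bar>\<xi> x\<bar> \<le> B" for x
    by (rule LIMSEQ_le_const2[OF tendsto_rabs[OF assms(7)[of x]]]) (use assms(5) in auto)
  moreover have "\<xi> x = 0" if "x \<notin> S" for x
    using assms(6)[OF that] assms(7)[of x] by (simp add: LIMSEQ_const_iff)
  moreover have \<xi>: "\<xi> \<in> borel_measurable borel"
    by (rule borel_measurable_LIMSEQ_metric[OF assms(4,7)])
  ultimately have lim: "(LINT x:\<Omega>|lebesgue. g x * \<xi> x) = (LINT x|lebesgue. \<xi> x * (indicator S x * g x))"
    "integrable lebesgue (\<lambda>x. \<xi> x * (indicator S x * g x))"
    using assms(1-3) by (blast intro: LINT_mult_cutoff integrable_mult_cutoff)+
  have g: "integrable lebesgue (\<lambda>x. indicator S x * g x)"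
    using assms by (auto simp: locally_integrable_def set_integrable_def)
  have eq: "(LINT x:\<Omega>|lebesgue. g x * \<psi> n x) = (LINT x|lebesgue. \<psi> n x * (indicator S x * g x))"
    "integrable lebesgue (\<lambda>x. \<psi> n x * (indicator S x * g x))" for n
    using LINT_mult_cutoff[OF assms(1-3), of "\<psi> n" B] integrable_mult_cutoff[OF assms(1-3), of "\<psi> n" B] assms(4-6)
    by auto
  show ?thesis
    unfolding lim(1) eq(1)
  proof (rule integral_dominated_convergence[where w = "\<lambda>x. B * \<bar>indicator S x * g x\<bar>"])
    show "integrable lebesgue (\<lambda>x. B * \<bar>indicator S x * g x\<bar>)"
      using g by (intro integrable_mult_right integrable_abs)
    show "AE x in lebesgue. norm (\<psi> n x * (indicator S x * g x)) \<le> B * \<bar>indicator S x * g x\<bar>" for n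
      using assms(5)[of n] unfolding real_norm_def abs_mult by (intro AE_I2 mult_right_mono) auto
    show "AE x in lebesgue. (\<lambda>n. \<psi> n x * (indicator S x * g x)) \<longlonglongrightarrow> \<xi> x * (indicator S x * g x)"
      by (intro AE_I2 tendsto_intros assms)
  qed (use lim(2) eq(2) in auto)
qed

lemma locally_integrable_box:
  assumes "locally_integrable \<Omega> g" "cbox a b \<subseteq> \<Omega>"
  shows "g integrable_on cbox a b"
    and "(LINT x:\<Omega>|lebesgue. g x * indicator (box a b) x) = integral (cbox a b) g"
proof -
  have c: "set_integrable lebesgue (cbox a b) g"
    using assms by (auto simp: locally_integrable_def)
  then show "g integrable_on cbox a b"
    by (rule set_lebesgue_integral_eq_integral)
  have b: "set_integrable lebesgue (box a b) g"
    by (rule set_integrable_subset[OF c _ box_subset_cbox]) simp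
  have "(\<lambda>x. indicator \<Omega> x *\<^sub>R (g x * indicator (box a b) x)) = (\<lambda>x. indicator (box a b) x *\<^sub>R g x)"
    using assms(2) box_subset_cbox[of a b] by (auto simp: fun_eq_iff indicator_def)
  then have "(LINT x:\<Omega>|lebesgue. g x * indicator (box a b) x) = (LINT x:box a b|lebesgue. g x)"
    by (simp add: set_lebesgue_integral_def)
  also have "\<dots> = integral (cbox a b) g"
    using set_lebesgue_integral_eq_integral(2)[OF b] by (simp add: integral_open_interval)
  finally show "(LINT x:\<Omega>|lebesgue. g x * indicator (box a b) x) = integral (cbox a b) g" .
qed

lemma integral_box_eq_0_if_test_eq_0:
  fixes g :: "real^2 \<Rightarrow> real"
  assumes "locally_integrable \<Omega> g" "cbox a b \<subseteq> \<Omega>"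
    and "\<And>\<phi>. test_function \<Omega> \<phi> \<Longrightarrow> (LINT x:\<Omega>|lebesgue. g x * \<phi> x) = 0"
  shows "integral (cbox a b) g = 0"
proof -
  obtain \<phi> :: "nat \<Rightarrow> real^2 \<Rightarrow> real" where \<phi>:
    "\<And>\<Omega> n. cbox a b \<subseteq> \<Omega> \<Longrightarrow> test_function \<Omega> (\<phi> n)"
    "\<And>n x. \<bar>\<phi> n x\<bar> \<le> 1" "\<And>n x. x \<notin> cbox a b \<Longrightarrow> \<phi> n x = 0"
    "\<And>x. (\<lambda>n. \<phi> n x) \<longlonglongrightarrow> indicator (box a b) x"
    using test_functions_box by blast
  have "(\<lambda>n. LINT x:\<Omega>|lebesgue. g x * \<phi> n x) \<longlonglongrightarrow> (LINT x:\<Omega>|lebesgue. g x * indicator (box a b) x)"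
    by (rule LINT_mult_cutoff_tendsto[OF assms(1) compact_cbox assms(2) _ \<phi>(2-4)])
      (rule test_function_measurable[OF \<phi>(1)[OF subset_UNIV]])
  then show ?thesis
    using assms(3)[OF \<phi>(1)[OF assms(2)]] locally_integrable_box[OF assms(1,2)]
    by (simp add: LIMSEQ_const_iff)
qed

section \<open>Vanishing box integrals and uniqueness of weak derivatives\<close>

lemma One_vec_nth: "(One :: real^2) $ i = 1"
proof -
  have "(One :: real^2) \<bullet> axis i 1 = (\<Sum>b\<in>Basis. b \<bullet> (axis i 1 :: real^2))"
    by (simp only: inner_sum_left)
  also have "\<dots> = (\<Sum>b\<in>Basis. if b = (axis i 1 :: real^2) then 1 else 0)"
    by (intro sum.cong refl inner_Basis) (auto simp: axis_in_Basis_iff)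
  also have "\<dots> = 1" by (simp add: axis_in_Basis_iff)
  finally show ?thesis by (simp only: cart_eq_inner_axis)
qed

lemma cube_in_box:
  fixes a b x :: "real^2"
  assumes "x \<in> box a b"
  obtains d where "d > 0" "\<And>h. 0 < h \<Longrightarrow> h < d \<Longrightarrow> cbox x (x + h *\<^sub>R One) \<subseteq> box a b"
proof -
  define d where "d = min (b$1 - x$1) (b$2 - x$2)"
  show thesis
  proof
    show "d > 0" using assms by (auto simp: d_def mem_box_cart forall_2)
    show "cbox x (x + h *\<^sub>R One) \<subseteq> box a b" if "0 < h" "h < d" for h
      using assms that by (auto simp: d_def mem_box_cart forall_2 One_vec_nth simp del: sum_component)
  qed
qed

text \<open>Lebesgue differentiation: almost everywhere \<open>g x\<close> is the limit of its
  averages over small cubes with lower corner \<open>x\<close>, and these averages vanish. As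
  \<Omega> is a countable union of closed boxes, it suffices to treat one box.\<close>

lemma AE_zero_if_box_integrals_zero:
  fixes g :: "real^2 \<Rightarrow> real"
  assumes "open \<Omega>" "locally_integrable \<Omega> g"
    and zero: "\<And>a b. cbox a b \<subseteq> \<Omega> \<Longrightarrow> integral (cbox a b) g = 0"
  shows "AE x in lebesgue. x \<in> \<Omega> \<longrightarrow> g x = 0"
proof -
  have box: "negligible {x \<in> cbox a b. g x \<noteq> 0}" if ab: "cbox a b \<subseteq> \<Omega>" for a b
  proof -
    \<comment> \<open>The differentiation theorem asks for integrability on every box, hence the
      extension by zero.\<close>
    let ?f = "\<lambda>x. if x \<in> cbox a b then g x else 0"
    have "g integrable_on cbox a b"
      by (rule locally_integrable_box(1)[OF assms(2) ab])
    then have "?f integrable_on UNIV"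
      using integrable_restrict_UNIV by blast
    then have int: "?f integrable_on cbox c d" for c d
      by (rule integrable_on_subcbox) auto
    obtain N where N: "negligible N" "\<And>x e. \<lbrakk>x \<notin> N; 0 < e\<rbrakk> \<Longrightarrow>
        \<exists>d>0. \<forall>h. 0 < h \<and> h < d \<longrightarrow>
          norm (integral (cbox x (x + h *\<^sub>R One)) ?f /\<^sub>R h ^ DIM(real^2) - ?f x) < e"
      by (rule integrable_ccontinuous_explicit[of ?f, OF int]) (rule that)
    have "g x = 0" if x: "x \<in> box a b" "x \<notin> N" for x
    proof (rule ccontr)
      assume "g x \<noteq> 0"
      then obtain d where d: "d > 0" "\<forall>h. 0 < h \<and> h < d \<longrightarrow>
          norm (integral (cbox x (x + h *\<^sub>R One)) ?f /\<^sub>R h ^ DIM(real^2) - ?f x) < \<bar>g x\<bar>"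
        using N(2)[OF x(2), of "\<bar>g x\<bar>"] by auto
      obtain d' where d': "d' > 0" "\<And>h. 0 < h \<Longrightarrow> h < d' \<Longrightarrow> cbox x (x + h *\<^sub>R One) \<subseteq> box a b"
        using cube_in_box[OF x(1)] by blast
      define h where "h = min d d' / 2"
      have h: "0 < h" "h < d" "h < d'" using d d' by (auto simp: h_def)
      have sub: "cbox x (x + h *\<^sub>R One) \<subseteq> cbox a b"
        using d'(2)[OF h(1,3)] box_subset_cbox by blast
      have "integral (cbox x (x + h *\<^sub>R One)) ?f = integral (cbox x (x + h *\<^sub>R One)) g"
        using sub by (intro integral_cong) auto
      also have "\<dots> = 0" using sub ab by (intro zero) auto
      finally have "integral (cbox x (x + h *\<^sub>R One)) ?f = 0" .
      moreover have "?f x = g x" using x box_subset_cbox[of a b] by auto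
      moreover have "norm (integral (cbox x (x + h *\<^sub>R One)) ?f /\<^sub>R h ^ DIM(real^2) - ?f x) < \<bar>g x\<bar>"
        using d(2) h by blast
      ultimately show False by simp
    qed
    then have "{x \<in> cbox a b. g x \<noteq> 0} \<subseteq> N \<union> (cbox a b - box a b)" by blast
    then show ?thesis
      using N(1) negligible_frontier_interval negligible_Un negligible_subset by blast
  qed
  \<comment> \<open>The boxes with rational corners inside \<Omega>: each is indexed by a function
    that assigns a pair of rationals to every basis vector.\<close>
  obtain \<D> where D: "countable \<D>" "\<And>X. X \<in> \<D> \<Longrightarrow> \<exists>a b. X = cbox a b \<and> cbox a b \<subseteq> \<Omega>" "\<Omega> = \<Union>\<D>"
  proof -
    let ?a = "\<lambda>f. (\<Sum>(i::real^2)\<in>Basis. fst (f i) *\<^sub>R i)"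
    let ?b = "\<lambda>f. (\<Sum>(i::real^2)\<in>Basis. snd (f i) *\<^sub>R i)"
    let ?I = "{f\<in>Basis \<rightarrow>\<^sub>E \<rat> \<times> \<rat>. cbox (?a f) (?b f) \<subseteq> \<Omega>}"
    have "countable (Basis \<rightarrow>\<^sub>E (\<rat> \<times> \<rat> :: (real \<times> real) set) :: (real^2 \<Rightarrow> real \<times> real) set)"
      by (intro countable_PiE finite_Basis countable_SIGMA countable_rat)
    then have "countable ?I"
      by (rule countable_subset[rotated]) blast
    show thesis
    proof
      show "countable ((\<lambda>f. cbox (?a f) (?b f)) ` ?I)"
        by (rule countable_image) fact
      show "\<exists>a b. X = cbox a b \<and> cbox a b \<subseteq> \<Omega>" if "X \<in> (\<lambda>f. cbox (?a f) (?b f)) ` ?I" for X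
        using that by blast
      show "\<Omega> = \<Union>((\<lambda>f. cbox (?a f) (?b f)) ` ?I)"
        by (rule open_UNION_cbox[OF assms(1)])
    qed
  qed
  have "{x \<in> \<Omega>. g x \<noteq> 0} = \<Union>((\<lambda>X. {x \<in> X. g x \<noteq> 0}) ` \<D>)"
    unfolding D(3) by blast
  moreover have "negligible (\<Union>((\<lambda>X. {x \<in> X. g x \<noteq> 0}) ` \<D>))"
  proof (rule negligible_countable_Union)
    show "negligible S" if S: "S \<in> (\<lambda>X. {x \<in> X. g x \<noteq> 0}) ` \<D>" for S
    proof -
      obtain X where X: "X \<in> \<D>" "S = {x \<in> X. g x \<noteq> 0}" using S by auto
      then show ?thesis using D(2)[OF X(1)] box by auto
    qed
  qed (use D(1) in auto)
  ultimately have "{x \<in> \<Omega>. g x \<noteq> 0} \<in> null_sets lebesgue"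
    by (simp add: negligible_iff_null_sets)
  then show ?thesis
    by (rule AE_I') auto
qed

lemma locally_integrable_diff:
  "locally_integrable \<Omega> f \<Longrightarrow> locally_integrable \<Omega> g \<Longrightarrow> locally_integrable \<Omega> (\<lambda>x. f x - g x)"
  by (auto simp: locally_integrable_def)

lemma weak_derivative_diff:
  assumes "weak_derivative \<Omega> is u f" "weak_derivative \<Omega> is w g"
  shows "weak_derivative \<Omega> is (\<lambda>x. u x - w x) (\<lambda>x. f x - g x)"
  unfolding weak_derivative_def
proof (intro conjI allI impI)
  show "locally_integrable \<Omega> (\<lambda>x. u x - w x)" "locally_integrable \<Omega> (\<lambda>x. f x - g x)"
    using assms by (auto simp: weak_derivative_def intro: locally_integrable_diff)
  fix \<phi> assume \<phi>: "test_function \<Omega> \<phi>"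
  have "(LINT x:\<Omega>|lebesgue. u x * partials is \<phi> x - w x * partials is \<phi> x) =
      (LINT x:\<Omega>|lebesgue. u x * partials is \<phi> x) - (LINT x:\<Omega>|lebesgue. w x * partials is \<phi> x)"
    using assms test_function_partial[OF \<phi>, of "is"]
    by (intro set_integral_diff) (auto simp: weak_derivative_def intro: test_function_mult_integrable)
  moreover have "(LINT x:\<Omega>|lebesgue. f x * \<phi> x - g x * \<phi> x) =
      (LINT x:\<Omega>|lebesgue. f x * \<phi> x) - (LINT x:\<Omega>|lebesgue. g x * \<phi> x)"
    using assms \<phi> by (intro set_integral_diff) (auto simp: weak_derivative_def intro: test_function_mult_integrable)
  ultimately show "(LINT x:\<Omega>|lebesgue. (u x - w x) * partials is \<phi> x) =
      (- 1) ^ length is * (LINT x:\<Omega>|lebesgue. (f x - g x) * \<phi> x)"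
    using assms \<phi> by (simp add: weak_derivative_def left_diff_distrib right_diff_distrib)
qed

text \<open>The difference of two weak derivatives of \<open>u\<close> is a weak derivative of
  \<open>u - u\<close>, so its integral against every test function is zero.\<close>

lemma weak_derivative_unique:
  assumes "open \<Omega>" "weak_derivative \<Omega> is u f" "weak_derivative \<Omega> is u g"
  shows "AE x in lebesgue. x \<in> \<Omega> \<longrightarrow> f x = g x"
proof -
  have d: "weak_derivative \<Omega> is (\<lambda>x. u x - u x) (\<lambda>x. f x - g x)"
    by (rule weak_derivative_diff[OF assms(2,3)])
  have "(LINT x:\<Omega>|lebesgue. (f x - g x) * \<phi> x) = 0" if "test_function \<Omega> \<phi>" for \<phi>
  proof -
    have "(LINT x:\<Omega>|lebesgue. (u x - u x) * partials is \<phi> x) = 0"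
      by (simp add: set_lebesgue_integral_def)
    then show ?thesis
      using d that unfolding weak_derivative_def by simp
  qed
  moreover have "locally_integrable \<Omega> (\<lambda>x. f x - g x)"
    using d by (simp add: weak_derivative_def)
  ultimately have "AE x in lebesgue. x \<in> \<Omega> \<longrightarrow> f x - g x = 0"
    using assms(1) by (intro AE_zero_if_box_integrals_zero integral_box_eq_0_if_test_eq_0) auto
  then show ?thesis by simp
qed

lemma weak_derivative_AE_cong:
  assumes "weak_derivative \<Omega> is w g" "locally_integrable \<Omega> u" "AE x in lebesgue. x \<in> \<Omega> \<longrightarrow> u x = w x"
  shows "weak_derivative \<Omega> is u g"
  unfolding weak_derivative_def
proof (intro conjI allI impI)
  show "locally_integrable \<Omega> u" "locally_integrable \<Omega> g"
    using assms by (auto simp: weak_derivative_def)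
  fix \<phi> assume \<phi>: "test_function \<Omega> \<phi>"
  have "(LINT x:\<Omega>|lebesgue. u x * partials is \<phi> x) = (LINT x:\<Omega>|lebesgue. w x * partials is \<phi> x)"
    unfolding set_lebesgue_integral_def
  proof (rule integral_cong_AE)
    have "set_integrable lebesgue \<Omega> (\<lambda>x. u x * partials is \<phi> x)"
      "set_integrable lebesgue \<Omega> (\<lambda>x. w x * partials is \<phi> x)"
      using assms test_function_partial[OF \<phi>, of "is"]
      by (auto simp: weak_derivative_def intro: test_function_mult_integrable)
    then show "(\<lambda>x. indicator \<Omega> x *\<^sub>R (u x * partials is \<phi> x)) \<in> borel_measurable lebesgue"
      "(\<lambda>x. indicator \<Omega> x *\<^sub>R (w x * partials is \<phi> x)) \<in> borel_measurable lebesgue"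
      by (auto simp: set_integrable_def)
    show "AE x in lebesgue. indicator \<Omega> x *\<^sub>R (u x * partials is \<phi> x) =
        indicator \<Omega> x *\<^sub>R (w x * partials is \<phi> x)"
      using assms(3) by eventually_elim (auto simp: indicator_def)
  qed
  then show "(LINT x:\<Omega>|lebesgue. u x * partials is \<phi> x) =
      (- 1) ^ length is * (LINT x:\<Omega>|lebesgue. g x * \<phi> x)"
    using assms(1) \<phi> by (simp add: weak_derivative_def)
qed

lemma locally_integrable_bounded:
  assumes "set_borel_measurable lebesgue \<Omega> f" "AE x in lebesgue. x \<in> \<Omega> \<longrightarrow> \<bar>f x\<bar> \<le> M"
  shows "locally_integrable \<Omega> f"
  unfolding locally_integrable_def
proof (intro allI impI)
  fix K assume K: "compact K \<and> K \<subseteq> \<Omega>"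
  have "K \<in> lmeasurable"
    using K lmeasurable_compact by blast
  then have I: "integrable lebesgue (\<lambda>x. M * indicat_real K x)"
    by (intro integrable_mult_right integrable_real_indicator) (auto simp: fmeasurable_def)
  have eq: "indicator K x *\<^sub>R f x = indicator K x * (indicator \<Omega> x *\<^sub>R f x)" for x
    using K by (auto simp: indicator_def)
  have "K \<in> sets lebesgue" using \<open>K \<in> lmeasurable\<close> by (rule fmeasurableD)
  then have "(\<lambda>x. indicator K x *\<^sub>R f x) \<in> borel_measurable lebesgue"
    using assms(1) unfolding eq set_borel_measurable_def
    by (intro borel_measurable_times borel_measurable_indicator)
  then show "set_integrable lebesgue K f"
    unfolding set_integrable_def
  proof (rule Bochner_Integration.integrable_bound[OF I])
    show "AE x in lebesgue. norm (indicator K x *\<^sub>R f x) \<le> norm (M * indicat_real K x)"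
      using assms(2) by eventually_elim (use K in \<open>auto simp: indicator_def\<close>)
  qed
qed

section \<open>Weak derivatives of Lipschitz functions\<close>

lemma LINT_lborel_translate:
  fixes F :: "'a::euclidean_space \<Rightarrow> real"
  assumes "F \<in> borel_measurable borel"
  shows "(LINT x|lborel. F (x + c)) = (LINT x|lborel. F x)"
proof -
  have "(LINT x|lborel. F x) = (LINT x|distr lborel borel ((+) c). F x)"
    by (simp add: lborel_distr_plus)
  also have "\<dots> = (LINT x|lborel. F (c + x))"
    using assms by (intro integral_distr) auto
  finally show ?thesis by (simp add: add.commute)
qed

lemma has_derivative_directional_quotient:
  fixes f :: "'a::real_normed_vector \<Rightarrow> real"
  assumes f: "(f has_derivative f') (at x)" and t: "t \<longlonglongrightarrow> 0" "\<And>k. t k \<noteq> 0"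
  shows "(\<lambda>k. (f (x + t k *\<^sub>R e) - f x) / t k) \<longlonglongrightarrow> f' e"
proof -
  have "((\<lambda>s. x + s *\<^sub>R e) has_derivative (\<lambda>s. s *\<^sub>R e)) (at 0)"
    by (auto intro!: derivative_eq_intros)
  moreover have "(f has_derivative f') (at (x + 0 *\<^sub>R e))"
    using f by simp
  ultimately have "((\<lambda>s. f (x + s *\<^sub>R e)) has_derivative (\<lambda>s. f' (s *\<^sub>R e))) (at 0)"
    by (rule has_derivative_compose)
  then have "((\<lambda>s. f (x + s *\<^sub>R e)) has_real_derivative f' e) (at 0)"
    using has_derivative_linear[OF f]
    by (simp add: has_field_derivative_def linear_scale mult_commute_abs)
  then have "((\<lambda>s. (f (x + s *\<^sub>R e) - f x) / s) \<longlongrightarrow> f' e) (at 0)"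
    by (simp add: DERIV_def)
  moreover have "filterlim t (at 0) sequentially"
    using t by (simp add: filterlim_at)
  ultimately show ?thesis
    by (rule filterlim_compose)
qed

lemma test_function_directional_lipschitz:
  assumes "test_function \<Omega> \<phi>" "\<And>x. \<bar>partial i \<phi> x\<bar> \<le> B"
  shows "\<bar>\<phi> (x + t *\<^sub>R axis i 1) - \<phi> x\<bar> \<le> B * \<bar>t\<bar>"
proof -
  define g where "g s = \<phi> (x + s *\<^sub>R axis i 1)" for s
  have d: "(g has_real_derivative partial i \<phi> (x + s *\<^sub>R axis i 1)) (at s)" for s
  proof -
    have "\<phi> differentiable (at (x + s *\<^sub>R axis i 1))"
      using assms(1) partials_Nil unfolding test_function_def smooth_def by metis
    then have \<phi>: "(\<phi> has_derivative frechet_derivative \<phi> (at (x + s *\<^sub>R axis i 1))) (at (x + s *\<^sub>R axis i 1))"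
      by (simp add: frechet_derivative_works)
    have "((\<lambda>s. x + s *\<^sub>R axis i 1) has_derivative (\<lambda>s. s *\<^sub>R axis i 1)) (at s)"
      by (auto intro!: derivative_eq_intros)
    from has_derivative_compose[OF this \<phi>] show ?thesis
      using has_derivative_linear[OF \<phi>]
      by (simp add: has_field_derivative_def g_def[abs_def] partial_def linear_scale mult_commute_abs)
  qed
  have "norm (g t - g 0) \<le> B * norm (t - 0)"
    by (rule field_differentiable_bound[of UNIV g]) (use d assms(2) in auto)
  then show ?thesis by (simp add: g_def)
qed

text \<open>Integration by parts from translation invariance: the difference quotients of
  \<open>w * \<phi>\<close> have integral zero, converge almost everywhere to the product rule
  expression, and are bounded with support in a fixed compact set, so the limit has integral zero
  too. The Lipschitz bound is asked for along segments in \<Omega>, since \<Omega> need not be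
  convex.\<close>

lemma weak_derivative_of_lipschitz:
  fixes w :: "real^2 \<Rightarrow> real" and D :: "real^2 \<Rightarrow> real^2"
  assumes "open \<Omega>"
    and lip: "\<And>x y. closed_segment x y \<subseteq> \<Omega> \<Longrightarrow> \<bar>w x - w y\<bar> \<le> L * norm (x - y)"
    and bnd: "\<And>x. x \<in> \<Omega> \<Longrightarrow> \<bar>w x\<bar> \<le> B"
    and Z: "negligible Z"
    and der: "\<And>x. x \<in> \<Omega> \<Longrightarrow> x \<notin> Z \<Longrightarrow> (w has_derivative (\<lambda>v. D x \<bullet> v)) (at x)"
    and D: "locally_integrable \<Omega> (\<lambda>x. D x $ i)"
  shows "weak_derivative \<Omega> [i] w (\<lambda>x. D x $ i)"
proof -
  have w_ball: "\<bar>w x - w y\<bar> \<le> L * norm (x - y)" if "x \<in> ball z d" "y \<in> ball z d" "ball z d \<subseteq> \<Omega>" for x y z d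
    using closed_segment_subset[OF that(1,2) convex_ball] that(3) by (intro lip) blast
  have "continuous_on \<Omega> w"
  proof (rule continuous_at_imp_continuous_on, rule ballI)
    fix z assume "z \<in> \<Omega>"
    then obtain d where d: "d > 0" "ball z d \<subseteq> \<Omega>"
      using assms(1) open_contains_ball by blast
    have "(max L 0)-lipschitz_on (ball z d) w"
    proof (rule lipschitz_onI)
      fix x y assume xy: "x \<in> ball z d" "y \<in> ball z d"
      have "L * norm (x - y) \<le> max L 0 * norm (x - y)" by (intro mult_right_mono) auto
      then show "dist (w x) (w y) \<le> max L 0 * dist x y"
        using w_ball[OF xy d(2)] by (simp add: dist_norm)
    qed simp
    then show "isCont w z"
      using d by (intro continuous_on_interior[of "ball z d"] lipschitz_on_continuous_on) auto
  qed
  then have w_meas: "(\<lambda>x. indicator \<Omega> x *\<^sub>R w x) \<in> borel_measurable borel"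
    using assms(1) by (intro borel_measurable_continuous_on_indicator) auto
  then have wl: "locally_integrable \<Omega> w"
    using bnd by (intro locally_integrable_bounded[of _ _ B])
      (auto simp: set_borel_measurable_def intro: measurable_completion)
  show ?thesis
    unfolding weak_derivative_def
  proof (intro conjI allI impI wl D)
    fix \<phi> assume \<phi>: "test_function \<Omega> \<phi>"
    define S where "S = closure {x. \<phi> x \<noteq> 0}"
    have S: "compact S" "S \<subseteq> \<Omega>" using \<phi> by (auto simp: S_def test_function_def)
    have \<phi>0: "\<phi> x = 0" "partial i \<phi> x = 0" if "x \<notin> S" for x
      using that partials_zero_outside_support[of x \<phi> "[]"] partials_zero_outside_support[of x \<phi> "[i]"]
      by (auto simp: S_def partials_Cons)
    have \<phi>': "test_function \<Omega> (partial i \<phi>)"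
      using test_function_partial[OF \<phi>, of "[i]"] by (simp add: partials_Cons)
    obtain P where P: "P \<ge> 0" "\<And>x. \<bar>\<phi> x\<bar> \<le> P"
      using test_function_bounded[OF \<phi>] by blast
    obtain P' where P': "P' \<ge> 0" "\<And>x. \<bar>partial i \<phi> x\<bar> \<le> P'"
      using test_function_bounded[OF \<phi>'] by blast
    \<comment> \<open>A margin around the support: a translation by less than \<open>d\<close> that
      starts or ends in \<open>S\<close> stays inside \<Omega>.\<close>
    obtain d where d: "d > 0" "(\<Union>x\<in>S. ball x d) \<subseteq> \<Omega>"
      using compact_subset_open_imp_ball_epsilon_subset[OF S(1) assms(1) S(2)] by blast
    define e :: "real^2" where "e = axis i 1"
    have e: "norm e = 1" by (simp add: e_def)
    define t where "t k = d / 2 * inverse (real (Suc k))" for k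
    have t: "t \<longlonglongrightarrow> 0" "\<And>k. 0 < t k" "\<And>k. t k < d"
    proof -
      have "(\<lambda>k. d / 2 * inverse (real (Suc k))) \<longlonglongrightarrow> d / 2 * 0"
        by (intro tendsto_intros LIMSEQ_inverse_real_of_nat)
      then show "t \<longlonglongrightarrow> 0" by (simp add: t_def[abs_def])
      show "0 < t k" for k using d by (simp add: t_def)
      have "inverse (real (Suc k)) \<le> 1" for k by (simp add: inverse_le_1_iff)
      then have *: "d / 2 * inverse (real (Suc k)) \<le> d / 2 * 1" for k
        using d by (intro mult_left_mono) auto
      show "t k < d" for k unfolding t_def using d *[of k] by linarith
    qed
    \<comment> \<open>The product is extended by zero to the whole plane, where Lebesgue measure is
      translation invariant.\<close>
    define F where "F x = (indicator \<Omega> x *\<^sub>R w x) * \<phi> x" for x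
    have F_meas: "F \<in> borel_measurable borel"
      unfolding F_def[abs_def] by (intro borel_measurable_times w_meas test_function_measurable[OF \<phi>])
    have F_lim: "integrable lborel F"
    proof -
      have "integrable lborel (\<lambda>x. (B * P) * indicat_real S x)"
        using S(1) by (intro integrable_mult_right integrable_real_indicator emeasure_compact_finite) (auto intro: borel_compact)
      then show ?thesis
      proof (rule Bochner_Integration.integrable_bound)
        show "AE x in lborel. norm (F x) \<le> norm (B * P * indicat_real S x)"
        proof (intro AE_I2)
          fix x
          have "\<bar>w x\<bar> * \<bar>\<phi> x\<bar> \<le> \<bar>B\<bar> * \<bar>P\<bar>" if "x \<in> S"
            using that S(2) bnd[of x] P(2)[of x] by (intro mult_mono) (auto intro: order_trans[OF _ abs_ge_self])
          then show "norm (F x) \<le> norm (B * P * indicat_real S x)"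
            using \<phi>0(1)[of x] S(2) by (cases "x \<in> S") (auto simp: F_def abs_mult indicator_def)
        qed
      qed (use F_meas in simp)
    qed
    define f where "f k x = (F (x + t k *\<^sub>R e) - F x) / t k" for k x
    have f_meas: "f k \<in> borel_measurable borel" for k
      unfolding f_def[abs_def] using F_meas by measurable
    have f_int: "(LINT x|lebesgue. f k x) = 0" for k
    proof -
      have "integrable lborel (\<lambda>x. F (x + t k *\<^sub>R e))"
        using F_lim F_meas integrable_distr_eq[of "(+) (t k *\<^sub>R e)" lborel borel F]
        by (simp add: lborel_distr_plus add.commute)
      then have "(LINT x|lborel. f k x) = 0"
        using F_lim LINT_lborel_translate[OF F_meas] by (simp add: f_def)
      then show ?thesis
        using f_meas by (simp add: integral_completion)
    qed
    \<comment> \<open>\<open>K\<close> is the product rule bound for the difference quotients, and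
      \<open>S'\<close> contains every point at which one of them can be nonzero.\<close>
    define K where "K = L * P + B * P'"
    define S' where "S' = {x + y | x y. x \<in> S \<and> y \<in> cball 0 d}"
    have "compact S'" unfolding S'_def using S(1) by (intro compact_sums) auto
    define \<xi> where "\<xi> x = indicator \<Omega> x * (w x * partial i \<phi> x + D x $ i * \<phi> x)" for x
    have wi: "set_integrable lebesgue \<Omega> (\<lambda>x. w x * partial i \<phi> x)"
      and Di: "set_integrable lebesgue \<Omega> (\<lambda>x. D x $ i * \<phi> x)"
      using test_function_mult_integrable[OF wl \<phi>'] test_function_mult_integrable[OF D \<phi>] .
    have far: "x \<in> \<Omega> \<and> x + s *\<^sub>R e \<in> \<Omega> \<and> closed_segment x (x + s *\<^sub>R e) \<subseteq> \<Omega> \<and> x \<in> S'"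
      if s: "0 \<le> s" "s < d" and xs: "x \<in> S \<or> x + s *\<^sub>R e \<in> S" for x s
    proof -
      from xs obtain z where z: "z \<in> S" "x \<in> ball z d" "x + s *\<^sub>R e \<in> ball z d"
        using s e d(1) by (auto simp: dist_norm)
      then have sub: "closed_segment x (x + s *\<^sub>R e) \<subseteq> ball z d"
        by (intro closed_segment_subset) auto
      have "x = z + (x - z)" "x - z \<in> cball 0 d"
        using z(2) by (auto simp: dist_norm norm_minus_commute)
      then have "x \<in> S'" using z(1) unfolding S'_def by blast
      moreover have "ball z d \<subseteq> \<Omega>" using d(2) z(1) by blast
      ultimately show ?thesis using sub z by blast
    qed
    have f_bound: "norm (f k x) \<le> K * indicator S' x" for k x
    proof (cases "x \<in> S \<or> x + t k *\<^sub>R e \<in> S")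
      case False
      \<comment> \<open>The majorant has to be nonnegative. The signs of \<open>L\<close> and
        \<open>B\<close> follow from the hypotheses once the support has a point; with empty
        \<open>S'\<close> the majorant is zero.\<close>
      have "L \<ge> 0 \<or> S' = {}" 
      proof (rule disjCI)
        assume "S' \<noteq> {}"
        then obtain z where "z \<in> S" unfolding S'_def by blast
        then have "closed_segment z (z + t 0 *\<^sub>R e) \<subseteq> \<Omega>" using far[of "t 0" z] t(2,3)[of 0] by auto
        then have "0 \<le> L * t 0" using lip[of z "z + t 0 *\<^sub>R e"] e t(2)[of 0] by auto
        then show "L \<ge> 0" using t(2)[of 0] by (simp add: zero_le_mult_iff)
      qed
      moreover have "B \<ge> 0 \<or> S' = {}"
      proof (rule disjCI)
        assume "S' \<noteq> {}"
        then obtain z where "z \<in> S" unfolding S'_def by blast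
        then show "B \<ge> 0" using bnd[of z] S(2) by fastforce
      qed
      ultimately have "0 \<le> K * indicator S' x"
        using P P' unfolding K_def by (cases "S' = {}") auto
      moreover have "f k x = 0" using False \<phi>0 by (simp add: f_def F_def)
      ultimately show ?thesis by simp
    next
      case True
      let ?y = "x + t k *\<^sub>R e"
      have *: "x \<in> \<Omega>" "?y \<in> \<Omega>" "closed_segment x ?y \<subseteq> \<Omega>" "x \<in> S'"
        using far[of "t k" x] t(2,3)[of k] True by auto
      have "\<bar>w ?y - w x\<bar> \<le> L * t k"
        using lip[of ?y x] *(3) t(2)[of k] e by (simp add: closed_segment_commute)
      then have 1: "\<bar>w ?y - w x\<bar> * \<bar>\<phi> ?y\<bar> \<le> L * t k * P"
        using P by (intro mult_mono) auto
      have "\<bar>\<phi> ?y - \<phi> x\<bar> \<le> P' * t k"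
        using test_function_directional_lipschitz[OF \<phi> P'(2), of x "t k"] t(2)[of k] by (simp add: e_def)
      then have 2: "\<bar>w x\<bar> * \<bar>\<phi> ?y - \<phi> x\<bar> \<le> B * (P' * t k)"
        using bnd[OF *(1)] by (intro mult_mono) auto
      have "F ?y - F x = (w ?y - w x) * \<phi> ?y + w x * (\<phi> ?y - \<phi> x)"
        using * by (simp add: F_def algebra_simps)
      then have "\<bar>F ?y - F x\<bar> \<le> \<bar>w ?y - w x\<bar> * \<bar>\<phi> ?y\<bar> + \<bar>w x\<bar> * \<bar>\<phi> ?y - \<phi> x\<bar>"
        by (metis abs_mult abs_triangle_ineq)
      also have "\<dots> \<le> K * t k" using 1 2 by (simp add: K_def algebra_simps)
      finally show ?thesis
        using t(2)[of k] *(4) by (simp add: f_def divide_le_eq)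
    qed
    have lim: "(\<lambda>k. f k x) \<longlonglongrightarrow> \<xi> x" if "x \<notin> Z" for x
    proof (cases "x \<in> \<Omega>")
      case False
      have "f k x = 0" for k
      proof -
        have "x + t k *\<^sub>R e \<notin> S" using far[of "t k" x] t(2,3)[of k] False by auto
        moreover have "x \<notin> S" using False S by auto
        ultimately show ?thesis using \<phi>0 by (simp add: f_def F_def)
      qed
      then show ?thesis using False by (simp add: \<xi>_def)
    next
      case True
      have "\<phi> differentiable (at x)"
        using \<phi> partials_Nil unfolding test_function_def smooth_def by metis
      then have "(\<phi> has_derivative frechet_derivative \<phi> (at x)) (at x)"
        by (simp add: frechet_derivative_works)
      then have "((\<lambda>y. w y * \<phi> y) has_derivative
          (\<lambda>v. w x * frechet_derivative \<phi> (at x) v + (D x \<bullet> v) * \<phi> x)) (at x)"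
        by (rule has_derivative_mult[OF der[OF True that]])
      then have "(F has_derivative (\<lambda>v. w x * frechet_derivative \<phi> (at x) v + (D x \<bullet> v) * \<phi> x)) (at x)"
        by (rule has_derivative_transform_within_open[where s = \<Omega>]) (use assms(1) True in \<open>auto simp: F_def\<close>)
      then have "(\<lambda>k. (F (x + t k *\<^sub>R e) - F x) / t k) \<longlonglongrightarrow> w x * frechet_derivative \<phi> (at x) e + (D x \<bullet> e) * \<phi> x"
        by (rule has_derivative_directional_quotient) (use t in \<open>auto simp: less_imp_neq[symmetric]\<close>)
      then show ?thesis
        using True by (simp add: f_def \<xi>_def partial_def e_def inner_axis)
    qed
    have "(\<lambda>k. LINT x|lebesgue. f k x) \<longlonglongrightarrow> (LINT x|lebesgue. \<xi> x)"
    proof (rule integral_dominated_convergence[where w = "\<lambda>x. K * indicator S' x"])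
      have "set_integrable lebesgue \<Omega> (\<lambda>x. w x * partial i \<phi> x + D x $ i * \<phi> x)"
        using wi Di by (rule set_integral_add)
      then show "\<xi> \<in> borel_measurable lebesgue"
        by (simp add: set_integrable_def \<xi>_def[abs_def])
      show "f k \<in> borel_measurable lebesgue" for k
        using f_meas by (intro measurable_completion) simp
      show "integrable lebesgue (\<lambda>x. K * indicat_real S' x)"
        using lmeasurable_compact[OF \<open>compact S'\<close>]
        by (intro integrable_mult_right integrable_real_indicator) (auto simp: fmeasurable_def)
      have "Z \<in> null_sets lebesgue" using Z by (simp add: negligible_iff_null_sets)
      then show "AE x in lebesgue. (\<lambda>k. f k x) \<longlonglongrightarrow> \<xi> x"
        by (rule AE_I') (use lim in auto)
    qed (use f_bound in auto)
    then have "(LINT x|lebesgue. \<xi> x) = 0"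
      by (simp add: f_int LIMSEQ_const_iff)
    moreover have "(LINT x|lebesgue. \<xi> x) = (LINT x:\<Omega>|lebesgue. w x * partial i \<phi> x + D x $ i * \<phi> x)"
      by (simp add: set_lebesgue_integral_def \<xi>_def)
    ultimately show "(LINT x:\<Omega>|lebesgue. w x * partials [i] \<phi> x) =
        (- 1) ^ length [i] * (LINT x:\<Omega>|lebesgue. D x $ i * \<phi> x)"
      using set_integral_add(2)[OF wi Di] by (simp add: partials_Cons)
  qed
qed

section \<open>Bounded weak derivatives and cube averages\<close>

text \<open>Test the weak derivative with the sweeping functions and pass to the limit: one side
  becomes the difference of the two integrals, the other is at most the side length times
  \<open>M\<close> times the area of the swept box.\<close>

lemma box_translate_weak_derivative_bound:
  fixes w g :: "real^2 \<Rightarrow> real"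
  assumes wd: "weak_derivative \<Omega> [i] w g" and s: "0 \<le> s" and ab: "a $ i \<le> b $ i"
    and sub: "cbox a (b + s *\<^sub>R axis i 1) \<subseteq> \<Omega>"
    and bnd: "AE x in lebesgue. x \<in> cbox a (b + s *\<^sub>R axis i 1) \<longrightarrow> \<bar>g x\<bar> \<le> M"
  shows "\<bar>integral (cbox a b) w - integral (cbox (a + s *\<^sub>R axis i 1) (b + s *\<^sub>R axis i 1)) w\<bar> \<le>
      (b $ i - a $ i) * M * measure lebesgue (cbox a (b + s *\<^sub>R axis i 1))"
proof -
  define S where "S = cbox a (b + s *\<^sub>R axis i 1)"
  obtain \<phi> :: "nat \<Rightarrow> real^2 \<Rightarrow> real" where \<phi>:
    "\<And>\<Omega> n. S \<subseteq> \<Omega> \<Longrightarrow> test_function \<Omega> (\<phi> n)"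
    "\<And>n x. \<bar>\<phi> n x\<bar> \<le> b $ i - a $ i"
    "\<And>n x. \<bar>partial i (\<phi> n) x\<bar> \<le> 1"
    "\<And>n x. x \<notin> S \<Longrightarrow> \<phi> n x = 0" "\<And>n x. x \<notin> S \<Longrightarrow> partial i (\<phi> n) x = 0"
    "\<And>x. (\<lambda>n. partial i (\<phi> n) x) \<longlonglongrightarrow>
        indicator (box a b) x - indicator (box (a + s *\<^sub>R axis i 1) (b + s *\<^sub>R axis i 1)) x"
    using test_functions_sweep[OF ab s] unfolding S_def by blast
  have S: "compact S" "S \<subseteq> \<Omega>" using sub by (auto simp: S_def)
  have w: "locally_integrable \<Omega> w" and g: "locally_integrable \<Omega> g"
    using wd by (auto simp: weak_derivative_def)
  have test: "test_function \<Omega> (\<phi> n)" for n by (rule \<phi>(1)[OF S(2)])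
  have meas: "partial i (\<phi> n) \<in> borel_measurable borel" for n
    using test_function_measurable[OF test_function_partial[OF test, of "[i]"]] by (simp add: partials_Cons)
  have "(\<lambda>n. LINT x:\<Omega>|lebesgue. w x * partial i (\<phi> n) x) \<longlonglongrightarrow>
      (LINT x:\<Omega>|lebesgue. w x * (indicator (box a b) x - indicator (box (a + s *\<^sub>R axis i 1) (b + s *\<^sub>R axis i 1)) x))"
    by (rule LINT_mult_cutoff_tendsto[OF w S meas \<phi>(3,5,6)])
  moreover have "(LINT x:\<Omega>|lebesgue. w x * (indicator (box a b) x - indicator (box (a + s *\<^sub>R axis i 1) (b + s *\<^sub>R axis i 1)) x))
     = integral (cbox a b) w - integral (cbox (a + s *\<^sub>R axis i 1) (b + s *\<^sub>R axis i 1)) w"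
  proof -
    have ge: "0 \<le> (s *\<^sub>R axis i 1 :: real^2) $ j" for j
      using s by (simp add: axis_def)
    have "cbox a b \<subseteq> S"
      using ge by (auto simp: S_def mem_box_cart simp del: vector_scaleR_component
          intro!: add_increasing2)
    moreover have "cbox (a + s *\<^sub>R axis i 1) (b + s *\<^sub>R axis i 1) \<subseteq> S"
    proof
      fix x assume x: "x \<in> cbox (a + s *\<^sub>R axis i 1) (b + s *\<^sub>R axis i 1)"
      have "a $ j \<le> x $ j" for j
        using x ge[of j] unfolding mem_box_cart vector_add_component by (meson add_increasing2 order_trans order_refl)
      then show "x \<in> S" using x by (simp add: S_def mem_box_cart)
    qed
    ultimately have sub2: "cbox a b \<subseteq> \<Omega>" "cbox (a + s *\<^sub>R axis i 1) (b + s *\<^sub>R axis i 1) \<subseteq> \<Omega>"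
      using S(2) by auto
    have *: "set_integrable lebesgue \<Omega> (\<lambda>x. w x * indicator (box c d) x)" if "cbox c d \<subseteq> \<Omega>" for c d
      by (rule set_integrable_mult_cutoff[OF w compact_cbox that, where B = 1])
        (use box_subset_cbox in \<open>auto simp: indicator_def\<close>)
    show ?thesis
      unfolding right_diff_distrib
      by (subst set_integral_diff(2)[OF *[OF sub2(1)] *[OF sub2(2)]])
        (simp add: locally_integrable_box[OF w] sub2)
  qed
  ultimately have "(\<lambda>n. LINT x:\<Omega>|lebesgue. w x * partial i (\<phi> n) x) \<longlonglongrightarrow>
      integral (cbox a b) w - integral (cbox (a + s *\<^sub>R axis i 1) (b + s *\<^sub>R axis i 1)) w"
    by simp
  then have lim: "(\<lambda>n. \<bar>LINT x:\<Omega>|lebesgue. w x * partial i (\<phi> n) x\<bar>) \<longlonglongrightarrow>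
      \<bar>integral (cbox a b) w - integral (cbox (a + s *\<^sub>R axis i 1) (b + s *\<^sub>R axis i 1)) w\<bar>"
    by (rule tendsto_rabs)
  have le: "\<bar>LINT x:\<Omega>|lebesgue. w x * partial i (\<phi> n) x\<bar> \<le> (b $ i - a $ i) * M * measure lebesgue S" for n
  proof -
    have "(LINT x:\<Omega>|lebesgue. w x * partials [i] (\<phi> n) x) = (-1) ^ length [i] * (LINT x:\<Omega>|lebesgue. g x * \<phi> n x)"
      using wd test unfolding weak_derivative_def by blast
    then have "\<bar>LINT x:\<Omega>|lebesgue. w x * partial i (\<phi> n) x\<bar> = \<bar>LINT x:\<Omega>|lebesgue. g x * \<phi> n x\<bar>"
      by (simp add: partials_Cons)
    also have "\<dots> \<le> (LINT x|lebesgue. (b $ i - a $ i) * M * indicat_real S x)"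
      unfolding set_lebesgue_integral_def
    proof (rule order_trans[OF integral_abs_bound integral_mono_AE])
      show "integrable lebesgue (\<lambda>x. \<bar>indicator \<Omega> x *\<^sub>R (g x * \<phi> n x)\<bar>)"
        using test_function_mult_integrable[OF g test] by (auto simp: set_integrable_def)
      show "integrable lebesgue (\<lambda>x. (b $ i - a $ i) * M * indicat_real S x)"
        using lmeasurable_compact[OF S(1)]
        by (intro integrable_mult_right integrable_real_indicator) (auto simp: fmeasurable_def)
      show "AE x in lebesgue. \<bar>indicator \<Omega> x *\<^sub>R (g x * \<phi> n x)\<bar> \<le> (b $ i - a $ i) * M * indicat_real S x"
        using bnd
      proof eventually_elim
        case (elim x)
        show ?case
        proof (cases "x \<in> S")
          case True
          then have "\<bar>g x\<bar> * \<bar>\<phi> n x\<bar> \<le> M * (b $ i - a $ i)"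
            using elim \<phi>(2)[of n x] by (intro mult_mono) (auto simp: S_def)
          then show ?thesis using True S(2) by (auto simp: abs_mult mult.commute)
        qed (simp add: \<phi>(4))
      qed
    qed
    also have "\<dots> = (b $ i - a $ i) * M * measure lebesgue S"
      by simp
    finally show ?thesis .
  qed
  show ?thesis
    using LIMSEQ_le_const2[OF lim] le unfolding S_def by blast
qed

definition cube_average :: "(real^2 \<Rightarrow> real) \<Rightarrow> real \<Rightarrow> real^2 \<Rightarrow> real" where
  "cube_average w h x = integral (cbox x (x + h *\<^sub>R One)) w / h\<^sup>2"

text \<open>The swept box has area h (h + |s|) and the test functions have size at most
  \<open>h\<close>; after division by h^2 there remains M (h + |s|). The surplus M h disappears as h
  tends to 0.\<close>

lemma cube_average_step:
  assumes wd: "weak_derivative \<Omega> [i] w g" and sub: "cbox p q \<subseteq> \<Omega>"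
    and bnd: "AE x in lebesgue. x \<in> cbox p q \<longrightarrow> \<bar>g x\<bar> \<le> M"
    and h: "0 < h" and s: "y = x + s *\<^sub>R axis i 1"
    and xy: "x \<in> cbox p q" "x + h *\<^sub>R One \<in> cbox p q" "y \<in> cbox p q" "y + h *\<^sub>R One \<in> cbox p q"
  shows "\<bar>cube_average w h x - cube_average w h y\<bar> \<le> M * (h + \<bar>s\<bar>)"
proof -
  have pos: "\<bar>cube_average w h x - cube_average w h y\<bar> \<le> M * (h + \<bar>s\<bar>)"
    if s: "0 \<le> s" "y = x + s *\<^sub>R axis i 1" and x: "x \<in> cbox p q" and y: "y + h *\<^sub>R One \<in> cbox p q" for x y s
  proof -
    have eq: "y + h *\<^sub>R One = (x + h *\<^sub>R One) + s *\<^sub>R axis i 1" using s by simp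
    have box: "cbox x (y + h *\<^sub>R One) \<subseteq> cbox p q"
      using x y by (auto simp: mem_box_cart simp del: vector_add_component) (smt (verit, best))+
    then have bnd': "AE x' in lebesgue. x' \<in> cbox x (y + h *\<^sub>R One) \<longrightarrow> \<bar>g x'\<bar> \<le> M"
      using bnd by (auto elim: eventually_mono)
    have ii: "(x + h *\<^sub>R One) $ i - x $ i = h"
      by (simp add: One_vec_nth del: sum_component)
    have meas: "measure lebesgue (cbox x (y + h *\<^sub>R One)) = h * (h + s)"
    proof -
      have "cbox x (y + h *\<^sub>R One) \<noteq> {}"
        using h s(1) by (simp add: interval_ne_empty_cart s(2) One_vec_nth axis_def del: sum_component)
      then have "measure lborel (cbox x (y + h *\<^sub>R One)) = (\<Prod>j\<in>UNIV. (y + h *\<^sub>R One) $ j - x $ j)"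
        by (rule content_cbox_cart)
      also have "\<dots> = h * (h + s)"
        using exhaust_2[of i] by (auto simp: UNIV_2 s(2) One_vec_nth axis_def simp del: sum_component)
      finally show ?thesis by simp
    qed
    have "\<bar>integral (cbox x (x + h *\<^sub>R One)) w - integral (cbox (x + s *\<^sub>R axis i 1) (x + h *\<^sub>R One + s *\<^sub>R axis i 1)) w\<bar>
        \<le> ((x + h *\<^sub>R One) $ i - x $ i) * M * measure lebesgue (cbox x (x + h *\<^sub>R One + s *\<^sub>R axis i 1))"
      by (rule box_translate_weak_derivative_bound[OF wd s(1)])
        (use h ii box sub bnd' in \<open>auto simp flip: eq\<close>)
    then have "\<bar>integral (cbox x (x + h *\<^sub>R One)) w - integral (cbox y (y + h *\<^sub>R One)) w\<bar> \<le> h * M * (h * (h + s))"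
      by (simp only: ii meas flip: eq s(2))
    then have "\<bar>integral (cbox x (x + h *\<^sub>R One)) w - integral (cbox y (y + h *\<^sub>R One)) w\<bar> / h\<^sup>2 \<le> h * M * (h * (h + s)) / h\<^sup>2"
      by (intro divide_right_mono) auto
    also have "h * M * (h * (h + s)) / h\<^sup>2 = M * (h + s)"
      using h by (simp add: power2_eq_square)
    finally show ?thesis
      using s h by (simp add: cube_average_def abs_divide flip: diff_divide_distrib)
  qed
  show ?thesis
  proof (cases "0 \<le> s")
    case True
    then show ?thesis using pos[OF True s xy(1,4)] by simp
  next
    case False
    then show ?thesis using pos[of "- s" x y] s xy by (simp add: abs_minus_commute)
  qed
qed

text \<open>Go from \<open>x\<close> to \<open>y\<close> parallel to the axes through the corner
  \<open>c\<close>. The averages over cubes at \<open>c\<close> cancel by the triangle inequality,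
  so convergence is used at \<open>x\<close> and \<open>y\<close> alone and \<open>c\<close> may
  fail to be a Lebesgue point.\<close>

lemma lipschitz_at_lebesgue_points:
  fixes w :: "real^2 \<Rightarrow> real" and g :: "2 \<Rightarrow> real^2 \<Rightarrow> real"
  assumes wd: "\<And>i. weak_derivative \<Omega> [i] w (g i)" and sub: "cbox p q \<subseteq> \<Omega>"
    and bnd: "\<And>i. AE x in lebesgue. x \<in> cbox p q \<longrightarrow> \<bar>g i x\<bar> \<le> M"
    and x: "x \<in> box p q" "((\<lambda>h. cube_average w h x) \<longlongrightarrow> w x) (at_right 0)"
    and y: "y \<in> box p q" "((\<lambda>h. cube_average w h y) \<longlongrightarrow> w y) (at_right 0)"
  shows "\<bar>w x - w y\<bar> \<le> M * (\<bar>x $ 1 - y $ 1\<bar> + \<bar>x $ 2 - y $ 2\<bar>)"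
proof -
  define c where "c = x + (y $ 1 - x $ 1) *\<^sub>R axis 1 1"
  have c: "c $ 1 = y $ 1" "c $ 2 = x $ 2" "y = c + (y $ 2 - x $ 2) *\<^sub>R axis 2 1"
    by (auto simp: c_def vec_eq_iff forall_2 axis_def)
  have cb: "c \<in> box p q" using x y c by (auto simp: mem_box_cart forall_2)
  have in_cbox: "\<forall>\<^sub>F h in at_right 0. z + h *\<^sub>R One \<in> cbox p q" if "z \<in> box p q" for z
  proof -
    obtain d where d: "d > 0" "\<And>h. 0 < h \<Longrightarrow> h < d \<Longrightarrow> cbox z (z + h *\<^sub>R One) \<subseteq> box p q"
      using cube_in_box[OF \<open>z \<in> box p q\<close>] by blast
    have "z + h *\<^sub>R One \<in> cbox p q" if "0 < h" "h < d" for h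
    proof -
      have "z + h *\<^sub>R One \<in> cbox z (z + h *\<^sub>R One)"
        using that by (simp add: mem_box_cart One_vec_nth del: sum_component)
      then show ?thesis using d(2)[OF that] box_subset_cbox by blast
    qed
    then show ?thesis using d(1) by (auto simp: eventually_at_right_field)
  qed
  have "\<forall>\<^sub>F h in at_right 0. \<bar>cube_average w h x - cube_average w h y\<bar> \<le>
      M * (h + \<bar>y $ 1 - x $ 1\<bar>) + M * (h + \<bar>y $ 2 - x $ 2\<bar>)"
    using in_cbox[OF x(1)] in_cbox[OF cb] in_cbox[OF y(1)] eventually_at_right_less[of "0::real"]
  proof eventually_elim
    case (elim h)
    have "\<bar>cube_average w h x - cube_average w h c\<bar> \<le> M * (h + \<bar>y $ 1 - x $ 1\<bar>)"
      by (rule cube_average_step[OF wd sub bnd elim(4) c_def])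
        (use elim x(1) cb box_subset_cbox in auto)
    moreover have "\<bar>cube_average w h c - cube_average w h y\<bar> \<le> M * (h + \<bar>y $ 2 - x $ 2\<bar>)"
      by (rule cube_average_step[OF wd sub bnd elim(4) c(3)])
        (use elim y(1) cb box_subset_cbox in auto)
    ultimately show ?case by linarith
  qed
  moreover have "((\<lambda>h. \<bar>cube_average w h x - cube_average w h y\<bar>) \<longlongrightarrow> \<bar>w x - w y\<bar>) (at_right 0)"
    by (intro tendsto_intros x y)
  moreover have "((\<lambda>h. M * (h + \<bar>y $ 1 - x $ 1\<bar>) + M * (h + \<bar>y $ 2 - x $ 2\<bar>)) \<longlongrightarrow>
      M * (0 + \<bar>y $ 1 - x $ 1\<bar>) + M * (0 + \<bar>y $ 2 - x $ 2\<bar>)) (at_right 0)"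
    by (intro tendsto_intros)
  ultimately have "\<bar>w x - w y\<bar> \<le> M * (0 + \<bar>y $ 1 - x $ 1\<bar>) + M * (0 + \<bar>y $ 2 - x $ 2\<bar>)"
    by (intro tendsto_le[OF trivial_limit_at_right_real]) 
  then show ?thesis
    by (simp add: abs_minus_commute distrib_left)
qed

lemma lebesgue_points:
  fixes w :: "real^2 \<Rightarrow> real"
  assumes w: "\<And>a b. (\<lambda>x. if x \<in> \<Omega> then w x else 0) integrable_on cbox a b" and "open \<Omega>"
  obtains N where "negligible N"
    "\<And>x. x \<in> \<Omega> \<Longrightarrow> x \<notin> N \<Longrightarrow> ((\<lambda>h. cube_average w h x) \<longlongrightarrow> w x) (at_right 0)"
proof -
  let ?f = "\<lambda>x. if x \<in> \<Omega> then w x else 0"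
  obtain N where N: "negligible N" "\<And>x e. \<lbrakk>x \<notin> N; 0 < e\<rbrakk> \<Longrightarrow>
      \<exists>d>0. \<forall>h. 0 < h \<and> h < d \<longrightarrow>
        norm (integral (cbox x (x + h *\<^sub>R One)) ?f /\<^sub>R h ^ DIM(real^2) - ?f x) < e"
    by (rule integrable_ccontinuous_explicit[of ?f, OF w]) (rule that)
  have "((\<lambda>h. cube_average w h x) \<longlongrightarrow> w x) (at_right 0)" if x: "x \<in> \<Omega>" "x \<notin> N" for x
  proof (rule tendstoI)
    fix e :: real assume "e > 0"
    from N(2)[OF x(2) this] obtain d where d: "d > 0" "\<forall>h. 0 < h \<and> h < d \<longrightarrow>
        norm (integral (cbox x (x + h *\<^sub>R One)) ?f /\<^sub>R h ^ DIM(real^2) - ?f x) < e"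
      by (elim exE conjE)
    obtain a b where ab: "x \<in> box a b" "box a b \<subseteq> \<Omega>"
      by (rule open_contains_box[OF assms(2) x(1)])
    obtain d' where d': "d' > 0" "\<And>h. 0 < h \<Longrightarrow> h < d' \<Longrightarrow> cbox x (x + h *\<^sub>R One) \<subseteq> box a b"
      using cube_in_box[OF ab(1)] by blast
    have "dist (cube_average w h x) (w x) < e" if h: "0 < h" "h < min d d'" for h
    proof -
      have "integral (cbox x (x + h *\<^sub>R One)) ?f = integral (cbox x (x + h *\<^sub>R One)) w"
        using d'(2)[of h] h ab(2) by (intro integral_cong) auto
      then show ?thesis
        using d(2)[rule_format, of h] h x(1) by (simp add: cube_average_def dist_norm divide_inverse mult.commute)
    qed
    then show "\<forall>\<^sub>F h in at_right 0. dist (cube_average w h x) (w x) < e"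
      using d(1) d'(1) by (auto simp: eventually_at_right_field intro!: exI[of _ "min d d'"])
  qed
  then show thesis using N(1) that by blast
qed

lemma open_subset_closure_minus_negligible:
  fixes \<Omega> :: "'a::euclidean_space set"
  assumes "open \<Omega>" "negligible N"
  shows "\<Omega> \<subseteq> closure (\<Omega> - N)"
proof
  fix x assume x: "x \<in> \<Omega>"
  show "x \<in> closure (\<Omega> - N)"
  proof (rule ccontr)
    assume c: "x \<notin> closure (\<Omega> - N)"
    define V where "V = \<Omega> \<inter> - closure (\<Omega> - N)"
    have "open V" "x \<in> V" using assms x c by (auto simp: V_def)
    moreover have "V \<subseteq> N" using closure_subset[of "\<Omega> - N"] by (auto simp: V_def)
    ultimately show False
      using assms(2) negligible_subset open_not_negligible by blast
  qed
qed

lemma dense_sequence: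
  fixes \<Omega> :: "'a::euclidean_space set"
  assumes "open \<Omega>" "negligible N" "x \<in> \<Omega>"
  obtains s where "\<And>n::nat. s n \<in> \<Omega> - N" "s \<longlonglongrightarrow> x"
  using open_subset_closure_minus_negligible[OF assms(1,2)] assms(3) closure_sequential[of x "\<Omega> - N"] by blast

text \<open>Lebesgue points are dense, so for a continuous function the estimate extends to all
  pairs. It serves to bound a Taylor remainder by the essential supremum of its weak
  gradient.\<close>

lemma lipschitz_on_box_of_continuous:
  fixes w :: "real^2 \<Rightarrow> real" and g :: "2 \<Rightarrow> real^2 \<Rightarrow> real"
  assumes wd: "\<And>i. weak_derivative \<Omega> [i] w (g i)" and sub: "cbox p q \<subseteq> \<Omega>" and "open \<Omega>"
    and bnd: "\<And>i. AE x in lebesgue. x \<in> cbox p q \<longrightarrow> \<bar>g i x\<bar> \<le> M"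
    and int: "\<And>a b. (\<lambda>x. if x \<in> \<Omega> then w x else 0) integrable_on cbox a b"
    and cont: "continuous_on \<Omega> w" and xy: "x \<in> box p q" "y \<in> box p q"
  shows "\<bar>w x - w y\<bar> \<le> M * (\<bar>x $ 1 - y $ 1\<bar> + \<bar>x $ 2 - y $ 2\<bar>)"
proof -
  obtain N where N: "negligible N"
    "\<And>x. x \<in> \<Omega> \<Longrightarrow> x \<notin> N \<Longrightarrow> ((\<lambda>h. cube_average w h x) \<longlongrightarrow> w x) (at_right 0)"
    using lebesgue_points[OF int \<open>open \<Omega>\<close>] by blast
  have box\<Omega>: "box p q \<subseteq> \<Omega>" using sub box_subset_cbox by blast
  obtain s where s: "\<And>n::nat. s n \<in> box p q - N" "s \<longlonglongrightarrow> x"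
    using dense_sequence[OF open_box N(1) xy(1)] by blast
  obtain t where t: "\<And>n::nat. t n \<in> box p q - N" "t \<longlonglongrightarrow> y"
    using dense_sequence[OF open_box N(1) xy(2)] by blast
  have le: "\<bar>w (s n) - w (t n)\<bar> \<le> M * (\<bar>s n $ 1 - t n $ 1\<bar> + \<bar>s n $ 2 - t n $ 2\<bar>)" for n
    by (rule lipschitz_at_lebesgue_points[OF wd sub bnd]) (use s(1)[of n] t(1)[of n] box\<Omega> N(2) in auto)
  have "isCont w x" "isCont w y"
    using cont \<open>open \<Omega>\<close> box\<Omega> xy by (auto simp: continuous_on_eq_continuous_at)
  then have "(\<lambda>n. w (s n)) \<longlonglongrightarrow> w x" "(\<lambda>n. w (t n)) \<longlonglongrightarrow> w y"
    using s(2) t(2) by (auto intro: isCont_tendsto_compose)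
  then have "(\<lambda>n. \<bar>w (s n) - w (t n)\<bar>) \<longlonglongrightarrow> \<bar>w x - w y\<bar>"
    by (intro tendsto_intros)
  moreover have "(\<lambda>n. M * (\<bar>s n $ 1 - t n $ 1\<bar> + \<bar>s n $ 2 - t n $ 2\<bar>)) \<longlonglongrightarrow>
      M * (\<bar>x $ 1 - y $ 1\<bar> + \<bar>x $ 2 - y $ 2\<bar>)"
    by (intro tendsto_intros s t)
  ultimately show ?thesis
    by (rule LIMSEQ_le) (use le in auto)
qed

section \<open>Lipschitz representatives and classical gradients\<close>

lemma l1_le_norm: "\<bar>x $ 1 - y $ 1\<bar> + \<bar>x $ 2 - y $ 2\<bar> \<le> 2 * norm (x - y :: real^2)"
  using component_le_norm_cart[of "x - y" 1] component_le_norm_cart[of "x - y" 2] by simp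

text \<open>The extension is described by approximating sequences rather than by continuity, so that
  inequalities for \<open>f\<close> on \<open>D\<close> pass to \<open>F\<close> by a limit.\<close>

lemma extension_from_dense:
  fixes f :: "'a::euclidean_space \<Rightarrow> real"
  assumes dense: "\<Omega> \<subseteq> closure D"
    and loc: "\<And>x. x \<in> \<Omega> \<Longrightarrow> \<exists>V K. open V \<and> x \<in> V \<and> (\<forall>a\<in>D \<inter> V. \<forall>b\<in>D \<inter> V. \<bar>f a - f b\<bar> \<le> K * norm (a - b))"
  obtains F where "\<And>x. x \<in> D \<Longrightarrow> F x = f x"
    "\<And>x. x \<in> \<Omega> \<Longrightarrow> \<exists>s::nat \<Rightarrow> 'a. (\<forall>n. s n \<in> D) \<and> s \<longlonglongrightarrow> x \<and> (\<lambda>n. f (s n)) \<longlonglongrightarrow> F x"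
proof -
  have "\<exists>s. x \<in> \<Omega> \<longrightarrow> (\<forall>n::nat. s n \<in> D) \<and> s \<longlonglongrightarrow> x" for x
    using dense closure_sequential[of x D] by blast
  then obtain s where s: "\<And>x n. x \<in> \<Omega> \<Longrightarrow> s x (n::nat) \<in> D" "\<And>x. x \<in> \<Omega> \<Longrightarrow> s x \<longlonglongrightarrow> x"
    by metis
  have conv: "convergent (\<lambda>n. f (s x n))" if x: "x \<in> \<Omega>" for x
  proof -
    obtain V K where V: "open V" "x \<in> V" "\<forall>a\<in>D \<inter> V. \<forall>b\<in>D \<inter> V. \<bar>f a - f b\<bar> \<le> K * norm (a - b)"
      using loc[OF x] by blast
    obtain m where m: "\<And>n. n \<ge> m \<Longrightarrow> s x n \<in> V"
      using topological_tendstoD[OF s(2)[OF x] V(1,2)] by (auto simp: eventually_sequentially)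
    have "Cauchy (\<lambda>n. s x (n + m))"
      using LIMSEQ_ignore_initial_segment[OF s(2)[OF x], of m] LIMSEQ_imp_Cauchy by blast
    have "(max K 0)-lipschitz_on (D \<inter> V) f"
    proof (rule lipschitz_onI)
      fix a b assume "a \<in> D \<inter> V" "b \<in> D \<inter> V"
      then have "\<bar>f a - f b\<bar> \<le> K * norm (a - b)" using V(3) by blast
      also have "\<dots> \<le> max K 0 * norm (a - b)" by (intro mult_right_mono) auto
      finally show "dist (f a) (f b) \<le> max K 0 * dist a b" by (simp add: dist_norm)
    qed simp
    then have "uniformly_continuous_on (D \<inter> V) f"
      by (rule lipschitz_on_uniformly_continuous)
    then have "Cauchy (\<lambda>n. f (s x (n + m)))"
      by (rule uniformly_continuous_on_Cauchy) (use \<open>Cauchy (\<lambda>n. s x (n + m))\<close> s(1)[OF x] m in auto)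
    then show ?thesis
      using Cauchy_convergent convergent_ignore_initial_segment by blast
  qed
  \<comment> \<open>Off \<open>D\<close> the value is the limit along one fixed sequence in
    \<open>D\<close>; the local Lipschitz bound makes the values a Cauchy sequence.\<close>
  define F where "F x = (if x \<in> D then f x else lim (\<lambda>n. f (s x n)))" for x
  show thesis
  proof
    show "F x = f x" if "x \<in> D" for x using that by (simp add: F_def)
    show "\<exists>s::nat \<Rightarrow> 'a. (\<forall>n. s n \<in> D) \<and> s \<longlonglongrightarrow> x \<and> (\<lambda>n. f (s n)) \<longlonglongrightarrow> F x" if x: "x \<in> \<Omega>" for x
    proof (cases "x \<in> D")
      case True
      then show ?thesis by (intro exI[of _ "\<lambda>_. x"]) (simp add: F_def)
    next
      case False
      then show ?thesis
        using s(1)[OF x] s(2)[OF x] conv[OF x] by (intro exI[of _ "s x"]) (simp add: F_def convergent_LIMSEQ_iff)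
    qed
  qed
qed

lemma Linf_AE_bound:
  assumes "f \<in> Linf \<Omega>"
  obtains M where "M \<ge> 0" "AE x in lebesgue. x \<in> \<Omega> \<longrightarrow> \<bar>f x\<bar> \<le> M"
proof -
  obtain M where "AE x in lebesgue. x \<in> \<Omega> \<longrightarrow> \<bar>f x\<bar> \<le> M" using assms by (auto simp: Linf_def)
  then have "AE x in lebesgue. x \<in> \<Omega> \<longrightarrow> \<bar>f x\<bar> \<le> max M 0" by eventually_elim auto
  then show thesis using that[of "max M 0"] by simp
qed

lemma Linf_locally_integrable: "f \<in> Linf \<Omega> \<Longrightarrow> locally_integrable \<Omega> f"
  by (auto simp: Linf_def intro: locally_integrable_bounded)

lemma Linf_restrict_integrable_on:
  assumes "f \<in> Linf \<Omega>"
  shows "(\<lambda>x. if x \<in> \<Omega> then f x else 0) integrable_on cbox a b"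
proof -
  obtain M where M: "M \<ge> 0" "AE x in lebesgue. x \<in> \<Omega> \<longrightarrow> \<bar>f x\<bar> \<le> M"
    using Linf_AE_bound[OF assms] by blast
  have "locally_integrable UNIV (\<lambda>x. indicator \<Omega> x *\<^sub>R f x)"
  proof (rule locally_integrable_bounded)
    show "set_borel_measurable lebesgue UNIV (\<lambda>x. indicator \<Omega> x *\<^sub>R f x)"
      using assms by (simp add: Linf_def set_borel_measurable_def)
    show "AE x in lebesgue. x \<in> UNIV \<longrightarrow> \<bar>indicator \<Omega> x *\<^sub>R f x\<bar> \<le> M"
      using M(2) by eventually_elim (use M(1) in \<open>auto simp: indicator_def\<close>)
  qed
  then have "(\<lambda>x. indicator \<Omega> x *\<^sub>R f x) integrable_on cbox a b"
    by (rule locally_integrable_box) simp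
  then show ?thesis
    by (rule integrable_eq) (auto simp: indicator_def)
qed

lemma continuous_bounded_imp_Linf:
  assumes "open \<Omega>" "continuous_on \<Omega> f" "\<And>x. x \<in> \<Omega> \<Longrightarrow> \<bar>f x\<bar> \<le> M"
  shows "f \<in> Linf \<Omega>"
proof -
  have "(\<lambda>x. indicator \<Omega> x *\<^sub>R f x) \<in> borel_measurable borel"
    using assms by (intro borel_measurable_continuous_on_indicator) auto
  then have "set_borel_measurable lebesgue \<Omega> f"
    unfolding set_borel_measurable_def by (intro measurable_completion) simp
  then show ?thesis
    using assms(3) unfolding Linf_def by (auto intro!: exI[of _ M])
qed

lemma AE_lebesgue_negligible:
  assumes "AE x in lebesgue. P x"
  obtains N where "negligible N" "\<And>x. x \<notin> N \<Longrightarrow> P x"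
proof (rule AE_E3[OF assms])
  fix N assume N: "\<And>x. x \<in> space lebesgue - N \<Longrightarrow> P x" "N \<in> null_sets lebesgue"
  show thesis
    by (rule that[of N]) (use N in \<open>auto simp: negligible_iff_null_sets\<close>)
qed

text \<open>On the set of full measure formed by the Lebesgue points at which the essential bound of
  \<open>w\<close> holds, \<open>w\<close> is Lipschitz within each box, and the extension by
  density gives the representative. Boxes are the natural domain here because the estimate moves
  along axis-parallel paths.\<close>

lemma lipschitz_representative:
  fixes w :: "real^2 \<Rightarrow> real"
  assumes "open \<Omega>" and w: "w \<in> Linf \<Omega>" and wd: "\<And>i. weak_derivative \<Omega> [i] w (g i)"
    and g: "\<And>i. g i \<in> Linf \<Omega>"
  obtains F K where "K \<ge> 0" "AE x in lebesgue. x \<in> \<Omega> \<longrightarrow> w x = F x" "\<And>x. x \<in> \<Omega> \<Longrightarrow> \<bar>F x\<bar> \<le> K"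
    "\<And>p q x y. cbox p q \<subseteq> \<Omega> \<Longrightarrow> x \<in> box p q \<Longrightarrow> y \<in> box p q \<Longrightarrow> \<bar>F x - F y\<bar> \<le> K * norm (x - y)"
proof -
  obtain W where W: "W \<ge> 0" "AE x in lebesgue. x \<in> \<Omega> \<longrightarrow> \<bar>w x\<bar> \<le> W"
    using Linf_AE_bound[OF w] by blast
  have "\<exists>M. AE x in lebesgue. x \<in> \<Omega> \<longrightarrow> \<bar>g i x\<bar> \<le> M" for i
    using g[of i] by (simp add: Linf_def)
  then obtain m where m: "\<And>i. AE x in lebesgue. x \<in> \<Omega> \<longrightarrow> \<bar>g i x\<bar> \<le> m i" by metis
  define M where "M = max 0 (max (m 1) (m 2))"
  have M: "M \<ge> 0" "AE x in lebesgue. x \<in> \<Omega> \<longrightarrow> \<bar>g i x\<bar> \<le> M" for i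
  proof -
    show "M \<ge> 0" by (simp add: M_def)
    have "m i \<le> M" using exhaust_2[of i] by (auto simp: M_def)
    then show "AE x in lebesgue. x \<in> \<Omega> \<longrightarrow> \<bar>g i x\<bar> \<le> M"
      using m[of i] by (auto elim: eventually_mono)
  qed
  obtain N0 where N0: "negligible N0"
    "\<And>x. x \<in> \<Omega> \<Longrightarrow> x \<notin> N0 \<Longrightarrow> ((\<lambda>h. cube_average w h x) \<longlongrightarrow> w x) (at_right 0)"
    using lebesgue_points[OF Linf_restrict_integrable_on[OF w] assms(1)] by blast
  obtain N1 where N1: "negligible N1" "\<And>x. x \<notin> N1 \<Longrightarrow> x \<in> \<Omega> \<longrightarrow> \<bar>w x\<bar> \<le> W"
    using AE_lebesgue_negligible[OF W(2)] by blast
  define D where "D = \<Omega> - (N0 \<union> N1)"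
  have neg: "negligible (N0 \<union> N1)" using N0 N1 by auto
  have lip: "\<bar>w x - w y\<bar> \<le> 2 * M * norm (x - y)"
    if "cbox p q \<subseteq> \<Omega>" "x \<in> D" "x \<in> box p q" "y \<in> D" "y \<in> box p q" for p q x y
  proof -
    have "\<bar>w x - w y\<bar> \<le> M * (\<bar>x $ 1 - y $ 1\<bar> + \<bar>x $ 2 - y $ 2\<bar>)"
    proof (rule lipschitz_at_lebesgue_points[OF wd that(1)])
      show "AE x in lebesgue. x \<in> cbox p q \<longrightarrow> \<bar>g i x\<bar> \<le> M" for i
        using M(2)[of i] that(1) by (auto elim: eventually_mono)
    qed (use that N0 in \<open>auto simp: D_def\<close>)
    also have "\<dots> \<le> M * (2 * norm (x - y))"
      by (intro mult_left_mono l1_le_norm M)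
    finally show ?thesis by simp
  qed
  have dense: "\<Omega> \<subseteq> closure D"
    unfolding D_def by (rule open_subset_closure_minus_negligible[OF assms(1) neg])
  have "\<exists>V K. open V \<and> x \<in> V \<and> (\<forall>a\<in>D \<inter> V. \<forall>b\<in>D \<inter> V. \<bar>w a - w b\<bar> \<le> K * norm (a - b))" if x: "x \<in> \<Omega>" for x
  proof -
    obtain p q where "cbox p q \<subseteq> \<Omega>" "x \<in> box p q"
      by (rule open_contains_cbox[OF assms(1) x])
    then show ?thesis using lip by (intro exI[of _ "box p q"] exI[of _ "2 * M"]) auto
  qed
  then obtain F where F: "\<And>x. x \<in> D \<Longrightarrow> F x = w x"
    "\<And>x. x \<in> \<Omega> \<Longrightarrow> \<exists>s::nat \<Rightarrow> real^2. (\<forall>n. s n \<in> D) \<and> s \<longlonglongrightarrow> x \<and> (\<lambda>n. w (s n)) \<longlonglongrightarrow> F x"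
    using extension_from_dense[OF dense] by blast
  show thesis
  proof
    show "max W (2 * M) \<ge> 0" using W by simp
    show "AE x in lebesgue. x \<in> \<Omega> \<longrightarrow> w x = F x"
      using neg unfolding negligible_iff_null_sets
      by (rule AE_I') (use F(1)[symmetric] in \<open>unfold D_def, blast\<close>)
    show "\<bar>F x\<bar> \<le> max W (2 * M)" if x: "x \<in> \<Omega>" for x
    proof -
      obtain s :: "nat \<Rightarrow> real^2" where s: "\<forall>n. s n \<in> D" "(\<lambda>n. w (s n)) \<longlonglongrightarrow> F x"
        using F(2)[OF x] by blast
      have "\<bar>w (s n)\<bar> \<le> W" for n using s(1) N1(2)[of "s n"] by (auto simp: D_def)
      then have "\<bar>F x\<bar> \<le> W" using LIMSEQ_le_const2[OF tendsto_rabs[OF s(2)]] by blast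
      then show ?thesis by simp
    qed
    show "\<bar>F x - F y\<bar> \<le> max W (2 * M) * norm (x - y)"
      if pq: "cbox p q \<subseteq> \<Omega>" and x: "x \<in> box p q" and y: "y \<in> box p q" for p q x y
    proof -
      have xy: "x \<in> \<Omega>" "y \<in> \<Omega>" using x y pq box_subset_cbox by blast+
      obtain s :: "nat \<Rightarrow> real^2" where s: "\<forall>n. s n \<in> D" "s \<longlonglongrightarrow> x" "(\<lambda>n. w (s n)) \<longlonglongrightarrow> F x"
        using F(2)[OF xy(1)] by blast
      obtain t :: "nat \<Rightarrow> real^2" where t: "\<forall>n. t n \<in> D" "t \<longlonglongrightarrow> y" "(\<lambda>n. w (t n)) \<longlonglongrightarrow> F y"
        using F(2)[OF xy(2)] by blast
      have "(\<lambda>n. \<bar>w (s n) - w (t n)\<bar>) \<longlonglongrightarrow> \<bar>F x - F y\<bar>"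
        by (intro tendsto_intros s t)
      moreover have "(\<lambda>n. 2 * M * norm (s n - t n)) \<longlonglongrightarrow> 2 * M * norm (x - y)"
        by (intro tendsto_intros s t)
      moreover have "\<forall>\<^sub>F n in sequentially. \<bar>w (s n) - w (t n)\<bar> \<le> 2 * M * norm (s n - t n)"
        using topological_tendstoD[OF s(2) open_box x] topological_tendstoD[OF t(2) open_box y]
        by eventually_elim (use lip[OF pq] s(1) t(1) in auto)
      ultimately have "\<bar>F x - F y\<bar> \<le> 2 * M * norm (x - y)"
        by (intro tendsto_le[OF trivial_limit_sequentially])
      also have "\<dots> \<le> max W (2 * M) * norm (x - y)"
        by (intro mult_right_mono) auto
      finally show ?thesis .
    qed
  qed
qed

text \<open>After parametrization by the unit interval this is the local-to-global principle for
  Lipschitz functions on an interval, without loss in the constant. It carries bounds on boxes over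
  to segments in \<Omega>.\<close>

lemma lipschitz_on_segment:
  fixes f :: "'a::real_normed_vector \<Rightarrow> 'b::metric_space"
  assumes loc: "\<And>z. z \<in> closed_segment x y \<Longrightarrow> \<exists>e>0. \<forall>a\<in>ball z e. \<forall>b\<in>ball z e. dist (f a) (f b) \<le> K * dist a b"
    and "K \<ge> 0"
  shows "dist (f x) (f y) \<le> K * dist x y"
proof (cases "x = y")
  case False
  define \<gamma> where "\<gamma> t = x + t *\<^sub>R (y - x)" for t
  have \<gamma>_dist: "dist (\<gamma> s) (\<gamma> t) = dist x y * dist s t" for s t
  proof -
    have "\<gamma> s - \<gamma> t = (s - t) *\<^sub>R (y - x)" by (simp add: \<gamma>_def algebra_simps)
    then show ?thesis by (simp add: dist_norm norm_minus_commute)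
  qed
  have local: "\<exists>e>0. \<forall>s t. \<bar>s - r\<bar> < e \<longrightarrow> \<bar>t - r\<bar> < e \<longrightarrow> dist (f (\<gamma> s)) (f (\<gamma> t)) \<le> K * dist x y * dist s t"
    if "r \<in> {0..1}" for r
  proof -
    have "\<gamma> r = (1 - r) *\<^sub>R x + r *\<^sub>R y" by (simp add: \<gamma>_def algebra_simps)
    then have "\<gamma> r \<in> closed_segment x y" using that by (auto simp: in_segment)
    then obtain e where e: "e > 0" "\<forall>a\<in>ball (\<gamma> r) e. \<forall>b\<in>ball (\<gamma> r) e. dist (f a) (f b) \<le> K * dist a b"
      using loc by blast
    have in_ball: "\<gamma> s \<in> ball (\<gamma> r) e" if "\<bar>s - r\<bar> < e / dist x y" for s
    proof -
      have "dist x y * \<bar>r - s\<bar> < e" using that False by (simp add: pos_less_divide_eq mult.commute abs_minus_commute)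
      then show ?thesis by (simp add: \<gamma>_dist dist_real_def)
    qed
    show ?thesis
    proof (intro exI[of _ "e / dist x y"] conjI allI impI)
      fix s t assume "\<bar>s - r\<bar> < e / dist x y" "\<bar>t - r\<bar> < e / dist x y"
      then have "dist (f (\<gamma> s)) (f (\<gamma> t)) \<le> K * dist (\<gamma> s) (\<gamma> t)" using in_ball e(2) by blast
      then show "dist (f (\<gamma> s)) (f (\<gamma> t)) \<le> K * dist x y * dist s t" by (simp add: \<gamma>_dist)
    qed (use e(1) False in simp)
  qed
  have "(K * dist x y)-lipschitz_on {0..1} (\<lambda>t. f (\<gamma> t))"
  proof (rule locally_lipschitz_imp_lipschitz)
    show "continuous_on {0..1} (\<lambda>t. f (\<gamma> t))"
    proof (rule continuous_at_imp_continuous_on, rule ballI)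
      fix r :: real assume "r \<in> {0..1}"
      then obtain e where e: "e > 0" "\<And>s t. \<bar>s - r\<bar> < e \<Longrightarrow> \<bar>t - r\<bar> < e \<Longrightarrow> dist (f (\<gamma> s)) (f (\<gamma> t)) \<le> K * dist x y * dist s t"
        using local by metis
      have "(K * dist x y)-lipschitz_on (ball r e) (\<lambda>t. f (\<gamma> t))"
        using e(2) assms(2) by (intro lipschitz_onI) (auto simp: dist_real_def abs_minus_commute)
      then show "isCont (\<lambda>t. f (\<gamma> t)) r"
        using e(1) by (intro continuous_on_interior[of "ball r e"] lipschitz_on_continuous_on) auto
    qed
    show "\<exists>z\<in>{r<..s}. dist (f (\<gamma> z)) (f (\<gamma> r)) \<le> K * dist x y * (z - r)" if "r \<in> {0..<1}" "s > r" for r s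
    proof -
      have "r \<in> {0..1}" using that by simp
      then obtain e where e: "e > 0" "\<And>s t. \<bar>s - r\<bar> < e \<Longrightarrow> \<bar>t - r\<bar> < e \<Longrightarrow> dist (f (\<gamma> s)) (f (\<gamma> t)) \<le> K * dist x y * dist s t"
        using local by metis
      define z where "z = min s (r + e / 2)"
      have "dist (f (\<gamma> z)) (f (\<gamma> r)) \<le> K * dist x y * dist z r"
        using e(1) that by (intro e(2)) (auto simp: z_def)
      then show ?thesis using e(1) that by (intro bexI[of _ z]) (auto simp: z_def dist_real_def)
    qed
  qed (use assms(2) in simp)
  then have "dist (f (\<gamma> 0)) (f (\<gamma> 1)) \<le> K * dist x y * dist 0 (1::real)"
    by (rule lipschitz_onD) auto
  then show ?thesis by (simp add: \<gamma>_def)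
qed simp

text \<open>Test the weak derivative of \<open>u\<close> in direction \<open>i\<close> with the
  \<open>j\<close>-th partial derivative of a test function. In the list \<open>[i, j]\<close> the
  index \<open>j\<close> acts on the test function first, which is exactly the order that
  arises.\<close>

lemma weak_derivative_iterate:
  assumes "weak_derivative \<Omega> [i] u g" "weak_derivative \<Omega> [i, j] u k"
  shows "weak_derivative \<Omega> [j] g k"
  unfolding weak_derivative_def
proof (intro conjI allI impI)
  show "locally_integrable \<Omega> g" "locally_integrable \<Omega> k" using assms by (auto simp: weak_derivative_def)
  fix \<phi> assume \<phi>: "test_function \<Omega> \<phi>"
  have "(LINT x:\<Omega>|lebesgue. u x * partials [i] (partials [j] \<phi>) x) = - (LINT x:\<Omega>|lebesgue. g x * partials [j] \<phi> x)"
    using assms(1) test_function_partial[OF \<phi>, of "[j]"] unfolding weak_derivative_def by simp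
  moreover have "(LINT x:\<Omega>|lebesgue. u x * partials [i, j] \<phi> x) = (LINT x:\<Omega>|lebesgue. k x * \<phi> x)"
    using assms(2) \<phi> unfolding weak_derivative_def by simp
  ultimately show "(LINT x:\<Omega>|lebesgue. g x * partials [j] \<phi> x) = (-1) ^ length [j] * (LINT x:\<Omega>|lebesgue. k x * \<phi> x)"
    by (simp add: partials_Cons)
qed

lemma inner_real2: "(x :: real^2) \<bullet> y = x $ 1 * y $ 1 + x $ 2 * y $ 2"
  by (simp add: inner_vec_def UNIV_2)

lemma norm_real2_le: "norm (x :: real^2) \<le> \<bar>x $ 1\<bar> + \<bar>x $ 2\<bar>"
  using norm_le_l1_cart[of x] by (simp add: UNIV_2)

lemma weak_derivative_linear:
  assumes "open \<Omega>" "bounded \<Omega>"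
  shows "weak_derivative \<Omega> [i] (\<lambda>x. c \<bullet> x) (\<lambda>x. c $ i)"
proof -
  obtain B where B: "\<And>x. x \<in> \<Omega> \<Longrightarrow> norm x \<le> B" using assms(2) by (auto simp: bounded_iff)
  show ?thesis
  proof (rule weak_derivative_of_lipschitz[where Z = "{}" and L = "norm c" and B = "norm c * B"])
    show "\<bar>c \<bullet> x - c \<bullet> y\<bar> \<le> norm c * norm (x - y)" for x y
      using Cauchy_Schwarz_ineq2[of c "x - y"] by (simp add: inner_diff_right)
    show "\<bar>c \<bullet> x\<bar> \<le> norm c * B" if "x \<in> \<Omega>" for x
      using Cauchy_Schwarz_ineq2[of c x] mult_left_mono[OF B[OF that] norm_ge_zero[of c]] by linarith
    show "((\<bullet>) c has_derivative (\<bullet>) c) (at x)" for x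
      by (intro bounded_linear_imp_has_derivative bounded_linear_inner_right)
    show "locally_integrable \<Omega> (\<lambda>x. c $ i)"
      by (intro Linf_locally_integrable continuous_bounded_imp_Linf[where M = "\<bar>c $ i\<bar>"] assms) auto
  qed (use assms in auto)
qed

lemma square_box:
  fixes x y :: "real^2"
  shows "y \<in> cbox (x - vec r) (x + vec r) \<longleftrightarrow> \<bar>y $ 1 - x $ 1\<bar> \<le> r \<and> \<bar>y $ 2 - x $ 2\<bar> \<le> r"
    and "y \<in> box (x - vec r) (x + vec r) \<longleftrightarrow> \<bar>y $ 1 - x $ 1\<bar> < r \<and> \<bar>y $ 2 - x $ 2\<bar> < r"
  by (auto simp: mem_box_cart forall_2)

text \<open>The weak first derivatives themselves have bounded weak derivatives, hence Lipschitz
  representatives, the components of \<open>G\<close>. That \<open>G\<close> is the classical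
  gradient follows from the box estimate applied to \<open>v\<close> minus the linear function with
  gradient \<open>G z\<close>, whose weak gradient is small near \<open>z\<close>.\<close>

lemma W2inf_regularity:
  fixes u :: "real^2 \<Rightarrow> real"
  assumes "open \<Omega>" "bounded \<Omega>" "u \<in> W2inf \<Omega>"
  obtains v G M where "M \<ge> 0" "AE x in lebesgue. x \<in> \<Omega> \<longrightarrow> u x = v x"
    "\<And>x. x \<in> \<Omega> \<Longrightarrow> \<bar>v x\<bar> \<le> M" "\<And>x. x \<in> \<Omega> \<Longrightarrow> norm (G x) \<le> M"
    "\<And>x y. closed_segment x y \<subseteq> \<Omega> \<Longrightarrow> norm (G x - G y) \<le> M * norm (x - y)"
    "\<And>x. x \<in> \<Omega> \<Longrightarrow> (v has_derivative (\<lambda>w. G x \<bullet> w)) (at x)"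
proof -
  have uL: "u \<in> Linf \<Omega>" and ex: "\<And>is. length is \<le> 2 \<Longrightarrow> \<exists>g\<in>Linf \<Omega>. weak_derivative \<Omega> is u g"
    using assms(3) by (auto simp: sobolev_def)
  have "\<forall>i. \<exists>g. g \<in> Linf \<Omega> \<and> weak_derivative \<Omega> [i] u g" using ex[of "[_]"] by fastforce
  then obtain g where g: "\<And>i. g i \<in> Linf \<Omega>" "\<And>i. weak_derivative \<Omega> [i] u (g i)" by metis
  have "\<forall>i j. \<exists>g. g \<in> Linf \<Omega> \<and> weak_derivative \<Omega> [i, j] u g" using ex[of "[_, _]"] by fastforce
  then obtain k where k: "\<And>i j. k i j \<in> Linf \<Omega>" "\<And>i j. weak_derivative \<Omega> [i, j] u (k i j)" by metis
  have gk: "weak_derivative \<Omega> [j] (g i) (k i j)" for i j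
    by (rule weak_derivative_iterate[OF g(2) k(2)])
  obtain v K0 where v: "K0 \<ge> 0" "AE x in lebesgue. x \<in> \<Omega> \<longrightarrow> u x = v x" "\<And>x. x \<in> \<Omega> \<Longrightarrow> \<bar>v x\<bar> \<le> K0"
    "\<And>p q x y. cbox p q \<subseteq> \<Omega> \<Longrightarrow> x \<in> box p q \<Longrightarrow> y \<in> box p q \<Longrightarrow> \<bar>v x - v y\<bar> \<le> K0 * norm (x - y)"
    by (rule lipschitz_representative[OF assms(1) uL g(2) g(1)]) (rule that)
  define rep where "rep i F K \<longleftrightarrow> K \<ge> 0 \<and> (AE x in lebesgue. x \<in> \<Omega> \<longrightarrow> g i x = F x) \<and> (\<forall>x\<in>\<Omega>. \<bar>F x\<bar> \<le> K) \<and>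
    (\<forall>p q x y. cbox p q \<subseteq> \<Omega> \<longrightarrow> x \<in> box p q \<longrightarrow> y \<in> box p q \<longrightarrow> \<bar>F x - F y\<bar> \<le> K * norm (x - y))"
    for i F and K :: real
  have "\<exists>F K. rep i F K" for i
  proof -
    obtain F K where "K \<ge> 0" "AE x in lebesgue. x \<in> \<Omega> \<longrightarrow> g i x = F x" "\<And>x. x \<in> \<Omega> \<Longrightarrow> \<bar>F x\<bar> \<le> K"
      "\<And>p q x y. cbox p q \<subseteq> \<Omega> \<Longrightarrow> x \<in> box p q \<Longrightarrow> y \<in> box p q \<Longrightarrow> \<bar>F x - F y\<bar> \<le> K * norm (x - y)"
      by (rule lipschitz_representative[OF assms(1) g(1)[of i] gk[of _ i] k(1)[of i]]) (rule that)
    then show ?thesis unfolding rep_def by (intro exI[of _ F] exI[of _ K]) simp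
  qed
  then obtain F K where FK: "\<And>i. rep i (F i) (K i)" by metis
  have F: "\<And>i. K i \<ge> 0" "\<And>i. AE x in lebesgue. x \<in> \<Omega> \<longrightarrow> g i x = F i x" "\<And>i x. x \<in> \<Omega> \<Longrightarrow> \<bar>F i x\<bar> \<le> K i"
    "\<And>i p q x y. cbox p q \<subseteq> \<Omega> \<Longrightarrow> x \<in> box p q \<Longrightarrow> y \<in> box p q \<Longrightarrow> \<bar>F i x - F i y\<bar> \<le> K i * norm (x - y)"
    using FK unfolding rep_def by simp_all
  define G :: "real^2 \<Rightarrow> real^2" where "G x = (\<chi> i. F i x)" for x
  define K' where "K' = K 1 + K 2"
  have K': "K' \<ge> 0" "K i \<le> K'" for i
    using F(1)[of 1] F(1)[of 2] exhaust_2[of i] by (auto simp: K'_def)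
  have G_box: "norm (G x - G y) \<le> K' * norm (x - y)" if "cbox p q \<subseteq> \<Omega>" "x \<in> box p q" "y \<in> box p q" for p q x y
    using norm_real2_le[of "G x - G y"] F(4)[OF that, of 1] F(4)[OF that, of 2]
    by (simp add: G_def K'_def distrib_right)
  have G_bound: "norm (G x) \<le> K'" if "x \<in> \<Omega>" for x
    using norm_real2_le[of "G x"] F(3)[OF that, of 1] F(3)[OF that, of 2] by (simp add: G_def K'_def)
  have box_at: "\<exists>r>0. cbox (z - vec r) (z + vec r) \<subseteq> \<Omega>" if "z \<in> \<Omega>" for z
  proof -
    obtain d where d: "d > 0" "cball z d \<subseteq> \<Omega>" using assms(1) \<open>z \<in> \<Omega>\<close> open_contains_cball by blast
    have "cbox (z - vec (d / 2)) (z + vec (d / 2)) \<subseteq> cball z d"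
    proof
      fix y assume "y \<in> cbox (z - vec (d / 2)) (z + vec (d / 2))"
      then have "\<bar>(z - y) $ 1\<bar> + \<bar>(z - y) $ 2\<bar> \<le> d" by (auto simp: square_box abs_minus_commute)
      then show "y \<in> cball z d" using norm_real2_le[of "z - y"] by (simp add: dist_norm)
    qed
    then show ?thesis using d by (intro exI[of _ "d / 2"]) auto
  qed
  have ball_in_box: "y \<in> box (z - vec r) (z + vec r)" if "y \<in> ball z r" for z y :: "real^2" and r
    using that component_le_norm_cart[of "y - z" 1] component_le_norm_cart[of "y - z" 2]
    by (auto simp: square_box dist_norm norm_minus_commute)
  have G_seg: "norm (G x - G y) \<le> K' * norm (x - y)" if xy: "closed_segment x y \<subseteq> \<Omega>" for x y
  proof -
    have "dist (G x) (G y) \<le> K' * dist x y"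
    proof (rule lipschitz_on_segment)
      fix z assume "z \<in> closed_segment x y"
      then obtain r where "r > 0" "cbox (z - vec r) (z + vec r) \<subseteq> \<Omega>" using box_at xy by blast
      then show "\<exists>e>0. \<forall>a\<in>ball z e. \<forall>b\<in>ball z e. dist (G a) (G b) \<le> K' * dist a b"
        using G_box ball_in_box by (auto simp: dist_norm intro!: exI[of _ r])
    qed (use K' in auto)
    then show ?thesis by (simp add: dist_norm)
  qed
  have v_cont: "continuous_on \<Omega> v"
  proof (rule continuous_at_imp_continuous_on, rule ballI)
    fix z assume "z \<in> \<Omega>"
    then obtain r where r: "r > 0" "cbox (z - vec r) (z + vec r) \<subseteq> \<Omega>" using box_at by blast
    have "K0-lipschitz_on (ball z r) v"
      using v(4)[OF r(2)] ball_in_box v(1) by (intro lipschitz_onI) (auto simp: dist_norm)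
    then show "isCont v z"
      using r by (intro continuous_on_interior[of "ball z r"] lipschitz_on_continuous_on) auto
  qed
  have vL: "v \<in> Linf \<Omega>" by (rule continuous_bounded_imp_Linf[OF assms(1) v_cont v(3)])
  have vg: "weak_derivative \<Omega> [i] v (g i)" for i
    by (rule weak_derivative_AE_cong[OF g(2) Linf_locally_integrable[OF vL]]) (use v(2) in \<open>auto elim: eventually_mono\<close>)
  obtain B where B: "\<And>x. x \<in> \<Omega> \<Longrightarrow> norm x \<le> B" using assms(2) by (auto simp: bounded_iff)
  \<comment> \<open>On the box of half-width \<open>r\<close> the weak partial derivatives of v(x) -
    G z . x are at most \<open>K' * (2 * r)\<close>. The box of half-width \<open>2 * r\<close> is
    there because the Lipschitz bound for \<open>F\<close> holds in open boxes whose closed box lies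
    in \<Omega>.\<close>
  have taylor: "\<bar>v y - v z - G z \<bullet> (y - z)\<bar> \<le> 8 * K' * r * norm (y - z)"
    if r: "r > 0" "cbox (z - vec (2 * r)) (z + vec (2 * r)) \<subseteq> \<Omega>" and y: "norm (y - z) < r" for r y z
  proof -
    let ?p = "z - vec r" and ?q = "z + vec r"
    have sub: "cbox ?p ?q \<subseteq> box (z - vec (2 * r)) (z + vec (2 * r))"
      using r(1) by (auto simp: square_box)
    then have sub\<Omega>: "cbox ?p ?q \<subseteq> \<Omega>" using r(2) box_subset_cbox by blast
    have z: "z \<in> box (z - vec (2 * r)) (z + vec (2 * r))" "z \<in> box ?p ?q" using r by (auto simp: square_box)
    have zin: "z \<in> \<Omega>" using z(1) r(2) box_subset_cbox by blast
    have bd: "\<bar>F i x - G z $ i\<bar> \<le> K' * (2 * r)" if "x \<in> cbox ?p ?q" for x i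
    proof -
      have "\<bar>F i x - F i z\<bar> \<le> K i * norm (x - z)" by (rule F(4)[OF r(2)]) (use sub that z in auto)
      also have "\<dots> \<le> K' * (2 * r)"
        using that norm_real2_le[of "x - z"] K' r(1) by (intro mult_mono) (auto simp: square_box)
      finally show ?thesis by (simp add: G_def)
    qed
    have cont: "continuous_on \<Omega> (\<lambda>x. v x - G z \<bullet> x)"
      by (intro continuous_intros v_cont)
    have "\<bar>v x - G z \<bullet> x\<bar> \<le> K0 + K' * B" if "x \<in> \<Omega>" for x
    proof -
      have "\<bar>G z \<bullet> x\<bar> \<le> norm (G z) * norm x" by (rule Cauchy_Schwarz_ineq2)
      also have "\<dots> \<le> K' * B" using that B zin K' by (intro mult_mono G_bound) auto
      finally show ?thesis using v(3)[OF that] by linarith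
    qed
    then have L: "(\<lambda>x. v x - G z \<bullet> x) \<in> Linf \<Omega>"
      by (rule continuous_bounded_imp_Linf[OF assms(1) cont])
    have "\<bar>(v y - G z \<bullet> y) - (v z - G z \<bullet> z)\<bar> \<le> K' * (2 * r) * (\<bar>y $ 1 - z $ 1\<bar> + \<bar>y $ 2 - z $ 2\<bar>)"
    proof (rule lipschitz_on_box_of_continuous[where g = "\<lambda>i x. g i x - G z $ i", OF _ sub\<Omega> assms(1) _ _ cont])
      show "weak_derivative \<Omega> [i] (\<lambda>x. v x - G z \<bullet> x) (\<lambda>x. g i x - G z $ i)" for i
        by (rule weak_derivative_diff[OF vg weak_derivative_linear[OF assms(1,2)]])
      show "AE x in lebesgue. x \<in> cbox ?p ?q \<longrightarrow> \<bar>g i x - G z $ i\<bar> \<le> K' * (2 * r)" for i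
        using F(2)[of i] by eventually_elim (use bd sub\<Omega> in auto)
      show "(\<lambda>x. if x \<in> \<Omega> then v x - G z \<bullet> x else 0) integrable_on cbox a b" for a b
        by (rule Linf_restrict_integrable_on[OF L])
      show "y \<in> box ?p ?q" using y by (intro ball_in_box) (simp add: dist_norm norm_minus_commute)
    qed (use z in auto)
    also have "\<dots> \<le> K' * (2 * r) * (2 * norm (y - z))"
      using K' r by (intro mult_left_mono l1_le_norm) auto
    also have "\<dots> \<le> 8 * K' * r * norm (y - z)" using K' r by simp
    finally show ?thesis by (simp add: inner_diff_right algebra_simps)
  qed
  have deriv: "(v has_derivative (\<lambda>w. G z \<bullet> w)) (at z)" if z: "z \<in> \<Omega>" for z
    unfolding has_derivative_at_alt
  proof (intro conjI allI impI)
    show "bounded_linear ((\<bullet>) (G z))" by (rule bounded_linear_inner_right)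
    fix e :: real assume e: "e > 0"
    obtain r0 where r0: "r0 > 0" "cbox (z - vec r0) (z + vec r0) \<subseteq> \<Omega>" using box_at[OF z] by blast
    \<comment> \<open>The 1 in \<open>8 * K' + 1\<close> avoids a division by zero when
      \<open>K'\<close> vanishes.\<close>
    define r where "r = min (r0 / 2) (e / (8 * K' + 1))"
    have r: "r > 0" "2 * r \<le> r0" using r0 e K' by (auto simp: r_def add_nonneg_pos)
    have pos: "8 * K' + 1 > 0" using K' by (simp add: add_nonneg_pos)
    then have "(8 * K' + 1) * r \<le> (8 * K' + 1) * (e / (8 * K' + 1))"
      by (intro mult_left_mono) (auto simp: r_def)
    also have "\<dots> = e" using pos by simp
    finally have re: "8 * K' * r \<le> e" using r by (simp add: distrib_right)
    have sub: "cbox (z - vec (2 * r)) (z + vec (2 * r)) \<subseteq> \<Omega>"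
      using r r0(2) by (force simp: square_box subset_iff)
    show "\<exists>d>0. \<forall>y. norm (y - z) < d \<longrightarrow> norm (v y - v z - G z \<bullet> (y - z)) \<le> e * norm (y - z)"
    proof (intro exI[of _ r] conjI allI impI r(1))
      fix y assume "norm (y - z) < r"
      then have "\<bar>v y - v z - G z \<bullet> (y - z)\<bar> \<le> 8 * K' * r * norm (y - z)"
        by (rule taylor[OF r(1) sub])
      also have "\<dots> \<le> e * norm (y - z)" using re by (rule mult_right_mono) simp
      finally show "norm (v y - v z - G z \<bullet> (y - z)) \<le> e * norm (y - z)" by simp
    qed
  qed
  show thesis
  proof
    show "max K0 K' \<ge> 0" using K' by simp
    show "AE x in lebesgue. x \<in> \<Omega> \<longrightarrow> u x = v x" by (rule v(2))
    show "\<bar>v x\<bar> \<le> max K0 K'" "norm (G x) \<le> max K0 K'" if "x \<in> \<Omega>" for x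
      using v(3)[OF that] G_bound[OF that] by auto
    show "norm (G x - G y) \<le> max K0 K' * norm (x - y)" if "closed_segment x y \<subseteq> \<Omega>" for x y
      using G_seg[OF that] by (rule order_trans) (intro mult_right_mono; simp)
    show "(v has_derivative (\<lambda>w. G x \<bullet> w)) (at x)" if "x \<in> \<Omega>" for x
      by (rule deriv[OF that])
  qed
qed

section \<open>Whitney estimates on Lipschitz domains\<close>

text \<open>Above a graph, a path goes up, across and down. Its segments lie in \<Omega> and have
  lengths comparable to the distance of the end points, so that derivative bounds along segments can
  be chained without convexity.\<close>

definition three_step :: "'a::real_normed_vector set \<Rightarrow> real \<Rightarrow> 'a \<Rightarrow> 'a \<Rightarrow> bool" where
  "three_step \<Omega> \<kappa> z x \<longleftrightarrow> (\<exists>p q. closed_segment z p \<subseteq> \<Omega> \<and> closed_segment p q \<subseteq> \<Omega> \<and> closed_segment q x \<subseteq> \<Omega> \<and>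
     norm (p - z) \<le> \<kappa> * norm (x - z) \<and> norm (q - p) \<le> \<kappa> * norm (x - z) \<and> norm (x - q) \<le> \<kappa> * norm (x - z))"

lemma three_step_mono: "three_step \<Omega> \<kappa> z x \<Longrightarrow> \<kappa> \<le> \<kappa>' \<Longrightarrow> three_step \<Omega> \<kappa>' z x"
  unfolding three_step_def by (meson mult_right_mono norm_ge_zero order_trans)

lemma up_direction:
  fixes R :: "real^2 \<Rightarrow> real^2"
  assumes "orthogonal_transformation R"
  obtains e where "norm e = 1" "\<And>x s. R (x + s *\<^sub>R e) $ 1 = R x $ 1" "\<And>x s. R (x + s *\<^sub>R e) $ 2 = R x $ 2 + s"
proof -
  have "surj R" using assms orthogonal_transformation_surj by blast
  then obtain e where e: "R e = axis 2 1" by (metis surjD)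
  have lin: "linear R" using assms by (simp add: orthogonal_transformation_def)
  show thesis
  proof
    show "norm e = 1" using orthogonal_transformation_norm[OF assms, of e] e by simp
    show "R (x + s *\<^sub>R e) $ 1 = R x $ 1" "R (x + s *\<^sub>R e) $ 2 = R x $ 2 + s" for x s
      by (simp_all add: linear_add[OF lin] linear_scale[OF lin] e axis_def)
  qed
qed

text \<open>Move upwards by \<open>L * norm (x - z)\<close> from both points; the segment joining the two
  lifted points then stays above the graph.\<close>

lemma three_step_above_graph:
  fixes R :: "real^2 \<Rightarrow> real^2"
  assumes R: "orthogonal_transformation R" and g: "L-lipschitz_on UNIV g"
    and \<Omega>: "\<Omega> \<inter> ball x0 r = {y \<in> ball x0 r. g (R y $ 1) < R y $ 2}" and r: "r > 0"
    and x: "x \<in> \<Omega>" "x \<in> ball x0 (r / (2 * (1 + L)))" and z: "z \<in> \<Omega>" "z \<in> ball x0 (r / (2 * (1 + L)))"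
  shows "three_step \<Omega> (1 + L) z x"
proof -
  have L: "L \<ge> 0" using g by (rule lipschitz_on_nonneg)
  obtain e where e: "norm e = 1" "\<And>x s. R (x + s *\<^sub>R e) $ 1 = R x $ 1" "\<And>x s. R (x + s *\<^sub>R e) $ 2 = R x $ 2 + s"
    by (rule up_direction[OF R]) (rule that)
  have lin: "linear R" using R by (simp add: orthogonal_transformation_def)
  define t where "t = norm (x - z)"
  \<comment> \<open>Two points of the ball of radius \<open>\<delta>\<close> have distance at most
    \<open>2 * \<delta>\<close>, so a lift by \<open>L * t\<close> moves them by at most
    \<open>L * (2 * \<delta>)\<close>; this radius keeps the lifted points in the ball of radius
    \<open>r\<close>.\<close>
  define \<delta> where "\<delta> = r / (2 * (1 + L))"
  have \<delta>: "\<delta> > 0" "\<delta> + L * (2 * \<delta>) < r" "\<delta> \<le> r"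
  proof -
    show "\<delta> > 0" using r L by (simp add: \<delta>_def)
    have "2 * (1 + L) * \<delta> = r" using L by (simp add: \<delta>_def)
    then have "2 * \<delta> + L * (2 * \<delta>) = r" by (simp add: algebra_simps)
    moreover have "0 \<le> L * (2 * \<delta>)" using L \<open>\<delta> > 0\<close> by simp
    ultimately show "\<delta> + L * (2 * \<delta>) < r" "\<delta> \<le> r" using \<open>\<delta> > 0\<close> by linarith+
  qed
  have t: "0 \<le> t" "t \<le> 2 * \<delta>"
  proof -
    have "dist x z \<le> dist x0 x + dist x0 z" by (rule dist_triangle3)
    then show "t \<le> 2 * \<delta>" using x z by (simp add: t_def dist_norm \<delta>_def)
  qed (simp add: t_def)
  have lift: "w + s *\<^sub>R e \<in> ball x0 r" if "w \<in> ball x0 \<delta>" "0 \<le> s" "s \<le> L * t" for w s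
  proof -
    have "norm (x0 - (w + s *\<^sub>R e)) \<le> norm (x0 - w) + norm (s *\<^sub>R e)"
      using norm_triangle_ineq4[of "x0 - w" "s *\<^sub>R e"] by (simp add: algebra_simps)
    moreover have "L * t \<le> L * (2 * \<delta>)" using t L by (intro mult_left_mono) auto
    ultimately show ?thesis using that e(1) \<delta>(2) by (simp add: dist_norm)
  qed
  have mem: "y \<in> \<Omega>" if "y \<in> ball x0 r" "g (R y $ 1) < R y $ 2" for y
    using that \<Omega> by blast
  have above: "g (R w $ 1) < R w $ 2" if "w \<in> \<Omega>" "w \<in> ball x0 \<delta>" for w
    using that \<Omega> \<delta>(3) by force
  have x\<delta>: "x \<in> ball x0 \<delta>" and z\<delta>: "z \<in> ball x0 \<delta>" using x z by (simp_all add: \<delta>_def)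
  have vertical: "closed_segment w (w + (L * t) *\<^sub>R e) \<subseteq> \<Omega>" if w: "w \<in> \<Omega>" "w \<in> ball x0 \<delta>" for w
  proof
    fix y assume "y \<in> closed_segment w (w + (L * t) *\<^sub>R e)"
    then obtain u where u: "0 \<le> u" "u \<le> 1" "y = (1 - u) *\<^sub>R w + u *\<^sub>R (w + (L * t) *\<^sub>R e)"
      by (auto simp: in_segment)
    have y: "y = w + (u * (L * t)) *\<^sub>R e" unfolding u(3) by (simp add: algebra_simps)
    have "0 \<le> u * (L * t)" "u * (L * t) \<le> L * t"
      using u L t by (auto intro: mult_left_le_one_le)
    then show "y \<in> \<Omega>"
      using above[OF w] lift[OF w(2), of "u * (L * t)"] by (intro mem) (auto simp: y e)
  qed
  define p where "p = z + (L * t) *\<^sub>R e"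
  define q where "q = x + (L * t) *\<^sub>R e"
  have "0 \<le> L * t" using L t by simp
  have pq: "p \<in> ball x0 r" "q \<in> ball x0 r"
    unfolding p_def q_def using lift[OF z\<delta> \<open>0 \<le> L * t\<close> order_refl] lift[OF x\<delta> \<open>0 \<le> L * t\<close> order_refl] .
  have horizontal: "closed_segment p q \<subseteq> \<Omega>"
  proof
    fix y assume y: "y \<in> closed_segment p q"
    then obtain u where u: "0 \<le> u" "u \<le> 1" "y = (1 - u) *\<^sub>R p + u *\<^sub>R q"
      by (auto simp: in_segment)
    have Ry: "R y = (1 - u) *\<^sub>R R p + u *\<^sub>R R q"
      unfolding u(3) by (simp add: linear_add[OF lin] linear_scale[OF lin])
    define a where "a = R z $ 1"
    define b where "b = R x $ 1"
    have "\<bar>(R x - R z) $ 1\<bar> \<le> norm (R x - R z)" by (rule component_le_norm_cart)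
    also have "\<dots> = t"
      using orthogonal_transformation_norm[OF R, of "x - z"] by (simp add: t_def linear_diff[OF lin])
    finally have ab: "\<bar>b - a\<bar> \<le> t" by (simp add: a_def b_def)
    have y1: "R y $ 1 = (1 - u) * a + u * b" and y2: "R y $ 2 = (1 - u) * R z $ 2 + u * R x $ 2 + L * t"
      by (simp_all add: Ry p_def q_def e a_def b_def algebra_simps)
    define m where "m = (1 - u) * a + u * b"
    have "\<bar>g m - g a\<bar> \<le> L * \<bar>m - a\<bar>" "\<bar>g m - g b\<bar> \<le> L * \<bar>m - b\<bar>"
      using lipschitz_onD[OF g, of m a] lipschitz_onD[OF g, of m b] by (simp_all add: dist_real_def)
    moreover have "\<bar>m - a\<bar> = u * \<bar>b - a\<bar>" "\<bar>m - b\<bar> = (1 - u) * \<bar>b - a\<bar>"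
    proof -
      have "m - a = u * (b - a)" "m - b = - ((1 - u) * (b - a))" by (simp_all add: m_def algebra_simps)
      then show "\<bar>m - a\<bar> = u * \<bar>b - a\<bar>" "\<bar>m - b\<bar> = (1 - u) * \<bar>b - a\<bar>" using u by (simp_all add: abs_mult)
    qed
    ultimately have ga: "g m \<le> g a + L * (u * \<bar>b - a\<bar>)" and gb: "g m \<le> g b + L * ((1 - u) * \<bar>b - a\<bar>)"
      by auto
    \<comment> \<open>Averaging the two Lipschitz bounds with weights \<open>1 - u\<close> and
      \<open>u\<close> shows that the graph exceeds its chord by at most 2u(1-u) L |b - a|, which
      the lift \<open>L * t\<close> covers.\<close>
    have "g m = (1 - u) * g m + u * g m" by (simp add: algebra_simps)
    also have "\<dots> \<le> (1 - u) * (g a + L * (u * \<bar>b - a\<bar>)) + u * (g b + L * ((1 - u) * \<bar>b - a\<bar>))"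
      using u by (intro add_mono mult_left_mono ga gb) auto
    also have "\<dots> = (1 - u) * g a + u * g b + (2 * u * (1 - u)) * (L * \<bar>b - a\<bar>)"
      by (simp add: algebra_simps)
    also have "(2 * u * (1 - u)) * (L * \<bar>b - a\<bar>) \<le> 1 * (L * t)"
    proof (intro mult_mono)
      have "0 \<le> (1 - 2 * u)\<^sup>2" by simp
      then show "2 * u * (1 - u) \<le> 1" using u by (simp add: power2_eq_square algebra_simps)
    qed (use ab L in auto)
    finally have gm: "g m \<le> (1 - u) * g a + u * g b + L * t" by simp
    have "(1 - u) * g a + u * g b < (1 - u) * R z $ 2 + u * R x $ 2"
    \<comment> \<open>Strictness needs a positive weight on a strict inequality: the one at
      \<open>x\<close> if u = 1, the one at \<open>z\<close> otherwise.\<close>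
    proof (cases "u = 1")
      case True
      then show ?thesis using above[OF x(1) x\<delta>] by (simp add: b_def)
    next
      case False
      have "(1 - u) * g a < (1 - u) * R z $ 2"
        using above[OF z(1) z\<delta>] False u by (intro mult_strict_left_mono) (auto simp: a_def)
      moreover have "u * g b \<le> u * R x $ 2"
        using above[OF x(1) x\<delta>] u by (intro mult_left_mono) (auto simp: b_def)
      ultimately show ?thesis by linarith
    qed
    then have "g (R y $ 1) < R y $ 2" using gm unfolding y1 y2 m_def by linarith
    moreover have "y \<in> ball x0 r"
      using y closed_segment_subset[OF pq convex_ball] by blast
    ultimately show "y \<in> \<Omega>" by (intro mem)
  qed
  have "closed_segment q x \<subseteq> \<Omega>"
    using vertical[OF x(1) x\<delta>] by (simp add: q_def closed_segment_commute)
  moreover have "norm (p - z) \<le> (1 + L) * t" "norm (x - q) \<le> (1 + L) * t"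
    using e(1) L t by (simp_all add: p_def q_def distrib_right)
  moreover have "norm (q - p) \<le> (1 + L) * t"
    using L t by (simp add: p_def q_def distrib_right flip: t_def)
  moreover have "closed_segment z p \<subseteq> \<Omega>" using vertical[OF z(1) z\<delta>] by (simp add: p_def)
  ultimately show ?thesis
    using horizontal unfolding three_step_def t_def by blast
qed

text \<open>Local charts cover the compact closure. A Lebesgue number \<open>\<rho>\<close> of a
  finite subcover puts two points closer than \<open>\<rho>\<close> into one chart, and the sum of
  the finitely many constants bounds each of them.\<close>

lemma lipschitz_domain_three_step:
  assumes "open \<Omega>" "bounded \<Omega>" "lipschitz_boundary \<Omega>"
  obtains \<rho> \<kappa> where "\<rho> > 0" "\<kappa> \<ge> 0" "\<And>x z. x \<in> \<Omega> \<Longrightarrow> z \<in> \<Omega> \<Longrightarrow> norm (x - z) < \<rho> \<Longrightarrow> three_step \<Omega> \<kappa> z x"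
proof -
  have "\<exists>\<delta> \<kappa>. \<delta> > 0 \<and> \<kappa> \<ge> 0 \<and> (\<forall>x\<in>\<Omega> \<inter> ball x0 \<delta>. \<forall>z\<in>\<Omega> \<inter> ball x0 \<delta>. three_step \<Omega> \<kappa> z x)"
    if x0: "x0 \<in> closure \<Omega>" for x0
  proof (cases "x0 \<in> \<Omega>")
    case True
    then obtain d where d: "d > 0" "ball x0 d \<subseteq> \<Omega>" using assms(1) open_contains_ball by blast
    have "three_step \<Omega> 1 z x" if "x \<in> ball x0 d" "z \<in> ball x0 d" for x z
      using closed_segment_subset[OF that(2,1) convex_ball] d(2) that
      unfolding three_step_def by (intro exI[of _ z] exI[of _ x]) auto
    then show ?thesis using d(1) by (rule_tac exI[of _ d], rule_tac exI[of _ 1]) auto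
  next
    case False
    then have fr: "x0 \<in> frontier \<Omega>" using x0 assms(1) by (simp add: frontier_def interior_open)
    from bspec[OF assms(3)[unfolded lipschitz_boundary_def] fr]
    obtain r and R :: "real^2 \<Rightarrow> real^2" and g L where *: "r > 0" "orthogonal_transformation R" "L-lipschitz_on UNIV g"
       "\<Omega> \<inter> ball x0 r = {y \<in> ball x0 r. g (R y $ 1) < R y $ 2}"
      by (elim exE conjE)
    have "L \<ge> 0" using *(3) by (rule lipschitz_on_nonneg)
    then show ?thesis
      using three_step_above_graph[OF *(2,3,4,1)] *(1)
      by (rule_tac exI[of _ "r / (2 * (1 + L))"], rule_tac exI[of _ "1 + L"]) auto
  qed
  then obtain \<delta> \<kappa> where \<delta>: "\<And>x0. x0 \<in> closure \<Omega> \<Longrightarrow> \<delta> x0 > 0" and \<kappa>: "\<And>x0. x0 \<in> closure \<Omega> \<Longrightarrow> \<kappa> x0 \<ge> 0"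
    and step: "\<And>x0 x z. x0 \<in> closure \<Omega> \<Longrightarrow> x \<in> \<Omega> \<inter> ball x0 (\<delta> x0) \<Longrightarrow> z \<in> \<Omega> \<inter> ball x0 (\<delta> x0) \<Longrightarrow> three_step \<Omega> (\<kappa> x0) z x"
    by metis
  have comp: "compact (closure \<Omega>)" using assms(2) by (rule compact_closure[THEN iffD2])
  have cover: "closure \<Omega> \<subseteq> (\<Union>x0\<in>closure \<Omega>. ball x0 (\<delta> x0))" using \<delta> by force
  obtain A where A: "A \<subseteq> closure \<Omega>" "finite A" "closure \<Omega> \<subseteq> (\<Union>x0\<in>A. ball x0 (\<delta> x0))"
    by (rule compactE_image[OF comp _ cover]) (auto intro: that)
  obtain \<rho> where \<rho>: "\<rho> > 0" "\<And>x. x \<in> closure \<Omega> \<Longrightarrow> \<exists>B\<in>(\<lambda>x0. ball x0 (\<delta> x0)) ` A. ball x \<rho> \<subseteq> B"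
    by (rule Heine_Borel_lemma[OF comp, of "(\<lambda>x0. ball x0 (\<delta> x0)) ` A"]) (use A(3) in \<open>auto intro: that\<close>)
  define K where "K = (\<Sum>a\<in>A. \<kappa> a)"
  show thesis
  proof
    show "\<rho> > 0" by fact
    show "K \<ge> 0" using A(1) \<kappa> by (auto simp: K_def intro!: sum_nonneg)
    fix x z assume xz: "x \<in> \<Omega>" "z \<in> \<Omega>" "norm (x - z) < \<rho>"
    then have "x \<in> closure \<Omega>" using closure_subset by blast
    then obtain a where a: "a \<in> A" "ball x \<rho> \<subseteq> ball a (\<delta> a)" using \<rho>(2) by blast
    have "x \<in> ball x \<rho>" "z \<in> ball x \<rho>" using xz \<rho>(1) by (auto simp: dist_norm)
    then have "x \<in> ball a (\<delta> a)" "z \<in> ball a (\<delta> a)" using a(2) by blast+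
    then have "three_step \<Omega> (\<kappa> a) z x"
      using a A(1) xz by (intro step) auto
    moreover have "\<kappa> a \<le> K"
      unfolding K_def using a(1) A \<kappa> by (intro member_le_sum) auto
    ultimately show "three_step \<Omega> K z x" by (rule three_step_mono)
  qed
qed

section \<open>Taylor estimates for all pairs of points\<close>

lemma linearization_bound:
  fixes v :: "'a::real_inner \<Rightarrow> real"
  assumes "convex S" "\<And>x. x \<in> S \<Longrightarrow> (v has_derivative (\<lambda>w. G x \<bullet> w)) (at x)"
    and "\<And>x. x \<in> S \<Longrightarrow> norm (G x - c) \<le> B" and ab: "a \<in> S" "b \<in> S"
  shows "\<bar>v b - v a - c \<bullet> (b - a)\<bar> \<le> B * norm (b - a)"
proof -
  have "norm ((v b - c \<bullet> b) - (v a - c \<bullet> a)) \<le> B * norm (b - a)"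
  proof (rule differentiable_bound[OF assms(1)])
    fix x assume x: "x \<in> S"
    have "((\<lambda>x. v x - c \<bullet> x) has_derivative (\<lambda>w. G x \<bullet> w - c \<bullet> w)) (at x)"
      by (intro has_derivative_diff assms(2)[OF x] bounded_linear_imp_has_derivative bounded_linear_inner_right)
    then show "((\<lambda>x. v x - c \<bullet> x) has_derivative (\<lambda>w. (G x - c) \<bullet> w)) (at x within S)"
      by (simp add: inner_diff_left has_derivative_at_withinI)
    have "\<bar>(G x - c) \<bullet> w\<bar> \<le> B * norm w" for w
      by (rule order_trans[OF Cauchy_Schwarz_ineq2]) (intro mult_right_mono assms(3) x norm_ge_zero)
    moreover have "0 \<le> B" using assms(3)[OF x] norm_ge_zero order_trans by blast
    ultimately show "onorm (\<lambda>w. (G x - c) \<bullet> w) \<le> B" by (intro onorm_bound) simp_all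
  qed (use ab in auto)
  then show ?thesis by (simp add: inner_diff_right algebra_simps)
qed

text \<open>Pairs closer than \<open>\<rho>\<close> are joined by a three-segment path, along which
  the mean value inequality is chained. For distant pairs the crude bounds on \<open>v\<close> and
  \<open>G\<close> suffice, as \<open>norm (x - z) / \<rho>\<close> is at least 1. The resulting
  Lipschitz bound for \<open>v\<close> also extends it to the closure, where vertices of triangles
  may lie.\<close>

lemma W2inf_Whitney:
  fixes u :: "real^2 \<Rightarrow> real"
  assumes "open \<Omega>" "bounded \<Omega>" "lipschitz_boundary \<Omega>" "u \<in> W2inf \<Omega>"
  obtains v G A where "A \<ge> 0" "AE x in lebesgue. x \<in> \<Omega> \<longrightarrow> u x = v x" "continuous_on (closure \<Omega>) v"
    "\<And>x. x \<in> \<Omega> \<Longrightarrow> (v has_derivative (\<lambda>w. G x \<bullet> w)) (at x)" "\<And>x. x \<in> \<Omega> \<Longrightarrow> norm (G x) \<le> A"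
    "\<And>x z. x \<in> \<Omega> \<Longrightarrow> z \<in> \<Omega> \<Longrightarrow> norm (G x - G z) \<le> A * norm (x - z)"
    "\<And>x z. x \<in> \<Omega> \<Longrightarrow> z \<in> \<Omega> \<Longrightarrow> \<bar>v x - v z - G z \<bullet> (x - z)\<bar> \<le> A * (norm (x - z))\<^sup>2"
proof -
  obtain v G M where v: "M \<ge> 0" "AE x in lebesgue. x \<in> \<Omega> \<longrightarrow> u x = v x"
    "\<And>x. x \<in> \<Omega> \<Longrightarrow> \<bar>v x\<bar> \<le> M" "\<And>x. x \<in> \<Omega> \<Longrightarrow> norm (G x) \<le> M"
    "\<And>x y. closed_segment x y \<subseteq> \<Omega> \<Longrightarrow> norm (G x - G y) \<le> M * norm (x - y)"
    "\<And>x. x \<in> \<Omega> \<Longrightarrow> (v has_derivative (\<lambda>w. G x \<bullet> w)) (at x)"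
    by (rule W2inf_regularity[OF assms(1,2,4)]) (rule that)
  obtain \<rho> \<kappa> where \<rho>: "\<rho> > 0" "\<kappa> \<ge> 0" "\<And>x z. x \<in> \<Omega> \<Longrightarrow> z \<in> \<Omega> \<Longrightarrow> norm (x - z) < \<rho> \<Longrightarrow> three_step \<Omega> \<kappa> z x"
    by (rule lipschitz_domain_three_step[OF assms(1-3)]) (rule that)
  have near: "norm (G x - G z) \<le> 3 * M * \<kappa> * norm (x - z) \<and>
      \<bar>v x - v z - G z \<bullet> (x - z)\<bar> \<le> 6 * M * \<kappa>\<^sup>2 * (norm (x - z))\<^sup>2"
    if xz: "x \<in> \<Omega>" "z \<in> \<Omega>" "norm (x - z) < \<rho>" for x z
  proof -
    define d where "d = \<kappa> * norm (x - z)"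
    have d0: "d \<ge> 0" using \<rho>(2) by (simp add: d_def)
    obtain p q where pq: "closed_segment z p \<subseteq> \<Omega>" "closed_segment p q \<subseteq> \<Omega>" "closed_segment q x \<subseteq> \<Omega>"
      "norm (p - z) \<le> d" "norm (q - p) \<le> d" "norm (x - q) \<le> d"
      using \<rho>(3)[OF xz] unfolding three_step_def d_def by blast
    have seg: "norm (G \<xi> - G a) \<le> M * d" if "closed_segment a b \<subseteq> \<Omega>" "norm (b - a) \<le> d" "\<xi> \<in> closed_segment a b" for a b \<xi>
    proof -
      have "closed_segment \<xi> a \<subseteq> closed_segment a b"
        using that(3) by (simp add: subset_closed_segment)
      then have "norm (G \<xi> - G a) \<le> M * norm (\<xi> - a)" using that(1) by (intro v(5)) auto
      also have "\<dots> \<le> M * d"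
        using segment_bound1[OF that(3)] that(2) v(1) by (intro mult_left_mono) auto
      finally show ?thesis .
    qed
    have tay: "\<bar>v b - v a - G z \<bullet> (b - a)\<bar> \<le> B * d"
      if "closed_segment a b \<subseteq> \<Omega>" "norm (b - a) \<le> d" "\<And>\<xi>. \<xi> \<in> closed_segment a b \<Longrightarrow> norm (G \<xi> - G z) \<le> B" "B \<ge> 0" for a b B
    proof -
      have "\<bar>v b - v a - G z \<bullet> (b - a)\<bar> \<le> B * norm (b - a)"
        by (rule linearization_bound[of "closed_segment a b"]) (use that(1,3) v(6) in auto)
      also have "\<dots> \<le> B * d" using that by (intro mult_left_mono) auto
      finally show ?thesis .
    qed
    \<comment> \<open>The gradient drifts by at most \<open>M * d\<close> on each segment, so the
      three remainders are at most 1, 2 and 3 times M d^2, in total 6 M d^2.\<close>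
    have 1: "norm (G \<xi> - G z) \<le> M * d" if "\<xi> \<in> closed_segment z p" for \<xi>
      using seg[OF pq(1,4) that] .
    have 2: "norm (G \<xi> - G z) \<le> 2 * (M * d)" if "\<xi> \<in> closed_segment p q" for \<xi>
      using seg[OF pq(2,5) that] 1[of p] norm_triangle_ineq[of "G \<xi> - G p" "G p - G z"] by simp
    have 3: "norm (G \<xi> - G z) \<le> 3 * (M * d)" if "\<xi> \<in> closed_segment q x" for \<xi>
      using seg[OF pq(3,6) that] 2[of q] norm_triangle_ineq[of "G \<xi> - G q" "G q - G z"] by simp
    have Md: "0 \<le> M * d" using v(1) d0 by simp
    have "\<bar>v p - v z - G z \<bullet> (p - z)\<bar> \<le> (M * d) * d" "\<bar>v q - v p - G z \<bullet> (q - p)\<bar> \<le> (2 * (M * d)) * d"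
      "\<bar>v x - v q - G z \<bullet> (x - q)\<bar> \<le> (3 * (M * d)) * d"
      using Md by (intro tay pq 1 2 3; simp)+
    moreover have "v x - v z - G z \<bullet> (x - z) = (v p - v z - G z \<bullet> (p - z)) + (v q - v p - G z \<bullet> (q - p)) + (v x - v q - G z \<bullet> (x - q))"
      by (simp add: inner_diff_right)
    ultimately have "\<bar>v x - v z - G z \<bullet> (x - z)\<bar> \<le> 6 * M * (d * d)"
      by (simp add: algebra_simps)
    moreover have "norm (G x - G z) \<le> 3 * M * d" using 3[of x] by simp
    ultimately show ?thesis by (simp add: d_def power2_eq_square algebra_simps)
  qed
  have far: "norm (G x - G z) \<le> 2 * M / \<rho> * norm (x - z) \<and>
      \<bar>v x - v z - G z \<bullet> (x - z)\<bar> \<le> (2 * M / \<rho>\<^sup>2 + M / \<rho>) * (norm (x - z))\<^sup>2"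
    if xz: "x \<in> \<Omega>" "z \<in> \<Omega>" "\<not> norm (x - z) < \<rho>" for x z
  proof -
    define t where "t = norm (x - z) / \<rho>"
    have t: "t \<ge> 1" "norm (x - z) = t * \<rho>" using xz(3) \<rho>(1) by (auto simp: t_def)
    have "1 \<le> t\<^sup>2" "t \<le> t\<^sup>2" using t(1) by (simp_all add: power2_eq_square mult_ge1_I)
    then have "M * 1 \<le> M * t" "M * 1 \<le> M * t\<^sup>2" "M * (t * \<rho>) \<le> M * (t\<^sup>2 * \<rho>)"
      using t(1) v(1) \<rho>(1) by (intro mult_left_mono mult_right_mono; simp)+
    moreover have "norm (G x - G z) \<le> 2 * M"
      using norm_triangle_ineq4[of "G x" "G z"] v(4)[OF xz(1)] v(4)[OF xz(2)] by linarith
    moreover have "\<bar>G z \<bullet> (x - z)\<bar> \<le> M * (t * \<rho>)"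
      unfolding t(2)[symmetric] by (rule order_trans[OF Cauchy_Schwarz_ineq2]) (intro mult_right_mono v(4) xz norm_ge_zero)
    ultimately have "norm (G x - G z) \<le> 2 * (M * t)" "\<bar>v x - v z - G z \<bullet> (x - z)\<bar> \<le> 2 * (M * t\<^sup>2) + M * (t\<^sup>2 * \<rho>)"
      using v(3)[OF xz(1)] v(3)[OF xz(2)] by linarith+
    moreover have "2 * M / \<rho> * (t * \<rho>) = 2 * (M * t)"
      "(2 * M / \<rho>\<^sup>2 + M / \<rho>) * (t * \<rho>)\<^sup>2 = 2 * (M * t\<^sup>2) + M * (t\<^sup>2 * \<rho>)"
      using \<rho>(1) by (simp_all add: power2_eq_square field_simps)
    ultimately show ?thesis unfolding t(2) by simp
  qed
  define A where "A = M + 3 * M * \<kappa> + 6 * M * \<kappa>\<^sup>2 + 2 * M / \<rho> + (2 * M / \<rho>\<^sup>2 + M / \<rho>)"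
  have A: "M \<le> A" "3 * M * \<kappa> \<le> A" "6 * M * \<kappa>\<^sup>2 \<le> A" "2 * M / \<rho> \<le> A" "2 * M / \<rho>\<^sup>2 + M / \<rho> \<le> A"
  proof -
    have "0 \<le> M" "0 \<le> 3 * M * \<kappa>" "0 \<le> 6 * M * \<kappa>\<^sup>2" "0 \<le> 2 * M / \<rho>" "0 \<le> 2 * M / \<rho>\<^sup>2 + M / \<rho>"
      using v(1) \<rho>(1,2) by auto
    then show "M \<le> A" "3 * M * \<kappa> \<le> A" "6 * M * \<kappa>\<^sup>2 \<le> A" "2 * M / \<rho> \<le> A" "2 * M / \<rho>\<^sup>2 + M / \<rho> \<le> A"
      unfolding A_def by linarith+
  qed
  have G_lip: "norm (G x - G z) \<le> A * norm (x - z)" and v_tay: "\<bar>v x - v z - G z \<bullet> (x - z)\<bar> \<le> A * (norm (x - z))\<^sup>2"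
    if "x \<in> \<Omega>" "z \<in> \<Omega>" for x z
  proof -
    show "norm (G x - G z) \<le> A * norm (x - z)"
      using near[OF that] far[OF that] mult_right_mono[OF A(2) norm_ge_zero[of "x - z"]]
        mult_right_mono[OF A(4) norm_ge_zero[of "x - z"]] by linarith
    show "\<bar>v x - v z - G z \<bullet> (x - z)\<bar> \<le> A * (norm (x - z))\<^sup>2"
      using near[OF that] far[OF that] mult_right_mono[OF A(3), of "(norm (x - z))\<^sup>2"]
        mult_right_mono[OF A(5), of "(norm (x - z))\<^sup>2"] by fastforce
  qed
  obtain D where D: "D \<ge> 0" "\<And>x z. x \<in> \<Omega> \<Longrightarrow> z \<in> \<Omega> \<Longrightarrow> norm (x - z) \<le> D"
  proof -
    obtain D where "\<And>x. x \<in> \<Omega> \<Longrightarrow> norm x \<le> D" using assms(2) by (auto simp: bounded_iff)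
    then have "norm (x - z) \<le> 2 * max D 0" if "x \<in> \<Omega>" "z \<in> \<Omega>" for x z
      using norm_triangle_ineq4[of x z] that by (smt (verit))
    then show thesis using that[of "2 * max D 0"] by simp
  qed
  have "(M + A * D)-lipschitz_on \<Omega> v"
  proof (rule lipschitz_onI)
    fix x z assume xz: "x \<in> \<Omega>" "z \<in> \<Omega>"
    have "\<bar>G z \<bullet> (x - z)\<bar> \<le> M * norm (x - z)"
      by (rule order_trans[OF Cauchy_Schwarz_ineq2]) (intro mult_right_mono v(4) xz norm_ge_zero)
    moreover have "A * (norm (x - z))\<^sup>2 \<le> A * D * norm (x - z)"
      unfolding power2_eq_square mult.assoc using D(2)[OF xz] A(1) v(1)
      by (intro mult_left_mono mult_right_mono) auto
    ultimately show "dist (v x) (v z) \<le> (M + A * D) * dist x z"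
      using v_tay[OF xz] by (simp add: dist_norm distrib_right)
  qed (use v(1) A(1) D(1) in simp)
  then have "uniformly_continuous_on \<Omega> v" by (rule lipschitz_on_uniformly_continuous)
  then obtain v' where v': "uniformly_continuous_on (closure \<Omega>) v'" "\<And>x. x \<in> \<Omega> \<Longrightarrow> v x = v' x"
    by (rule uniformly_continuous_on_extension_on_closure) (rule that)
  show thesis
  proof
    show "A \<ge> 0" using A(1) v(1) by linarith
    show "AE x in lebesgue. x \<in> \<Omega> \<longrightarrow> u x = v' x" using v(2) by eventually_elim (use v'(2) in auto)
    show "continuous_on (closure \<Omega>) v'" using v'(1) by (rule uniformly_continuous_imp_continuous)
    show "(v' has_derivative (\<lambda>w. G x \<bullet> w)) (at x)" if "x \<in> \<Omega>" for x
      by (rule has_derivative_transform_within_open[OF v(6)[OF that] assms(1) that v'(2)])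
    show "norm (G x) \<le> A" if "x \<in> \<Omega>" for x using v(4)[OF that] A(1) by linarith
    show "norm (G x - G z) \<le> A * norm (x - z)" "\<bar>v' x - v' z - G z \<bullet> (x - z)\<bar> \<le> A * (norm (x - z))\<^sup>2"
      if "x \<in> \<Omega>" "z \<in> \<Omega>" for x z
      using G_lip[OF that] v_tay[OF that] v'(2)[OF that(1)] v'(2)[OF that(2)] by simp_all
  qed
qed

text \<open>Just below the graph at a boundary point lies an open set disjoint from \<Omega>, hence
  from its closure; so no boundary point is interior to the closure. This puts the interiors of the
  elements, which tile the closure, inside \<Omega>.\<close>

lemma lipschitz_boundary_interior_closure:
  assumes "open \<Omega>" "lipschitz_boundary \<Omega>"
  shows "interior (closure \<Omega>) \<subseteq> \<Omega>"
proof
  fix x assume x: "x \<in> interior (closure \<Omega>)"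
  show "x \<in> \<Omega>"
  proof (rule ccontr)
    assume nx: "x \<notin> \<Omega>"
    then have fr: "x \<in> frontier \<Omega>"
      using x interior_subset assms(1) by (auto simp: frontier_def interior_open)
    from bspec[OF assms(2)[unfolded lipschitz_boundary_def] fr]
    obtain r and R :: "real^2 \<Rightarrow> real^2" and g L where *: "r > 0" "orthogonal_transformation R" "L-lipschitz_on UNIV g"
       "\<Omega> \<inter> ball x r = {y \<in> ball x r. g (R y $ 1) < R y $ 2}"
      by (elim exE conjE)
    obtain e where e: "norm e = 1" "\<And>x s. R (x + s *\<^sub>R e) $ 1 = R x $ 1" "\<And>x s. R (x + s *\<^sub>R e) $ 2 = R x $ 2 + s"
      by (rule up_direction[OF *(2)]) (rule that)
    have below: "R x $ 2 \<le> g (R x $ 1)" 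
    proof -
      have "x \<in> ball x r" using *(1) by simp
      then have "\<not> g (R x $ 1) < R x $ 2" using nx *(4) by blast
      then show ?thesis by simp
    qed
    obtain d where d: "d > 0" "ball x d \<subseteq> closure \<Omega>" using x mem_interior by blast
    define s where "s = min d r / 2"
    have s: "0 < s" "s < d" "s < r" using d(1) *(1) by (auto simp: s_def)
    define y where "y = x + (- s) *\<^sub>R e"
    define V where "V = ball x r \<inter> {y. R y $ 2 < g (R y $ 1)}"
    have contR: "continuous_on UNIV R"
      using *(2) by (simp add: orthogonal_transformation_def linear_continuous_on linear_conv_bounded_linear)
    have "continuous_on UNIV g" using *(3) by (rule lipschitz_on_continuous_on)
    then have "continuous_on UNIV (\<lambda>y. g (R y $ 1))"
      by (rule continuous_on_compose2) (auto intro!: continuous_intros contR)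
    then have "open {y. R y $ 2 < g (R y $ 1)}"
      by (intro open_Collect_less continuous_intros contR)
    then have "open V" by (simp add: V_def open_Int)
    moreover have "V \<inter> \<Omega> = {}"
    proof -
      have "g (R y $ 1) < R y $ 2" if "y \<in> \<Omega>" "y \<in> ball x r" for y using that *(4) by blast
      then show ?thesis unfolding V_def by force
    qed
    ultimately have "V \<inter> closure \<Omega> = {}" using open_Int_closure_eq_empty by blast
    moreover have "y \<in> V"
    proof -
      have "R y $ 1 = R x $ 1" "R y $ 2 = R x $ 2 + - s" unfolding y_def by (rule e)+
      moreover have "y \<in> ball x r" using s e(1) by (simp add: y_def dist_norm)
      ultimately show ?thesis using below s(1) by (simp add: V_def)
    qed
    moreover have "y \<in> closure \<Omega>" using d(2) s e by (auto simp: y_def dist_norm subset_iff)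
    ultimately show False by blast
  qed
qed

section \<open>Correction by Taylor polynomials\<close>

text \<open>A quadratic spline rising from 0 to 1 on the unit interval, with second derivative 4 on
  the first half and -4 on the second; its derivative \<open>step'\<close> is the tent of height 2
  at 1/2. A Lipschitz first derivative is all the regularity asked of the cutoff.\<close>

definition step :: "real \<Rightarrow> real" where
  "step t = 2 * ((max 0 t)\<^sup>2 - 2 * (max 0 (t - 1 / 2))\<^sup>2 + (max 0 (t - 1))\<^sup>2)"

definition step' :: "real \<Rightarrow> real" where
  "step' t = 4 * (max 0 t - 2 * max 0 (t - 1 / 2) + max 0 (t - 1))"

lemma DERIV_max_square: "((\<lambda>t. (max 0 t)\<^sup>2) has_real_derivative 2 * max 0 t) (at t)" for t :: real
proof (cases t "0::real" rule: linorder_cases)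
  case less
  have "((\<lambda>_. 0) has_real_derivative 0) (at t)" by simp
  then have "((\<lambda>t. (max 0 t)\<^sup>2) has_real_derivative 0) (at t)"
    by (rule has_field_derivative_transform_within_open[where S = "{..<0}"]) (use less in auto)
  then show ?thesis using less by simp
next
  case greater
  have "((\<lambda>t. t\<^sup>2) has_real_derivative 2 * t) (at t)"
    by (auto intro!: derivative_eq_intros)
  then have "((\<lambda>t. (max 0 t)\<^sup>2) has_real_derivative 2 * t) (at t)"
    by (rule has_field_derivative_transform_within_open[where S = "{0<..}"]) (use greater in auto)
  then show ?thesis using greater by simp
next
  case equal
  have "((\<lambda>h::real. (max 0 h)\<^sup>2 / h) \<longlongrightarrow> 0) (at 0)"
  proof (rule Lim_null_comparison)
    show "\<forall>\<^sub>F h in at 0. norm ((max 0 h)\<^sup>2 / h) \<le> \<bar>h\<bar>" for h :: real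
      by (intro always_eventually allI) (auto simp: max_def power2_eq_square)
    show "((\<lambda>h::real. \<bar>h\<bar>) \<longlongrightarrow> 0) (at 0)"
      using tendsto_rabs[OF tendsto_ident_at[of "0::real" UNIV]] by simp
  qed
  then show ?thesis using equal by (simp add: DERIV_def)
qed

lemma DERIV_step: "(step has_real_derivative step' t) (at t)"
proof -
  have shift: "((\<lambda>t. (max 0 (t - a))\<^sup>2) has_real_derivative 2 * max 0 (t - a)) (at t)" for a
  proof -
    have "((\<lambda>t. t - a) has_real_derivative 1) (at t)" by (auto intro!: derivative_eq_intros)
    from DERIV_chain2[OF DERIV_max_square this] show ?thesis by simp
  qed
  have "(step has_real_derivative 2 * (2 * max 0 t - 2 * (2 * max 0 (t - 1 / 2)) + 2 * max 0 (t - 1))) (at t)"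
    unfolding step_def[abs_def]
    by (intro DERIV_cmult DERIV_add DERIV_diff shift DERIV_max_square)
  then show ?thesis by (simp add: step'_def)
qed

lemma step_values:
  "t \<le> 0 \<Longrightarrow> step t = 0" "1 \<le> t \<Longrightarrow> step t = 1" "t \<le> 0 \<Longrightarrow> step' t = 0" "1 \<le> t \<Longrightarrow> step' t = 0"
  by (auto simp: step_def step'_def max_def power2_eq_square algebra_simps)

text \<open>The factor 16 is 4 times 1 + 2 + 1, as each truncation is Lipschitz with constant
  1.\<close>

lemma step'_lipschitz: "\<bar>step' s - step' t\<bar> \<le> 16 * \<bar>s - t\<bar>"
proof -
  have m: "\<bar>max 0 (s - a) - max 0 (t - a)\<bar> \<le> \<bar>s - t\<bar>" for a :: real by (auto simp: max_def)
  have key: "\<bar>4 * (a - 2 * b + c) - 4 * (a' - 2 * b' + c')\<bar> \<le> 16 * d"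
    if "\<bar>a - a'\<bar> \<le> d" "\<bar>b - b'\<bar> \<le> d" "\<bar>c - c'\<bar> \<le> d" for a b c a' b' c' d :: real
    using that unfolding abs_le_iff by (simp add: algebra_simps)
  show ?thesis
    unfolding step'_def by (rule key[OF m[of 0, unfolded diff_zero] m m])
qed

lemma step'_bound: "\<bar>step' t\<bar> \<le> 16"
proof (cases "0 \<le> t \<and> t \<le> 1")
  case True
  then show ?thesis using step'_lipschitz[of t 0] step_values(3)[of 0] by simp
next
  case False
  then show ?thesis using step_values(3,4)[of t] by auto
qed

lemma step_bound: "\<bar>step t\<bar> \<le> 16"
proof (cases "0 \<le> t \<and> t \<le> 1")
  case True
  have "norm (step t - step 0) \<le> 16 * norm (t - 0)"
    by (rule field_differentiable_bound[of UNIV step]) (use DERIV_step step'_bound in auto)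
  then show ?thesis using step_values(1)[of 0] True by simp
next
  case False
  then show ?thesis using step_values(1,2)[of t] by auto
qed

text \<open>Compose \<open>step\<close> with (|x|^2 - 1)/3, which runs from 0 to 1 as |x| runs from
  1 to 2; the squared norm keeps the composition differentiable at the origin. A single constant
  \<open>B\<close> serves for all the bounds, and 60 dominates those that arise.\<close>

lemma smooth_cutoff:
  obtains \<Phi> :: "'a::euclidean_space \<Rightarrow> real" and D\<Phi> B where "B \<ge> 1"
    "\<And>x. (\<Phi> has_derivative (\<lambda>w. D\<Phi> x \<bullet> w)) (at x)"
    "\<And>x. norm x \<le> 1 \<Longrightarrow> \<Phi> x = 1" "\<And>x. norm x \<ge> 2 \<Longrightarrow> \<Phi> x = 0" "\<And>x. norm x \<ge> 2 \<Longrightarrow> D\<Phi> x = 0"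
    "\<And>x. \<bar>\<Phi> x\<bar> \<le> B" "\<And>x. norm (D\<Phi> x) \<le> B" "\<And>x y. \<bar>\<Phi> x - \<Phi> y\<bar> \<le> B * norm (x - y)"
    "\<And>x y. norm (D\<Phi> x - D\<Phi> y) \<le> B * norm (x - y)"
proof -
  define \<tau> where "\<tau> x = (x \<bullet> x - 1) / 3" for x :: 'a
  have \<tau>: "\<tau> x = ((norm x)\<^sup>2 - 1) / 3" for x :: 'a by (simp add: \<tau>_def power2_norm_eq_inner)
  define \<Phi> where "\<Phi> x = 1 - step (\<tau> x)" for x :: 'a
  define P where "P x = step' (\<tau> x) *\<^sub>R x" for x :: 'a
  define D\<Phi> where "D\<Phi> x = (- (2 / 3)) *\<^sub>R P x" for x :: 'a
  have deriv: "(\<Phi> has_derivative (\<lambda>w. D\<Phi> x \<bullet> w)) (at x)" for x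
  proof -
    have "(\<tau> has_derivative (\<lambda>w. (2 / 3) * (x \<bullet> w))) (at x)"
      unfolding \<tau>_def by (auto intro!: derivative_eq_intros simp: inner_commute)
    from DERIV_compose_FDERIV[OF DERIV_step this]
    have "((\<lambda>x. 1 - step (\<tau> x)) has_derivative (\<lambda>w. 0 - (2 / 3) * (x \<bullet> w) * step' (\<tau> x))) (at x)"
      by (intro has_derivative_diff has_derivative_const)
    moreover have "(\<lambda>w. 0 - (2 / 3) * (x \<bullet> w) * step' (\<tau> x)) = (\<lambda>w. D\<Phi> x \<bullet> w)"
      by (simp add: fun_eq_iff D\<Phi>_def P_def)
    ultimately show ?thesis by (simp add: \<Phi>_def[abs_def])
  qed
  have out: "P x = 0" if "norm x \<ge> 2" for x
  proof -
    have "2\<^sup>2 \<le> (norm x)\<^sup>2" using that by (intro power_mono) auto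
    then show ?thesis by (simp add: P_def \<tau> step_values)
  qed
  have \<tau>_lip: "\<bar>\<tau> x - \<tau> y\<bar> \<le> 4 / 3 * \<bar>norm x - norm y\<bar>" if "norm x \<le> 2" "norm y \<le> 2" for x y
  proof -
    have "\<tau> x - \<tau> y = (norm x + norm y) * (norm x - norm y) / 3"
      by (simp add: \<tau> power2_eq_square field_simps)
    then have "\<bar>\<tau> x - \<tau> y\<bar> = (norm x + norm y) * \<bar>norm x - norm y\<bar> / 3"
      by (simp only: abs_mult abs_divide) simp
    also have "\<dots> \<le> 4 * \<bar>norm x - norm y\<bar> / 3"
      using that by (intro divide_right_mono mult_right_mono) auto
    finally show ?thesis by simp
  qed
  \<comment> \<open>The change of the scalar factor contributes 16 * 4/3 * 2 and that of the vector
    16, together less than 60.\<close>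
  have P_in: "norm (P x - P y) \<le> 60 * norm (x - y)" if "norm x \<le> 2" "norm y \<le> 2" for x y
  proof -
    have "\<bar>step' (\<tau> x) - step' (\<tau> y)\<bar> \<le> 16 * (4 / 3 * norm (x - y))"
    proof -
      have "\<bar>\<tau> x - \<tau> y\<bar> \<le> 4 / 3 * norm (x - y)"
        by (rule order_trans[OF \<tau>_lip[OF that]]) (simp add: norm_triangle_ineq3)
      then show ?thesis by (intro order_trans[OF step'_lipschitz]) simp
    qed
    then have "norm ((step' (\<tau> x) - step' (\<tau> y)) *\<^sub>R x) \<le> 16 * (4 / 3 * norm (x - y)) * 2"
      using that(1) unfolding norm_scaleR by (intro mult_mono) auto
    moreover have "norm (step' (\<tau> y) *\<^sub>R (x - y)) \<le> 16 * norm (x - y)"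
      unfolding norm_scaleR by (intro mult_right_mono step'_bound) auto
    ultimately have "norm ((step' (\<tau> x) - step' (\<tau> y)) *\<^sub>R x + step' (\<tau> y) *\<^sub>R (x - y)) \<le> 60 * norm (x - y)"
      using norm_triangle_ineq[of "(step' (\<tau> x) - step' (\<tau> y)) *\<^sub>R x" "step' (\<tau> y) *\<^sub>R (x - y)"] norm_ge_zero[of "x - y"] by linarith
    moreover have "P x - P y = (step' (\<tau> x) - step' (\<tau> y)) *\<^sub>R x + step' (\<tau> y) *\<^sub>R (x - y)"
      by (simp add: P_def algebra_simps)
    ultimately show ?thesis by (simp only:)
  qed
  \<comment> \<open>When only \<open>x\<close> lies in the disc of radius 2, the scalar factor is
    compared with its value 0 on the rim, where \<open>\<tau>\<close> equals 1; the distance from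
    \<open>x\<close> to the rim is at most \<open>norm (x - y)\<close>.\<close>
  have P_mixed: "norm (P x) \<le> 60 * norm (x - y)" if "norm x \<le> 2" "norm y \<ge> 2" for x y
  proof -
    have s1: "step' 1 = 0" by (simp add: step_values)
    have "1 - \<tau> x = (2 - norm x) * (2 + norm x) / 3" by (simp add: \<tau> power2_eq_square field_simps)
    moreover have "(2 - norm x) * (2 + norm x) \<le> norm (x - y) * 4"
      using that norm_triangle_ineq3[of x y] by (intro mult_mono) auto
    moreover have "0 \<le> (2 - norm x) * (2 + norm x)" using that by simp
    ultimately have "\<bar>\<tau> x - 1\<bar> \<le> 4 / 3 * norm (x - y)" by linarith
    then have "\<bar>step' (\<tau> x)\<bar> \<le> 16 * (4 / 3 * norm (x - y))"
      using step'_lipschitz[of "\<tau> x" 1] s1 by simp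
    then have "norm (P x) \<le> 16 * (4 / 3 * norm (x - y)) * 2"
      using that(1) unfolding P_def norm_scaleR by (intro mult_mono) auto
    then show ?thesis using norm_ge_zero[of "x - y"] by linarith
  qed
  have P_lip: "norm (P x - P y) \<le> 60 * norm (x - y)" for x y
  proof (cases "norm x \<le> 2"; cases "norm y \<le> 2")
    assume "norm x \<le> 2" "\<not> norm y \<le> 2"
    then show ?thesis using P_mixed[of x y] out[of y] by simp
  next
    assume "\<not> norm x \<le> 2" "norm y \<le> 2"
    then show ?thesis using P_mixed[of y x] out[of x] by (simp add: norm_minus_commute)
  next
    assume "\<not> norm x \<le> 2" "\<not> norm y \<le> 2"
    then show ?thesis using out[of x] out[of y] by simp
  qed (rule P_in)
  have P_bound: "norm (P x) \<le> 32" for x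
  proof (cases "norm x \<le> 2")
    case True
    have "\<bar>step' (\<tau> x)\<bar> * norm x \<le> 16 * 2" using step'_bound True by (intro mult_mono) auto
    then show ?thesis by (simp add: P_def)
  qed (use out in auto)
  have D_bound: "norm (D\<Phi> x) \<le> 60" for x using P_bound[of x] by (simp add: D\<Phi>_def)
  show thesis
  proof
    show "(60::real) \<ge> 1" by simp
    show "(\<Phi> has_derivative (\<lambda>w. D\<Phi> x \<bullet> w)) (at x)" for x by (rule deriv)
    show "\<Phi> x = 1" if "norm x \<le> 1" for x
      using that power_mono[of "norm x" 1 2] by (simp add: \<Phi>_def \<tau> step_values)
    show "\<Phi> x = 0" if "norm x \<ge> 2" for x
      using power_mono[OF that, of 2] by (simp add: \<Phi>_def \<tau> step_values)
    show "D\<Phi> x = 0" if "norm x \<ge> 2" for x using out[OF that] by (simp add: D\<Phi>_def)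
    show "\<bar>\<Phi> x\<bar> \<le> 60" for x using step_bound[of "\<tau> x"] by (simp add: \<Phi>_def)
    show "norm (D\<Phi> x) \<le> 60" for x by (rule D_bound)
    show "\<bar>\<Phi> x - \<Phi> y\<bar> \<le> 60 * norm (x - y)" for x y
      using linearization_bound[of UNIV \<Phi> D\<Phi> 0 60 y x] deriv D_bound by simp
    show "norm (D\<Phi> x - D\<Phi> y) \<le> 60 * norm (x - y)" for x y
    proof -
      have "D\<Phi> x - D\<Phi> y = (- (2 / 3)) *\<^sub>R (P x - P y)" by (simp add: D\<Phi>_def algebra_simps)
      then have "norm (D\<Phi> x - D\<Phi> y) = 2 / 3 * norm (P x - P y)" by simp
      then show ?thesis using P_lip[of x y] norm_ge_zero[of "x - y"] by linarith
    qed
  qed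
qed

text \<open>On the disc of radius \<open>2 * r\<close> the Taylor error is of order r^2 and its
  gradient of order r, while the rescaled cutoff has first order bounds 1/r and second order bounds
  1/r^2. The powers of \<open>r\<close> cancel in the Lipschitz bound for \<open>Dw\<close>, whose
  constant is therefore the same for every cluster.\<close>

lemma local_correction:
  fixes v :: "'a::euclidean_space \<Rightarrow> real"
  assumes der: "\<And>x. x \<in> \<Omega> \<Longrightarrow> (v has_derivative (\<lambda>w. G x \<bullet> w)) (at x)"
    and A: "A \<ge> 0" "\<And>x z. x \<in> \<Omega> \<Longrightarrow> z \<in> \<Omega> \<Longrightarrow> norm (G x - G z) \<le> A * norm (x - z)"
      "\<And>x z. x \<in> \<Omega> \<Longrightarrow> z \<in> \<Omega> \<Longrightarrow> \<bar>v x - v z - G z \<bullet> (x - z)\<bar> \<le> A * (norm (x - z))\<^sup>2"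
    and B: "B \<ge> 1" "\<And>x. (\<Phi> has_derivative (\<lambda>w. D\<Phi> x \<bullet> w)) (at x)"
      "\<And>x. norm x \<ge> 2 \<Longrightarrow> \<Phi> x = 0" "\<And>x. norm x \<ge> 2 \<Longrightarrow> D\<Phi> x = 0"
      "\<And>x. \<bar>\<Phi> x\<bar> \<le> B" "\<And>x. norm (D\<Phi> x) \<le> B" "\<And>x y. \<bar>\<Phi> x - \<Phi> y\<bar> \<le> B * norm (x - y)"
      "\<And>x y. norm (D\<Phi> x - D\<Phi> y) \<le> B * norm (x - y)"
    and z: "z \<in> \<Omega>" and r: "r > (0::real)"
  defines "w \<equiv> \<lambda>x. \<Phi> ((x - z) /\<^sub>R r) * (v z + G z \<bullet> (x - z) - v x)"
    and "Dw \<equiv> \<lambda>x. \<Phi> ((x - z) /\<^sub>R r) *\<^sub>R (G z - G x) + ((v z + G z \<bullet> (x - z) - v x) / r) *\<^sub>R D\<Phi> ((x - z) /\<^sub>R r)"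
  shows "\<And>x. x \<in> \<Omega> \<Longrightarrow> (w has_derivative (\<lambda>h. Dw x \<bullet> h)) (at x)"
    and "\<And>x. norm (x - z) \<ge> 2 * r \<Longrightarrow> Dw x = 0"
    and "\<And>x. x \<in> \<Omega> \<Longrightarrow> norm (Dw x) \<le> 13 * A * B * r"
    and "\<And>x y. x \<in> \<Omega> \<Longrightarrow> y \<in> \<Omega> \<Longrightarrow> norm (Dw x - Dw y) \<le> 13 * A * B * norm (x - y)"
proof -
  define e where "e x = v z + G z \<bullet> (x - z) - v x" for x
  define \<phi> where "\<phi> x = \<Phi> ((x - z) /\<^sub>R r)" for x
  define D\<phi> where "D\<phi> x = (1 / r) *\<^sub>R D\<Phi> ((x - z) /\<^sub>R r)" for x
  have w: "w = (\<lambda>x. \<phi> x * e x)" and Dw: "Dw x = \<phi> x *\<^sub>R (G z - G x) + e x *\<^sub>R D\<phi> x" for x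
    by (simp_all add: w_def Dw_def e_def \<phi>_def D\<phi>_def)
  show "(w has_derivative (\<lambda>h. Dw x \<bullet> h)) (at x)" if x: "x \<in> \<Omega>" for x
  proof -
    have "((\<lambda>x. (x - z) /\<^sub>R r) has_derivative (\<lambda>h. h /\<^sub>R r)) (at x)"
      by (auto intro!: derivative_eq_intros)
    from has_derivative_compose[OF this B(2)]
    have "(\<phi> has_derivative (\<lambda>h. D\<Phi> ((x - z) /\<^sub>R r) \<bullet> (h /\<^sub>R r))) (at x)"
      by (simp add: \<phi>_def[abs_def])
    moreover have "(e has_derivative (\<lambda>h. 0 + G z \<bullet> (h - 0) - G x \<bullet> h)) (at x)"
      unfolding e_def[abs_def]
      by (intro has_derivative_diff has_derivative_add has_derivative_const has_derivative_inner_right has_derivative_ident der x)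
    ultimately have "((\<lambda>x. \<phi> x * e x) has_derivative
        (\<lambda>h. \<phi> x * (0 + G z \<bullet> (h - 0) - G x \<bullet> h) + (D\<Phi> ((x - z) /\<^sub>R r) \<bullet> (h /\<^sub>R r)) * e x)) (at x)"
      by (rule has_derivative_mult)
    moreover have "(\<lambda>h. \<phi> x * (0 + G z \<bullet> (h - 0) - G x \<bullet> h) + (D\<Phi> ((x - z) /\<^sub>R r) \<bullet> (h /\<^sub>R r)) * e x) = (\<lambda>h. Dw x \<bullet> h)"
      by (simp add: fun_eq_iff Dw D\<phi>_def inner_add_left inner_diff_left divide_inverse algebra_simps)
    ultimately show ?thesis by (simp add: w)
  qed
  have far: "\<phi> x = 0" "D\<phi> x = 0" if "norm (x - z) \<ge> 2 * r" for x
  proof -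
    have "norm ((x - z) /\<^sub>R r) \<ge> 2" using that r unfolding norm_scaleR by (simp add: field_simps)
    then show "\<phi> x = 0" "D\<phi> x = 0" using B(3,4) by (simp_all add: \<phi>_def D\<phi>_def)
  qed
  then show "Dw x = 0" if "norm (x - z) \<ge> 2 * r" for x using that by (simp add: Dw)
  have \<phi>b: "\<bar>\<phi> x\<bar> \<le> B" "norm (D\<phi> x) \<le> B / r" for x
    using B(5,6) r by (auto simp: \<phi>_def D\<phi>_def divide_right_mono)
  have scale: "norm ((x - z) /\<^sub>R r - (y - z) /\<^sub>R r) = norm (x - y) / r" for x y
    using r by (simp add: divide_inverse mult.commute flip: scaleR_diff_right)
  have \<phi>l: "\<bar>\<phi> x - \<phi> y\<bar> \<le> B / r * norm (x - y)" "norm (D\<phi> x - D\<phi> y) \<le> B / r\<^sup>2 * norm (x - y)" for x y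
  proof -
    show "\<bar>\<phi> x - \<phi> y\<bar> \<le> B / r * norm (x - y)"
      using B(7)[of "(x - z) /\<^sub>R r" "(y - z) /\<^sub>R r"] unfolding scale by (simp add: \<phi>_def)
    have "norm (D\<phi> x - D\<phi> y) = 1 / r * norm (D\<Phi> ((x - z) /\<^sub>R r) - D\<Phi> ((y - z) /\<^sub>R r))"
      using r by (simp add: D\<phi>_def flip: scaleR_diff_right)
    also have "\<dots> \<le> 1 / r * (B * (norm (x - y) / r))"
      using B(8)[of "(x - z) /\<^sub>R r" "(y - z) /\<^sub>R r"] r unfolding scale by (intro mult_left_mono) auto
    finally show "norm (D\<phi> x - D\<phi> y) \<le> B / r\<^sup>2 * norm (x - y)" by (simp add: power2_eq_square)
  qed
  have De: "norm (G z - G x) \<le> 2 * A * r" if "x \<in> \<Omega>" "norm (x - z) \<le> 2 * r" for x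
    using A(2)[OF z that(1)] mult_left_mono[OF that(2) A(1)] by (simp add: norm_minus_commute)
  have eb: "\<bar>e x\<bar> \<le> 4 * A * r\<^sup>2" if "x \<in> \<Omega>" "norm (x - z) \<le> 2 * r" for x
  proof -
    have "(norm (x - z))\<^sup>2 \<le> (2 * r)\<^sup>2" using that(2) by (intro power_mono) auto
    then have "A * (norm (x - z))\<^sup>2 \<le> A * (2 * r)\<^sup>2" by (intro mult_left_mono A)
    then show ?thesis using A(3)[OF that(1) z] by (simp add: e_def power2_eq_square)
  qed
  \<comment> \<open>The Lipschitz bound for \<open>e\<close> comes from the Taylor estimate for the
    pair \<open>x\<close>, \<open>y\<close> and not from integrating a gradient: the segment between
    them may leave \<Omega>.\<close>
  have el: "\<bar>e x - e y\<bar> \<le> 6 * A * r * norm (x - y)"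
    if x: "x \<in> \<Omega>" "norm (x - z) \<le> 2 * r" and y: "y \<in> \<Omega>" "norm (y - z) \<le> 2 * r" for x y
  proof -
    have "e x - e y = (G z - G y) \<bullet> (x - y) - (v x - v y - G y \<bullet> (x - y))"
      by (simp add: e_def inner_diff_left inner_diff_right)
    moreover have "\<bar>(G z - G y) \<bullet> (x - y)\<bar> \<le> 2 * A * r * norm (x - y)"
      by (rule order_trans[OF Cauchy_Schwarz_ineq2]) (intro mult_right_mono De y norm_ge_zero)
    moreover have "norm (x - y) \<le> 4 * r"
      using norm_triangle_ineq4[of "x - z" "y - z"] x y by simp
    then have "A * (norm (x - y) * norm (x - y)) \<le> A * (4 * r * norm (x - y))"
      by (intro mult_left_mono mult_right_mono A norm_ge_zero)
    then have "\<bar>v x - v y - G y \<bullet> (x - y)\<bar> \<le> 4 * A * r * norm (x - y)"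
      using A(3)[OF x(1) y(1)] by (simp add: power2_eq_square)
    ultimately show ?thesis by linarith
  qed
  have AB: "0 \<le> A * B" using A(1) B(1) by simp
  show "norm (Dw x) \<le> 13 * A * B * r" if x: "x \<in> \<Omega>" for x
  proof (cases "norm (x - z) \<le> 2 * r")
    case True
    have "norm (\<phi> x *\<^sub>R (G z - G x)) \<le> B * (2 * A * r)"
      unfolding norm_scaleR using \<phi>b De[OF x True] B(1) by (intro mult_mono) auto
    moreover have "norm (e x *\<^sub>R D\<phi> x) \<le> (4 * A * r\<^sup>2) * (B / r)"
      unfolding norm_scaleR using \<phi>b eb[OF x True] A(1) by (intro mult_mono) auto
    moreover have "(4 * A * r\<^sup>2) * (B / r) = 4 * (A * B * r)" "B * (2 * A * r) = 2 * (A * B * r)"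
      using r by (simp_all add: power2_eq_square)
    moreover have "0 \<le> A * B * r" using AB r by simp
    ultimately show ?thesis
      using norm_triangle_ineq[of "\<phi> x *\<^sub>R (G z - G x)" "e x *\<^sub>R D\<phi> x"] unfolding Dw by linarith
  next
    case False
    then show ?thesis using far[of x] AB r by (simp add: Dw)
  qed
  have mixed: "norm (Dw x) \<le> 13 * A * B * norm (x - y)"
    if x: "x \<in> \<Omega>" "norm (x - z) \<le> 2 * r" and y: "norm (y - z) \<ge> 2 * r" for x y
  proof -
    have "\<bar>\<phi> x\<bar> \<le> B / r * norm (x - y)" "norm (D\<phi> x) \<le> B / r\<^sup>2 * norm (x - y)"
      using \<phi>l[of x y] far[OF y] by simp_all
    then have "norm (\<phi> x *\<^sub>R (G z - G x)) \<le> (B / r * norm (x - y)) * (2 * A * r)"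
      and "norm (e x *\<^sub>R D\<phi> x) \<le> (4 * A * r\<^sup>2) * (B / r\<^sup>2 * norm (x - y))"
      unfolding norm_scaleR using De[OF x] eb[OF x] A(1) B(1) r by (intro mult_mono; simp)+
    moreover have "(B / r * norm (x - y)) * (2 * A * r) = 2 * (A * B * norm (x - y))"
      "(4 * A * r\<^sup>2) * (B / r\<^sup>2 * norm (x - y)) = 4 * (A * B * norm (x - y))"
      using r by simp_all
    moreover have "0 \<le> A * B * norm (x - y)" using AB by simp
    ultimately show ?thesis
      using norm_triangle_ineq[of "\<phi> x *\<^sub>R (G z - G x)" "e x *\<^sub>R D\<phi> x"] unfolding Dw by linarith
  qed
  \<comment> \<open>Splitting both products gives four terms with constants 2, 1, 6 and 4, whose sum
    is 13. If only one point lies in the disc, the cutoff and its gradient there are compared with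
    their zero values at the other point.\<close>
  show "norm (Dw x - Dw y) \<le> 13 * A * B * norm (x - y)" if x: "x \<in> \<Omega>" and y: "y \<in> \<Omega>" for x y
  proof (cases "norm (x - z) \<le> 2 * r"; cases "norm (y - z) \<le> 2 * r")
    assume X: "norm (x - z) \<le> 2 * r" and Y: "norm (y - z) \<le> 2 * r"
    have "norm ((\<phi> x - \<phi> y) *\<^sub>R (G z - G x)) \<le> (B / r * norm (x - y)) * (2 * A * r)"
      unfolding norm_scaleR using \<phi>l[of x y] De[OF x X] B(1) r by (intro mult_mono) auto
    moreover have "norm (\<phi> y *\<^sub>R (G y - G x)) \<le> B * (A * norm (x - y))"
      unfolding norm_scaleR using \<phi>b A(2)[OF y x] B(1) by (intro mult_mono) (auto simp: norm_minus_commute)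
    moreover have "norm ((e x - e y) *\<^sub>R D\<phi> x) \<le> (6 * A * r * norm (x - y)) * (B / r)"
      unfolding norm_scaleR using \<phi>b el[OF x X y Y] A(1) r by (intro mult_mono) auto
    moreover have "norm (e y *\<^sub>R (D\<phi> x - D\<phi> y)) \<le> (4 * A * r\<^sup>2) * (B / r\<^sup>2 * norm (x - y))"
      unfolding norm_scaleR using \<phi>l[of x y] eb[OF y Y] A(1) by (intro mult_mono) auto
    moreover have "(B / r * norm (x - y)) * (2 * A * r) = 2 * (A * B * norm (x - y))"
      "B * (A * norm (x - y)) = A * B * norm (x - y)"
      "(6 * A * r * norm (x - y)) * (B / r) = 6 * (A * B * norm (x - y))"
      "(4 * A * r\<^sup>2) * (B / r\<^sup>2 * norm (x - y)) = 4 * (A * B * norm (x - y))"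
      using r by simp_all
    ultimately have "norm (((\<phi> x - \<phi> y) *\<^sub>R (G z - G x) + \<phi> y *\<^sub>R (G y - G x)) +
        ((e x - e y) *\<^sub>R D\<phi> x + e y *\<^sub>R (D\<phi> x - D\<phi> y))) \<le> 13 * (A * B * norm (x - y))"
      using norm_triangle_ineq[of "(\<phi> x - \<phi> y) *\<^sub>R (G z - G x)" "\<phi> y *\<^sub>R (G y - G x)"]
        norm_triangle_ineq[of "(e x - e y) *\<^sub>R D\<phi> x" "e y *\<^sub>R (D\<phi> x - D\<phi> y)"]
        norm_triangle_ineq[of "(\<phi> x - \<phi> y) *\<^sub>R (G z - G x) + \<phi> y *\<^sub>R (G y - G x)" "(e x - e y) *\<^sub>R D\<phi> x + e y *\<^sub>R (D\<phi> x - D\<phi> y)"]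
      by linarith
    moreover have "Dw x - Dw y = ((\<phi> x - \<phi> y) *\<^sub>R (G z - G x) + \<phi> y *\<^sub>R (G y - G x)) +
        ((e x - e y) *\<^sub>R D\<phi> x + e y *\<^sub>R (D\<phi> x - D\<phi> y))"
      unfolding Dw by (simp add: algebra_simps)
    ultimately show ?thesis by (simp only: mult.assoc)
  next
    assume "norm (x - z) \<le> 2 * r" "\<not> norm (y - z) \<le> 2 * r"
    then show ?thesis using mixed[OF x, of y] far[of y] by (simp add: Dw)
  next
    assume "\<not> norm (x - z) \<le> 2 * r" "norm (y - z) \<le> 2 * r"
    moreover from this have "Dw x = 0" using far[of x] by (simp add: Dw)
    ultimately show ?thesis using mixed[OF y, of x] by (simp add: norm_minus_commute[of x])
  next
    assume "\<not> norm (x - z) \<le> 2 * r" "\<not> norm (y - z) \<le> 2 * r"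
    then show ?thesis using far[of x] far[of y] AB by (simp add: Dw)
  qed
qed

text \<open>All local corrections are added. As the discs are disjoint, at most one correction is
  active at each point, so the number of clusters does not enter the constant.\<close>

lemma corrected_function:
  fixes v :: "'a::euclidean_space \<Rightarrow> real"
  assumes cont: "continuous_on S v"
    and der: "\<And>x. x \<in> \<Omega> \<Longrightarrow> (v has_derivative (\<lambda>w. G x \<bullet> w)) (at x)"
    and A: "A \<ge> 0" "\<And>x z. x \<in> \<Omega> \<Longrightarrow> z \<in> \<Omega> \<Longrightarrow> norm (G x - G z) \<le> A * norm (x - z)"
      "\<And>x z. x \<in> \<Omega> \<Longrightarrow> z \<in> \<Omega> \<Longrightarrow> \<bar>v x - v z - G z \<bullet> (x - z)\<bar> \<le> A * (norm (x - z))\<^sup>2"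
  obtains M where "M \<ge> 0" "\<And>(I :: nat set) z r. finite I \<Longrightarrow> (\<And>i. i \<in> I \<Longrightarrow> z i \<in> \<Omega>) \<Longrightarrow> (\<And>i. i \<in> I \<Longrightarrow> r i > 0) \<Longrightarrow>
     (\<And>i j. i \<in> I \<Longrightarrow> j \<in> I \<Longrightarrow> i \<noteq> j \<Longrightarrow> 2 * (r i + r j) \<le> norm (z i - z j)) \<Longrightarrow>
     \<exists>v' G'. continuous_on S v' \<and> (\<forall>x\<in>\<Omega>. (v' has_derivative (\<lambda>w. G' x \<bullet> w)) (at x)) \<and>
       (\<forall>x\<in>\<Omega>. \<forall>y\<in>\<Omega>. norm (G' x - G' y) \<le> M * norm (x - y)) \<and>
       (\<forall>x\<in>\<Omega>. (norm (G' x - G x))\<^sup>2 \<le> (\<Sum>i\<in>I. M * (r i)\<^sup>2 * indicator (ball (z i) (2 * r i)) x)) \<and>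
       (\<forall>j\<in>I. \<forall>x. norm (x - z j) \<le> r j \<longrightarrow> v' x = v (z j) + G (z j) \<bullet> (x - z j))"
proof -
  obtain \<Phi> :: "'a \<Rightarrow> real" and D\<Phi> B where B: "B \<ge> 1"
    "\<And>x. (\<Phi> has_derivative (\<lambda>w. D\<Phi> x \<bullet> w)) (at x)"
    "\<And>x. norm x \<le> 1 \<Longrightarrow> \<Phi> x = 1" "\<And>x. norm x \<ge> 2 \<Longrightarrow> \<Phi> x = 0" "\<And>x. norm x \<ge> 2 \<Longrightarrow> D\<Phi> x = 0"
    "\<And>x. \<bar>\<Phi> x\<bar> \<le> B" "\<And>x. norm (D\<Phi> x) \<le> B" "\<And>x y. \<bar>\<Phi> x - \<Phi> y\<bar> \<le> B * norm (x - y)"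
    "\<And>x y. norm (D\<Phi> x - D\<Phi> y) \<le> B * norm (x - y)"
    by (rule smooth_cutoff) (rule that)
  define L where "L = 13 * A * B"
  have L: "L \<ge> 0" using A(1) B(1) by (simp add: L_def)
  show thesis
  proof
    \<comment> \<open>One constant for two purposes: \<open>A + 2 * L\<close> is the Lipschitz
      constant of \<open>G'\<close>, because a pair of points meets at most two discs, and
      \<open>L\<^sup>2\<close> bounds the squared gradient change within one disc.\<close>
    show "A + 2 * L + L\<^sup>2 \<ge> 0" using A(1) L by simp
    fix I :: "nat set" and z r
    assume fin: "finite I" and z: "\<And>i. i \<in> I \<Longrightarrow> z i \<in> \<Omega>" and r: "\<And>i. i \<in> I \<Longrightarrow> r i > 0"
      and sep: "\<And>i j. i \<in> I \<Longrightarrow> j \<in> I \<Longrightarrow> i \<noteq> j \<Longrightarrow> 2 * (r i + r j) \<le> norm (z i - z j)"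
    define w where "w i x = \<Phi> ((x - z i) /\<^sub>R r i) * (v (z i) + G (z i) \<bullet> (x - z i) - v x)" for i x
    define Dw where "Dw i x = \<Phi> ((x - z i) /\<^sub>R r i) *\<^sub>R (G (z i) - G x) +
        ((v (z i) + G (z i) \<bullet> (x - z i) - v x) / r i) *\<^sub>R D\<Phi> ((x - z i) /\<^sub>R r i)" for i x
    have w_der: "(w i has_derivative (\<lambda>h. Dw i x \<bullet> h)) (at x)"
      and Dw_bound: "norm (Dw i x) \<le> L * r i"
      and Dw_lip: "y \<in> \<Omega> \<Longrightarrow> norm (Dw i x - Dw i y) \<le> L * norm (x - y)" if "i \<in> I" "x \<in> \<Omega>" for i x y
      using local_correction(1,3,4)[OF der A B(1,2,4-9) z[OF that(1)] r[OF that(1)]] that(2)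
      unfolding w_def[abs_def] Dw_def[abs_def] L_def by blast+
    have Dw_far: "Dw i x = 0" if "i \<in> I" "x \<notin> ball (z i) (2 * r i)" for i x
      using local_correction(2)[OF der A B(1,2,4-9) z[OF that(1)] r[OF that(1)], of x] that(2)
      unfolding Dw_def[abs_def] by (simp add: dist_norm norm_minus_commute)
    have disj: "disjoint_family_on (\<lambda>i. ball (z i) (2 * r i)) I"
      unfolding disjoint_family_on_def
    proof (intro ballI impI)
      fix i j assume ij: "i \<in> I" "j \<in> I" "i \<noteq> j"
      show "ball (z i) (2 * r i) \<inter> ball (z j) (2 * r j) = {}"
      proof (rule equals0I)
        fix x assume "x \<in> ball (z i) (2 * r i) \<inter> ball (z j) (2 * r j)"
        then have "dist (z i) (z j) < 2 * r i + 2 * r j"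
          using dist_triangle2[of "z i" "z j" x] by (simp add: dist_commute)
        then show False using sep[OF ij] by (simp add: dist_norm)
      qed
    qed
    have ind: "(\<Sum>i\<in>I. indicat_real (ball (z i) (2 * r i)) x) \<le> 1" for x
      by (subst indicator_UN_disjoint[OF fin disj, symmetric]) (simp add: indicator_le_1)
    define v' where "v' x = v x + (\<Sum>i\<in>I. w i x)" for x
    define G' where "G' x = G x + (\<Sum>i\<in>I. Dw i x)" for x
    have "continuous_on S v'"
    proof -
      have "continuous_on UNIV \<Phi>"
        using has_derivative_continuous[OF B(2)] by (simp add: continuous_at_imp_continuous_on)
      then have "continuous_on S (\<lambda>x. \<Phi> ((x - z i) /\<^sub>R r i))" for i
        by (rule continuous_on_compose2) (auto intro!: continuous_intros)
      then show ?thesis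
        unfolding v'_def[abs_def] w_def by (intro continuous_intros cont)
    qed
    moreover have "(v' has_derivative (\<lambda>h. G' x \<bullet> h)) (at x)" if "x \<in> \<Omega>" for x
    proof -
      have "(v' has_derivative (\<lambda>h. G x \<bullet> h + (\<Sum>i\<in>I. Dw i x \<bullet> h))) (at x)"
        unfolding v'_def[abs_def] by (intro has_derivative_add has_derivative_sum der w_der that)
      then show ?thesis by (simp add: G'_def inner_add_left inner_sum_left)
    qed
    moreover have "norm (G' x - G' y) \<le> (A + 2 * L + L\<^sup>2) * norm (x - y)" if xy: "x \<in> \<Omega>" "y \<in> \<Omega>" for x y
    proof -
      \<comment> \<open>A term is charged to \<open>x\<close> or to \<open>y\<close> if its disc
        contains that point; summed over \<open>i\<close>, the indicators give at most 1 for each of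
        the two points.\<close>
      have "norm (Dw i x - Dw i y) \<le> (indicator (ball (z i) (2 * r i)) x + indicator (ball (z i) (2 * r i)) y) * (L * norm (x - y))"
        if i: "i \<in> I" for i
      proof (cases "x \<in> ball (z i) (2 * r i) \<or> y \<in> ball (z i) (2 * r i)")
        case True
        then have "1 * (L * norm (x - y)) \<le> (indicator (ball (z i) (2 * r i)) x + indicator (ball (z i) (2 * r i)) y) * (L * norm (x - y))"
          using L by (intro mult_right_mono) (auto simp: indicator_def)
        then show ?thesis using Dw_lip[OF i xy] by linarith
      next
        case False
        then show ?thesis using Dw_far[OF i] L by simp
      qed
      then have "(\<Sum>i\<in>I. norm (Dw i x - Dw i y)) \<le>
          (\<Sum>i\<in>I. (indicator (ball (z i) (2 * r i)) x + indicator (ball (z i) (2 * r i)) y) * (L * norm (x - y)))"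
        by (rule sum_mono)
      also have "\<dots> = ((\<Sum>i\<in>I. indicator (ball (z i) (2 * r i)) x) + (\<Sum>i\<in>I. indicator (ball (z i) (2 * r i)) y)) * (L * norm (x - y))"
        by (simp add: sum_distrib_right sum.distrib distrib_right)
      also have "\<dots> \<le> (1 + 1) * (L * norm (x - y))"
        using L by (intro mult_right_mono add_mono ind) auto
      finally have "norm (\<Sum>i\<in>I. Dw i x - Dw i y) \<le> 2 * L * norm (x - y)"
        using norm_sum[of "\<lambda>i. Dw i x - Dw i y" I] by simp
      moreover have "G' x - G' y = (G x - G y) + (\<Sum>i\<in>I. Dw i x - Dw i y)"
        by (simp add: G'_def sum_subtractf)
      ultimately have "norm (G' x - G' y) \<le> A * norm (x - y) + 2 * L * norm (x - y)"
        using norm_triangle_ineq[of "G x - G y" "\<Sum>i\<in>I. Dw i x - Dw i y"] A(2)[OF xy] by simp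
      also have "\<dots> \<le> (A + 2 * L + L\<^sup>2) * norm (x - y)" by (simp add: distrib_right)
      finally show ?thesis .
    qed
    moreover have "(norm (G' x - G x))\<^sup>2 \<le> (\<Sum>i\<in>I. (A + 2 * L + L\<^sup>2) * (r i)\<^sup>2 * indicator (ball (z i) (2 * r i)) x)"
      if x: "x \<in> \<Omega>" for x
    proof (cases "\<exists>j\<in>I. x \<in> ball (z j) (2 * r j)")
      case True
      then obtain j where j: "j \<in> I" "x \<in> ball (z j) (2 * r j)" by blast
      have "Dw i x = 0" if "i \<in> I - {j}" for i
        using that j disjoint_family_onD[OF disj, of i j] by (intro Dw_far) auto
      then have "G' x - G x = Dw j x"
        using fin j(1) by (simp add: G'_def sum.remove[of I j])
      then have "(norm (G' x - G x))\<^sup>2 \<le> (L * r j)\<^sup>2"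
        using Dw_bound[OF j(1) x] by (intro power_mono) auto
      also have "\<dots> \<le> (A + 2 * L + L\<^sup>2) * (r j)\<^sup>2"
        unfolding power_mult_distrib using A(1) L by (intro mult_right_mono) auto
      also have "\<dots> = (A + 2 * L + L\<^sup>2) * (r j)\<^sup>2 * indicator (ball (z j) (2 * r j)) x" using j(2) by simp
      also have "\<dots> \<le> (\<Sum>i\<in>I. (A + 2 * L + L\<^sup>2) * (r i)\<^sup>2 * indicator (ball (z i) (2 * r i)) x)"
        using A(1) L by (intro member_le_sum[OF j(1) _ fin]) auto
      finally show ?thesis .
    next
      case False
      then have "G' x - G x = 0" using Dw_far by (simp add: G'_def)
      then show ?thesis using A(1) L by (auto intro!: sum_nonneg)
    qed
    moreover have "v' x = v (z j) + G (z j) \<bullet> (x - z j)" if j: "j \<in> I" and x: "norm (x - z j) \<le> r j" for j x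
    proof -
      have xj: "x \<in> ball (z j) (2 * r j)" using x r[OF j] by (simp add: dist_norm norm_minus_commute)
      have "w i x = 0" if i: "i \<in> I - {j}" for i
      proof -
        have "x \<notin> ball (z i) (2 * r i)" using i j xj disjoint_family_onD[OF disj, of i j] by auto
        then have "norm ((x - z i) /\<^sub>R r i) \<ge> 2"
          using r[of i] i unfolding norm_scaleR by (simp add: dist_norm norm_minus_commute field_simps)
        then show ?thesis using B(4) by (simp add: w_def)
      qed
      then have "v' x = v x + w j x"
        using fin j by (simp add: v'_def sum.remove[of I j])
      moreover have "norm ((x - z j) /\<^sub>R r j) \<le> 1" using x r[OF j] unfolding norm_scaleR by (simp add: field_simps)
      then have "\<Phi> ((x - z j) /\<^sub>R r j) = 1" by (rule B(3))
      ultimately show ?thesis by (simp add: w_def)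
    qed
    ultimately show "\<exists>v' G'. continuous_on S v' \<and> (\<forall>x\<in>\<Omega>. (v' has_derivative (\<lambda>w. G' x \<bullet> w)) (at x)) \<and>
       (\<forall>x\<in>\<Omega>. \<forall>y\<in>\<Omega>. norm (G' x - G' y) \<le> (A + 2 * L + L\<^sup>2) * norm (x - y)) \<and>
       (\<forall>x\<in>\<Omega>. (norm (G' x - G x))\<^sup>2 \<le> (\<Sum>i\<in>I. (A + 2 * L + L\<^sup>2) * (r i)\<^sup>2 * indicator (ball (z i) (2 * r i)) x)) \<and>
       (\<forall>j\<in>I. \<forall>x. norm (x - z j) \<le> r j \<longrightarrow> v' x = v (z j) + G (z j) \<bullet> (x - z j))"
      by (intro exI[of _ v'] exI[of _ G']) blast
  qed
qed

section \<open>Interpolation on triangles\<close>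

lemma simplex_facts:
  fixes K :: "(real^2) set"
  assumes "2 simplex K"
  shows "compact K" "convex K" "closed K" "interior K \<noteq> {}" "closure (interior K) = K" "interior K = rel_interior K"
proof -
  show "compact K" using assms by (auto simp: simplex intro: finite_imp_compact_convex_hull)
  then show "closed K" by (rule compact_imp_closed)
  show cv: "convex K" using assms by (auto simp: simplex)
  have ad: "aff_dim K = int DIM(real^2)" using aff_dim_simplex[OF assms] by simp
  then show ri: "interior K = rel_interior K" by (simp add: interior_rel_interior_gen)
  have "K \<noteq> {}" using aff_dim_simplex[OF assms] by auto
  then show ne: "interior K \<noteq> {}" by (simp only: ri rel_interior_eq_empty[OF cv] not_False_eq_True)
  show "closure (interior K) = K"
    using convex_closure_interior[OF cv ne] \<open>closed K\<close> by simp
qed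

text \<open>The labels are chosen so that the edge opposite \<open>p0\<close> is the longest, which
  later makes the cosine of the angle at \<open>p0\<close> at most 1/2.\<close>

lemma simplex_vertices:
  fixes K :: "(real^2) set"
  assumes "2 simplex K"
  obtains p0 p1 p2 where "p0 \<noteq> p1" "p0 \<noteq> p2" "p1 \<noteq> p2" "{x. x extreme_point_of K} = {p0, p1, p2}"
    "\<not> affine_dependent {p0, p1, p2}"
    "norm (p1 - p0) \<le> norm (p2 - p1)" "norm (p2 - p0) \<le> norm (p2 - p1)"
proof -
  from assms obtain V where V: "\<not> affine_dependent V" "int (card V) = 2 + 1" "K = convex hull V"
    unfolding simplex_def by (elim exE conjE)
  have card: "card V = 3" using V(2) by linarith
  have ext: "{x. x extreme_point_of K} = V"
    unfolding V(3) extreme_point_of_convex_hull_affine_independent[OF V(1)] by (rule Collect_mem_eq)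
  obtain a b c where abc: "V = {a, b, c}" "a \<noteq> b" "a \<noteq> c" "b \<noteq> c"
    using card unfolding card_3_iff by (elim exE conjE)
  consider "norm (b - a) \<le> norm (c - b)" "norm (c - a) \<le> norm (c - b)"
    | "norm (b - a) \<le> norm (c - a)" "norm (c - b) \<le> norm (c - a)"
    | "norm (c - a) \<le> norm (b - a)" "norm (c - b) \<le> norm (b - a)"
    by (meson linear order_trans)
  then show thesis
  proof cases
    case 1
    show thesis
      by (rule that[OF abc(2,3,4) ext[unfolded abc(1)] V(1)[unfolded abc(1)] 1])
  next
    case 2
    have perm: "{a, b, c} = {b, a, c}" by blast
    have "norm (a - b) \<le> norm (c - a)" using 2(1) by (simp only: norm_minus_commute[of a b])
    then show thesis
      by (rule that[OF abc(2)[symmetric] abc(4,3) ext[unfolded abc(1) perm] V(1)[unfolded abc(1) perm] _ 2(2)])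
  next
    case 3
    have perm: "{a, b, c} = {c, a, b}" by blast
    have "norm (a - c) \<le> norm (b - a)" "norm (b - c) \<le> norm (b - a)"
      using 3 by (simp_all only: norm_minus_commute[of a c] norm_minus_commute[of b c])
    then show thesis
      by (rule that[OF abc(3)[symmetric] abc(4)[symmetric] abc(2) ext[unfolded abc(1) perm] V(1)[unfolded abc(1) perm]])
  qed
qed

lemma linear_functional_inner:
  fixes g :: "'a::euclidean_space \<Rightarrow> real"
  assumes "linear g"
  shows "\<exists>a. \<forall>x. g x = a \<bullet> x"
  using adjoint_works[OF assms, of _ 1] by (intro exI[of _ "adjoint g 1"]) (simp add: inner_commute)

text \<open>Affine independence of the vertices makes the edge vectors from \<open>p0\<close>
  linearly independent, so a linear functional can be prescribed on them.\<close>

lemma affine_interpolant: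
  fixes K :: "(real^2) set" and f :: "real^2 \<Rightarrow> real"
  assumes "2 simplex K"
  shows "\<exists>a b. \<forall>p. p extreme_point_of K \<longrightarrow> a \<bullet> p + b = f p"
proof -
  obtain p0 p1 p2 where p: "{x. x extreme_point_of K} = {p0, p1, p2}" "\<not> affine_dependent {p0, p1, p2}"
    by (rule simplex_vertices[OF assms]) (rule that)
  have "independent ((\<lambda>x. - p0 + x) ` ({p0, p1, p2} - {p0}))"
    using p(2) affine_dependent_iff_dependent2[of p0 "{p0, p1, p2}"] by simp
  then obtain g where g: "linear g" "\<forall>x\<in>(\<lambda>x. - p0 + x) ` ({p0, p1, p2} - {p0}). g x = f (p0 + x) - f p0"
    using linear_independent_extend[of _ "\<lambda>x. f (p0 + x) - f p0"] by blast
  obtain a where a: "\<And>x. g x = a \<bullet> x" using linear_functional_inner[OF g(1)] by blast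
  have "a \<bullet> x + (f p0 - a \<bullet> p0) = f x" if "x extreme_point_of K" for x
  proof (cases "x = p0")
    case False
    then have "- p0 + x \<in> (\<lambda>x. - p0 + x) ` ({p0, p1, p2} - {p0})" using p(1) that by blast
    then have "a \<bullet> (- p0 + x) = f x - f p0" using g(2) a by fastforce
    then show ?thesis by (simp add: inner_diff_right)
  qed simp
  then show ?thesis by blast
qed

text \<open>Conformity makes the pieces fit: two elements meet in a common face, the extreme points
  of that face are vertices of both, and by Krein-Milman affine functions that agree there agree on
  the whole face.\<close>

lemma global_interpolant:
  fixes \<T> :: "(real^2) set set" and f :: "real^2 \<Rightarrow> real"
  assumes "triangulation \<T>" "\<And>K. K \<in> \<T> \<Longrightarrow> 2 simplex K"
  obtains a b w where "\<And>K p. K \<in> \<T> \<Longrightarrow> p extreme_point_of K \<Longrightarrow> a K \<bullet> p + b K = f p"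
    "\<And>K x. K \<in> \<T> \<Longrightarrow> x \<in> K \<Longrightarrow> w x = a K \<bullet> x + b K"
proof -
  have "\<forall>K. \<exists>a b. K \<in> \<T> \<longrightarrow> (\<forall>p. p extreme_point_of K \<longrightarrow> a \<bullet> p + b = f p)"
    using affine_interpolant[OF assms(2)] by blast
  then obtain a b where ab: "\<And>K p. K \<in> \<T> \<Longrightarrow> p extreme_point_of K \<Longrightarrow> a K \<bullet> p + b K = f p"
    by metis
  have agree: "a K \<bullet> x + b K = a K' \<bullet> x + b K'" if K: "K \<in> \<T>" "K' \<in> \<T>" and x: "x \<in> K" "x \<in> K'" for K K' x
  proof -
    let ?F = "K \<inter> K'"
    have F: "?F face_of K" "?F face_of K'"
      using assms(1) K unfolding triangulation_def by (metis Int_commute)+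
    have "compact ?F" "convex ?F"
      using simplex_facts(1-3)[OF assms(2)[OF K(1)]] simplex_facts(1-3)[OF assms(2)[OF K(2)]]
      by (auto intro: compact_Int convex_Int)
    then have "x \<in> convex hull {y. y extreme_point_of ?F}"
      using Krein_Milman_Minkowski[of ?F] x by auto
    moreover have "{y. y extreme_point_of ?F} \<subseteq> {y. (a K - a K') \<bullet> y = b K' - b K}"
    proof
      fix y assume "y \<in> {y. y extreme_point_of ?F}"
      then have "y extreme_point_of K" "y extreme_point_of K'"
        using extreme_point_of_face[OF F(1)] extreme_point_of_face[OF F(2)] by auto
      then show "y \<in> {y. (a K - a K') \<bullet> y = b K' - b K}"
        using ab K by (fastforce simp: inner_diff_left algebra_simps)
    qed
    then have "convex hull {y. y extreme_point_of ?F} \<subseteq> {y. (a K - a K') \<bullet> y = b K' - b K}"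
      by (rule hull_minimal) (rule convex_hyperplane)
    ultimately show ?thesis by (auto simp: inner_diff_left algebra_simps)
  qed
  \<comment> \<open>The element picked by \<open>SOME\<close> is immaterial, because the pieces
    agree on overlaps.\<close>
  define w where "w x = (let K = SOME K. K \<in> \<T> \<and> x \<in> K in a K \<bullet> x + b K)" for x
  have "w x = a K \<bullet> x + b K" if "K \<in> \<T>" "x \<in> K" for K x
  proof -
    have "(SOME K. K \<in> \<T> \<and> x \<in> K) \<in> \<T> \<and> x \<in> (SOME K. K \<in> \<T> \<and> x \<in> K)"
      by (rule someI[of "\<lambda>K. K \<in> \<T> \<and> x \<in> K"]) (use that in blast)
    then show ?thesis unfolding w_def Let_def using agree that by blast
  qed
  then show thesis using ab that by blast
qed

text \<open>In the plane the Gram determinant of \<open>d\<close>, \<open>e\<close>,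
  \<open>f\<close> vanishes. Solved for the norm of \<open>d\<close>, this expresses it by inner
  products, and the bound \<open>q\<close> on the cosine keeps the denominator away from 0.\<close>

lemma inner_bounds_imp_norm_bound:
  fixes d e f :: "real^2"
  assumes e: "e \<noteq> 0" "\<bar>d \<bullet> e\<bar> \<le> m * norm e" and f: "f \<noteq> 0" "\<bar>d \<bullet> f\<bar> \<le> m * norm f"
    and c: "\<bar>e \<bullet> f\<bar> \<le> q * (norm e * norm f)" and q: "0 \<le> q" "q < 1"
  shows "(norm d)\<^sup>2 \<le> 4 * m\<^sup>2 / (1 - q\<^sup>2)"
proof -
  define E where "E = norm e"
  define F where "F = norm f"
  have EF: "E > 0" "F > 0" using e f by (auto simp: E_def F_def)
  have m: "0 \<le> m * E" using e(2) by (simp add: E_def)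
  have "(norm d)\<^sup>2 * ((norm e)\<^sup>2 * (norm f)\<^sup>2 - (e \<bullet> f)\<^sup>2) =
      (norm f)\<^sup>2 * (d \<bullet> e)\<^sup>2 + (norm e)\<^sup>2 * (d \<bullet> f)\<^sup>2 - 2 * (e \<bullet> f) * (d \<bullet> e) * (d \<bullet> f)"
    unfolding power2_norm_eq_inner inner_real2 by (simp add: power2_eq_square algebra_simps)
  then have gram: "(norm d)\<^sup>2 * (E\<^sup>2 * F\<^sup>2 - (e \<bullet> f)\<^sup>2) =
      F\<^sup>2 * (d \<bullet> e)\<^sup>2 + E\<^sup>2 * (d \<bullet> f)\<^sup>2 - 2 * (e \<bullet> f) * (d \<bullet> e) * (d \<bullet> f)"
    by (simp add: E_def F_def)
  have ef: "(e \<bullet> f)\<^sup>2 \<le> (q * (E * F))\<^sup>2"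
    using c by (simp add: abs_le_square_iff[symmetric] E_def F_def)
  have de: "(d \<bullet> e)\<^sup>2 \<le> (m * E)\<^sup>2" and df: "(d \<bullet> f)\<^sup>2 \<le> (m * F)\<^sup>2"
    using e(2) f(2) by (auto simp: E_def F_def intro!: abs_le_square_iff[THEN iffD1] order_trans[OF _ abs_ge_self])
  have "\<bar>(e \<bullet> f) * (d \<bullet> e) * (d \<bullet> f)\<bar> \<le> (q * (E * F)) * (m * E) * (m * F)"
    unfolding abs_mult using c e(2) f(2) q(1) EF by (intro mult_mono) (auto simp: E_def F_def)
  also have "\<dots> = q * (m\<^sup>2 * (E\<^sup>2 * F\<^sup>2))" by (simp add: power2_eq_square)
  also have "\<dots> \<le> 1 * (m\<^sup>2 * (E\<^sup>2 * F\<^sup>2))" using q by (intro mult_right_mono) auto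
  finally have cross: "- 2 * ((e \<bullet> f) * (d \<bullet> e) * (d \<bullet> f)) \<le> 2 * (m\<^sup>2 * (E\<^sup>2 * F\<^sup>2))" by linarith
  have "(norm d)\<^sup>2 * ((1 - q\<^sup>2) * (E\<^sup>2 * F\<^sup>2)) \<le> (norm d)\<^sup>2 * (E\<^sup>2 * F\<^sup>2 - (e \<bullet> f)\<^sup>2)"
    using ef by (intro mult_left_mono) (auto simp: power_mult_distrib algebra_simps)
  also have "\<dots> \<le> F\<^sup>2 * (m * E)\<^sup>2 + E\<^sup>2 * (m * F)\<^sup>2 + 2 * (m\<^sup>2 * (E\<^sup>2 * F\<^sup>2))"
    unfolding gram using mult_left_mono[OF de zero_le_power2[of F]] mult_left_mono[OF df zero_le_power2[of E]] cross
    by linarith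
  also have "\<dots> = 4 * m\<^sup>2 * (E\<^sup>2 * F\<^sup>2)" by (simp add: power_mult_distrib)
  finally have "((norm d)\<^sup>2 * (1 - q\<^sup>2)) * (E\<^sup>2 * F\<^sup>2) \<le> (4 * m\<^sup>2) * (E\<^sup>2 * F\<^sup>2)" by (simp add: mult.assoc)
  then have "(norm d)\<^sup>2 * (1 - q\<^sup>2) \<le> 4 * m\<^sup>2"
    by (rule mult_right_le_imp_le) (use EF in simp)
  moreover have "q\<^sup>2 < 1" using q by (simp add: abs_square_less_1)
  ultimately show ?thesis by (simp add: pos_le_divide_eq)
qed

text \<open>The vertex opposite the longest edge carries an angle with cosine at most \<open>1/2\<close>; the
  maximum angle condition bounds the cosine away from \<open>-1\<close>.\<close>

lemma good_vertex:
  fixes K :: "(real^2) set"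
  assumes "2 simplex K" "max_angle K \<le> \<alpha>" "\<alpha> < pi"
  defines "q \<equiv> max (1 / 2) (- cos \<alpha>)"
  obtains p0 p1 p2 where "p0 extreme_point_of K" "p1 extreme_point_of K" "p2 extreme_point_of K"
    "p1 - p0 \<noteq> 0" "p2 - p0 \<noteq> 0" "\<bar>(p1 - p0) \<bullet> (p2 - p0)\<bar> \<le> q * (norm (p1 - p0) * norm (p2 - p0))" "0 \<le> q" "q < 1"
proof -
  obtain p0 p1 p2 where p: "p0 \<noteq> p1" "p0 \<noteq> p2" "p1 \<noteq> p2" "{x. x extreme_point_of K} = {p0, p1, p2}"
    "norm (p1 - p0) \<le> norm (p2 - p1)" "norm (p2 - p0) \<le> norm (p2 - p1)"
    by (rule simplex_vertices[OF assms(1)]) (rule that)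
  have ext: "p0 extreme_point_of K" "p1 extreme_point_of K" "p2 extreme_point_of K"
    using p(4) by auto
  let ?e = "p1 - p0" and ?f = "p2 - p0"
  have pos: "0 < norm ?e * norm ?f" using p(1,2) by simp
  have "angle_at p0 p1 p2 \<le> max_angle K"
    unfolding max_angle_def
  proof (rule Max_ge)
    have "{angle_at a b c | a b c. a extreme_point_of K \<and> b extreme_point_of K \<and> c extreme_point_of K \<and> a \<noteq> b \<and> a \<noteq> c \<and> b \<noteq> c}
      \<subseteq> (\<lambda>(a, b, c). angle_at a b c) ` ({x. x extreme_point_of K} \<times> {x. x extreme_point_of K} \<times> {x. x extreme_point_of K})"
      by (auto simp: image_def)
    moreover have "finite \<dots>" unfolding p(4) by (intro finite_imageI finite_cartesian_product) auto
    ultimately show "finite {angle_at a b c | a b c. a extreme_point_of K \<and> b extreme_point_of K \<and> c extreme_point_of K \<and> a \<noteq> b \<and> a \<noteq> c \<and> b \<noteq> c}"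
      by (rule finite_subset)
    show "angle_at p0 p1 p2 \<in> {angle_at a b c | a b c. a extreme_point_of K \<and> b extreme_point_of K \<and> c extreme_point_of K \<and> a \<noteq> b \<and> a \<noteq> c \<and> b \<noteq> c}"
      using ext p(1-3) by blast
  qed
  then have le: "angle_at p0 p1 p2 \<le> \<alpha>" using assms(2) by linarith
  define x where "x = (?e \<bullet> ?f) / (norm ?e * norm ?f)"
  have "\<bar>x\<bar> \<le> 1"
    using Cauchy_Schwarz_ineq2[of ?e ?f] pos by (simp add: x_def abs_divide)
  then have x: "-1 \<le> x" "x \<le> 1" by auto
  have angle: "angle_at p0 p1 p2 = arccos x" by (simp add: angle_at_def x_def)
  have \<alpha>0: "0 \<le> \<alpha>" using le arccos_lbound[OF x] angle by linarith
  have "cos \<alpha> \<le> cos (arccos x)"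
    using le angle arccos_lbound[OF x] assms(3) by (intro cos_monotone_0_pi_le) auto
  then have lower: "cos \<alpha> \<le> x" using x by simp
  \<comment> \<open>Law of cosines: as the opposite edge is longest, twice the inner product is at
    most the smaller squared side, hence at most the product of the two sides.\<close>
  have "(norm (p2 - p1))\<^sup>2 = (norm ?f)\<^sup>2 + (norm ?e)\<^sup>2 - 2 * (?e \<bullet> ?f)"
    by (simp add: power2_norm_eq_inner inner_diff_left inner_diff_right inner_commute)
  moreover have "(norm ?e)\<^sup>2 \<le> (norm (p2 - p1))\<^sup>2" "(norm ?f)\<^sup>2 \<le> (norm (p2 - p1))\<^sup>2"
    using p(5,6) by (auto intro: power_mono)
  ultimately have "2 * (?e \<bullet> ?f) \<le> (norm ?f)\<^sup>2" "2 * (?e \<bullet> ?f) \<le> (norm ?e)\<^sup>2" by linarith+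
  moreover have "(norm ?f)\<^sup>2 \<le> norm ?e * norm ?f \<or> (norm ?e)\<^sup>2 \<le> norm ?e * norm ?f"
    unfolding power2_eq_square by (metis linear mult_left_mono mult_right_mono norm_ge_zero)
  ultimately have "2 * (?e \<bullet> ?f) \<le> norm ?e * norm ?f" by linarith
  then have upper: "x \<le> 1 / 2" using pos by (simp add: x_def divide_le_eq)
  have "\<bar>x\<bar> \<le> q" using lower upper by (auto simp: q_def)
  then have main: "\<bar>?e \<bullet> ?f\<bar> \<le> q * (norm ?e * norm ?f)"
    using pos by (simp add: x_def abs_divide abs_mult pos_divide_le_eq)
  \<comment> \<open>The hypothesis \<alpha> < pi keeps \<open>q\<close> strictly below 1.\<close>
  have "cos \<alpha> > -1"
    using cos_monotone_0_pi[OF \<alpha>0 assms(3)] by simp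
  then have "q < 1" unfolding q_def by simp
  have "p1 - p0 \<noteq> 0" "p2 - p0 \<noteq> 0" "0 \<le> q" using p(1,2) by (simp_all add: q_def)
  then show thesis using main \<open>q < 1\<close> by (intro that[OF ext])
qed

text \<open>The interpolant reproduces \<open>f\<close> at the vertices, so along each edge its
  slope differs from that of the linearization of \<open>f\<close> at \<open>x\<close> by at most M
  h. Two edges at a vertex with controlled angle then bound the whole gradient error.\<close>

lemma triangle_interpolation_gradient:
  fixes K :: "(real^2) set" and f :: "real^2 \<Rightarrow> real"
  assumes K: "2 simplex K" "max_angle K \<le> \<alpha>" "\<alpha> < pi" "diameter K \<le> h"
    and f: "continuous_on K f" "\<And>x. x \<in> interior K \<Longrightarrow> (f has_derivative (\<lambda>w. G x \<bullet> w)) (at x)"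
    and G: "M \<ge> 0" "\<And>x y. x \<in> interior K \<Longrightarrow> y \<in> interior K \<Longrightarrow> norm (G x - G y) \<le> M * norm (x - y)"
    and a: "\<And>p. p extreme_point_of K \<Longrightarrow> a \<bullet> p + b = f p" and x: "x \<in> interior K"
  shows "(norm (G x - a))\<^sup>2 \<le> 4 * (M * h)\<^sup>2 / (1 - (max (1 / 2) (- cos \<alpha>))\<^sup>2)"
proof -
  have diam: "norm (y - z) \<le> h" if "y \<in> K" "z \<in> K" for y z
    using diameter_bounded_bound[of K y z] compact_imp_bounded[OF simplex_facts(1)[OF K(1)]] that K(4)
    by (simp add: dist_norm)
  have int: "\<bar>f s - f t - G x \<bullet> (s - t)\<bar> \<le> M * h * norm (s - t)" if "s \<in> interior K" "t \<in> interior K" for s t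
  proof (rule linearization_bound[of "interior K" f G])
    show "convex (interior K)" using simplex_facts(2)[OF K(1)] by (rule convex_interior)
    show "norm (G y - G x) \<le> M * h" if "y \<in> interior K" for y
    proof -
      have "M * norm (y - x) \<le> M * h"
        using that x interior_subset by (intro mult_left_mono diam G) blast+
      then show ?thesis using G(2)[OF that x] by linarith
    qed
  qed (use f that in auto)
  \<comment> \<open>The mean value estimate holds in the open triangle only, as \<open>f\<close>
    need not be differentiable on its boundary; continuity carries it to the vertices.\<close>
  have edge: "\<bar>(G x - a) \<bullet> (s - t)\<bar> \<le> M * h * norm (s - t)"
    if "s extreme_point_of K" "t extreme_point_of K" for s t
  proof -
    have st: "s \<in> K" "t \<in> K" using that by (auto simp: extreme_point_of_def)
    have "s \<in> closure (interior K)" "t \<in> closure (interior K)"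
      using st by (simp_all add: simplex_facts(5)[OF K(1)])
    then obtain s' t' where s': "\<And>n. s' n \<in> interior K" "s' \<longlonglongrightarrow> s" and t': "\<And>n. t' n \<in> interior K" "t' \<longlonglongrightarrow> t"
      unfolding closure_sequential by blast
    have "(\<lambda>n. f (s' n)) \<longlonglongrightarrow> f s" "(\<lambda>n. f (t' n)) \<longlonglongrightarrow> f t"
      using s' t' st interior_subset[of K]
      by (auto intro!: continuous_on_tendsto_compose[OF f(1)] always_eventually)
    then have 1: "(\<lambda>n. \<bar>f (s' n) - f (t' n) - G x \<bullet> (s' n - t' n)\<bar>) \<longlonglongrightarrow> \<bar>f s - f t - G x \<bullet> (s - t)\<bar>"
      by (intro tendsto_intros s' t')
    have 2: "(\<lambda>n. M * h * norm (s' n - t' n)) \<longlonglongrightarrow> M * h * norm (s - t)"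
      by (intro tendsto_intros s' t')
    have "\<bar>f s - f t - G x \<bullet> (s - t)\<bar> \<le> M * h * norm (s - t)"
      by (rule LIMSEQ_le[OF 1 2]) (use int s'(1) t'(1) in auto)
    moreover have "(G x - a) \<bullet> (s - t) = - (f s - f t - G x \<bullet> (s - t))"
      using a[OF that(1)] a[OF that(2)] by (simp add: inner_diff_left inner_diff_right)
    ultimately show ?thesis by simp
  qed
  show ?thesis
  proof (rule good_vertex[OF K(1-3)])
    fix p0 p1 p2
    assume p: "p0 extreme_point_of K" "p1 extreme_point_of K" "p2 extreme_point_of K"
      "p1 - p0 \<noteq> 0" "p2 - p0 \<noteq> 0"
      "\<bar>(p1 - p0) \<bullet> (p2 - p0)\<bar> \<le> max (1 / 2) (- cos \<alpha>) * (norm (p1 - p0) * norm (p2 - p0))"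
      "0 \<le> max (1 / 2) (- cos \<alpha>)" "max (1 / 2) (- cos \<alpha>) < 1"
    show ?thesis
      by (rule inner_bounds_imp_norm_bound[OF p(4) edge[OF p(2,1)] p(5) edge[OF p(3,1)] p(6-8)])
  qed
qed

text \<open>Affine functions equal at the vertices are equal on the convex hull; if their gradients
  differed, the triangle would lie on a line, against the interior point \<open>x\<close>.\<close>

lemma affine_interpolation_exact:
  fixes K :: "(real^2) set"
  assumes "2 simplex K" "\<And>p. p extreme_point_of K \<Longrightarrow> a \<bullet> p + b = c \<bullet> p + d" "x \<in> interior K"
  shows "a = c"
proof -
  have "{p. p extreme_point_of K} \<subseteq> {y. (a - c) \<bullet> y = d - b}"
    using assms(2) by (fastforce simp: inner_diff_left algebra_simps)
  then have "convex hull {p. p extreme_point_of K} \<subseteq> {y. (a - c) \<bullet> y = d - b}"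
    by (rule hull_minimal) (rule convex_hyperplane)
  then have sub: "K \<subseteq> {y. (a - c) \<bullet> y = d - b}"
    by (rule ord_eq_le_trans[OF Krein_Milman_Minkowski[OF simplex_facts(1,2)[OF assms(1)]]])
  show ?thesis
  proof (rule ccontr)
    assume "a \<noteq> c"
    then have "interior {y. (a - c) \<bullet> y = d - b} = {}" by (simp add: interior_hyperplane)
    then show False using interior_mono[OF sub] assms(3) by blast
  qed
qed

text \<open>A face that meets the relative interior of a convex set is the whole set; applied to the
  common face in each of the two elements, this gives both inclusions.\<close>

lemma triangulation_interior_unique:
  fixes \<T> :: "(real^2) set set"
  assumes "triangulation \<T>" "\<And>K. K \<in> \<T> \<Longrightarrow> 2 simplex K" "K \<in> \<T>" "K' \<in> \<T>" "x \<in> interior K" "x \<in> interior K'"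
  shows "K = K'"
proof -
  have *: "L \<subseteq> L'" if "L \<in> \<T>" "L' \<in> \<T>" "x \<in> interior L" "x \<in> interior L'" for L L'
  proof -
    have "L \<inter> L' face_of L"
      using assms(1)[unfolded triangulation_def, THEN conjunct2, THEN conjunct2, rule_format, OF conjI[OF that(1,2)]] .
    moreover have "x \<in> rel_interior L"
      using that(3) unfolding simplex_facts(6)[OF assms(2)[OF that(1)]] .
    moreover have "x \<in> L" "x \<in> L'" using that(3,4) interior_subset by blast+
    ultimately have "L \<subseteq> L \<inter> L'" 
      using subset_of_face_of[of "L \<inter> L'" L L] by blast
    then show ?thesis by blast
  qed
  show ?thesis using *[OF assms(3-6)] *[OF assms(4,3,6,5)] by (rule equalityI)
qed

section \<open>Energy estimates\<close>

lemma Linf_imp_L2: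
  assumes "open \<Omega>" "bounded \<Omega>" "f \<in> Linf \<Omega>"
  shows "f \<in> L2 \<Omega>"
proof -
  obtain M where M: "M \<ge> 0" "AE x in lebesgue. x \<in> \<Omega> \<longrightarrow> \<bar>f x\<bar> \<le> M"
    using Linf_AE_bound[OF assms(3)] by blast
  have meas: "(\<lambda>x. indicator \<Omega> x *\<^sub>R f x) \<in> borel_measurable lebesgue"
    using assms(3) by (simp add: Linf_def set_borel_measurable_def)
  have "\<Omega> \<in> lmeasurable" using assms(1,2) by (simp add: lmeasurable_open)
  then have I: "integrable lebesgue (\<lambda>x. M\<^sup>2 * indicat_real \<Omega> x)"
    by (intro integrable_mult_right integrable_real_indicator) (auto simp: fmeasurable_def)
  have eq: "indicator \<Omega> x *\<^sub>R (f x)\<^sup>2 = (indicator \<Omega> x *\<^sub>R f x)\<^sup>2" for x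
    by (simp add: indicator_def)
  have "integrable lebesgue (\<lambda>x. indicator \<Omega> x *\<^sub>R (f x)\<^sup>2)"
    unfolding eq
  proof (rule Bochner_Integration.integrable_bound[OF I])
    show "(\<lambda>x. (indicator \<Omega> x *\<^sub>R f x)\<^sup>2) \<in> borel_measurable lebesgue"
      by (rule borel_measurable_power[OF meas])
    show "AE x in lebesgue. norm ((indicator \<Omega> x *\<^sub>R f x)\<^sup>2) \<le> norm (M\<^sup>2 * indicat_real \<Omega> x)"
      using M(2)
    proof eventually_elim
      case (elim x)
      show ?case
      proof (cases "x \<in> \<Omega>")
        case True
        then have "\<bar>f x\<bar>\<^sup>2 \<le> M\<^sup>2" using elim by (intro power_mono) auto
        then show ?thesis using True by simp
      qed simp
    qed
  qed
  then show ?thesis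
    using assms(3) by (simp add: L2_def Linf_def set_integrable_def)
qed

text \<open>Along the segment the preimages of the elements are finitely many closed sets that cover
  the unit interval, and a common Lipschitz bound on such pieces holds on the interval.\<close>

lemma lipschitz_on_segment_piecewise_affine:
  fixes w :: "'a::real_inner \<Rightarrow> real"
  assumes fin: "finite \<T>" and closed: "\<And>K. K \<in> \<T> \<Longrightarrow> closed K" and sub: "closed_segment x y \<subseteq> \<Union>\<T>"
    and w: "\<And>K x. K \<in> \<T> \<Longrightarrow> x \<in> K \<Longrightarrow> w x = a K \<bullet> x + b K" and L: "L \<ge> 0" "\<And>K. K \<in> \<T> \<Longrightarrow> norm (a K) \<le> L"
  shows "\<bar>w x - w y\<bar> \<le> L * norm (x - y)"
proof -
  define \<gamma> where "\<gamma> t = x + t *\<^sub>R (y - x)" for t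
  have cont: "continuous_on UNIV \<gamma>" unfolding \<gamma>_def[abs_def] by (intro continuous_intros)
  have diff: "\<gamma> s - \<gamma> t = (s - t) *\<^sub>R (y - x)" for s t by (simp add: \<gamma>_def algebra_simps)
  have "(L * norm (y - x))-lipschitz_on {0..1} (\<lambda>t. w (\<gamma> t))"
  proof (rule lipschitz_on_closed_Union[where I = \<T> and U = "\<lambda>K. \<gamma> -` K"])
    show "(L * norm (y - x))-lipschitz_on (\<gamma> -` K) (\<lambda>t. w (\<gamma> t))" if K: "K \<in> \<T>" for K
    proof (rule lipschitz_onI)
      fix s t assume st: "s \<in> \<gamma> -` K" "t \<in> \<gamma> -` K"
      then have "w (\<gamma> s) - w (\<gamma> t) = a K \<bullet> (\<gamma> s - \<gamma> t)" using w[OF K] by (simp add: inner_diff_right)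
      then have "\<bar>w (\<gamma> s) - w (\<gamma> t)\<bar> \<le> norm (a K) * norm (\<gamma> s - \<gamma> t)"
        using Cauchy_Schwarz_ineq2 by simp
      also have "\<dots> \<le> L * norm (\<gamma> s - \<gamma> t)" by (intro mult_right_mono L K norm_ge_zero)
      finally show "dist (w (\<gamma> s)) (w (\<gamma> t)) \<le> L * norm (y - x) * dist s t"
        by (simp add: dist_norm diff mult_ac)
    qed (use L in simp)
    show "closed (\<gamma> -` K)" if "K \<in> \<T>" for K
      by (rule continuous_closed_vimage[OF closed[OF that]]) (use cont in \<open>simp add: continuous_on_eq_continuous_at\<close>)
    show "{0..1} \<subseteq> (\<Union>K\<in>\<T>. \<gamma> -` K)"
    proof
      fix t :: real assume "t \<in> {0..1}"
      then have "\<gamma> t \<in> closed_segment x y"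
        by (auto simp: in_segment \<gamma>_def algebra_simps intro!: exI[of _ t])
      then show "t \<in> (\<Union>K\<in>\<T>. \<gamma> -` K)" using sub by auto
    qed
  qed (use fin L in auto)
  then have "dist (w (\<gamma> 0)) (w (\<gamma> 1)) \<le> L * norm (y - x) * dist 0 (1::real)"
    by (rule lipschitz_onD) auto
  then show ?thesis by (simp add: \<gamma>_def dist_norm norm_minus_commute)
qed

lemma continuous_on_compact_bound:
  fixes f :: "'a::topological_space \<Rightarrow> real"
  assumes "compact S" "continuous_on S f"
  obtains B where "\<And>x. x \<in> S \<Longrightarrow> \<bar>f x\<bar> \<le> B"
proof -
  have "bounded (f ` S)" using assms by (intro compact_imp_bounded compact_continuous_image)
  then obtain B where "\<forall>y\<in>f ` S. norm y \<le> B" unfolding bounded_iff by blast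
  then show thesis by (intro that[of B]) auto
qed

section \<open>Continuous piecewise affine functions\<close>

locale piecewise_affine =
  fixes \<Omega> :: "(real^2) set" and \<T> :: "(real^2) set set" and a :: "(real^2) set \<Rightarrow> real^2" and b :: "(real^2) set \<Rightarrow> real"
    and w :: "real^2 \<Rightarrow> real"
  assumes open_dom: "open \<Omega>" and bounded_dom: "bounded \<Omega>" and tri: "conforming_triangulation \<Omega> \<T>"
    and w: "\<And>K x. K \<in> \<T> \<Longrightarrow> x \<in> K \<Longrightarrow> w x = a K \<bullet> x + b K"
begin

text \<open>A sum of indicators is measurable at once. At a point of \<Omega> off
  \<open>skeleton\<close> exactly one summand is active; the values on the edges are immaterial,
  since these form a null set.\<close>

definition gradient :: "real^2 \<Rightarrow> real^2" where
  "gradient x = (\<Sum>K\<in>\<T>. indicator (interior K) x *\<^sub>R a K)"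

definition skeleton :: "(real^2) set" where
  "skeleton = (\<Union>K\<in>\<T>. frontier K)"

lemma mesh: "finite \<T>" "triangulation \<T>" "\<And>K. K \<in> \<T> \<Longrightarrow> 2 simplex K" "\<Union>\<T> = closure \<Omega>"
  using tri by (auto simp: conforming_triangulation_def triangulation_def)

lemma gradient_eq: "K \<in> \<T> \<Longrightarrow> x \<in> interior K \<Longrightarrow> gradient x = a K"
proof -
  assume K: "K \<in> \<T>" "x \<in> interior K"
  have "indicator (interior K') x *\<^sub>R a K' = 0" if "K' \<in> \<T> - {K}" for K'
  proof -
    have "x \<notin> interior K'"
    proof
      assume "x \<in> interior K'"
      then have "K = K'" using that by (intro triangulation_interior_unique[OF mesh(2,3) K(1) _ K(2)]) auto
      then show False using that by simp
    qed
    then show ?thesis by simp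
  qed
  then have "(\<Sum>K'\<in>\<T> - {K}. indicator (interior K') x *\<^sub>R a K') = 0"
    by (intro sum.neutral ballI)
  then show "gradient x = a K"
    unfolding gradient_def sum.remove[OF mesh(1) K(1)] using K(2) by simp
qed

lemma negligible_skeleton: "negligible skeleton"
  unfolding skeleton_def
  using mesh(1) by (intro negligible_Union finite_imageI) (auto intro!: negligible_convex_frontier simplex_facts(2) mesh(3))

lemma in_interior: "x \<in> \<Omega> \<Longrightarrow> x \<notin> skeleton \<Longrightarrow> \<exists>K\<in>\<T>. x \<in> interior K"
proof -
  assume x: "x \<in> \<Omega>" "x \<notin> skeleton"
  then have "x \<in> \<Union>\<T>" using mesh(4) closure_subset by blast
  then obtain K where K: "K \<in> \<T>" "x \<in> K" by blast
  have "x \<notin> frontier K" using x(2) K(1) by (auto simp: skeleton_def)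
  then show ?thesis using K closure_subset by (auto simp: frontier_def)
qed

lemma continuous_on_closure: "continuous_on (closure \<Omega>) w"
proof -
  have "continuous_on K w" if "K \<in> \<T>" for K
  proof -
    have "continuous_on K (\<lambda>x. a K \<bullet> x + b K)" by (intro continuous_intros)
    then show ?thesis using w[OF that] by (simp cong: continuous_on_cong)
  qed
  then have "continuous_on (\<Union>K\<in>\<T>. K) w"
    using mesh(1,3) by (intro continuous_on_closed_Union) (auto intro: simplex_facts(3))
  then show ?thesis using mesh(4) by simp
qed

lemma w_Linf: "w \<in> Linf \<Omega>"
proof -
  have "compact (closure \<Omega>)" using bounded_dom by simp
  then obtain B where "\<And>x. x \<in> closure \<Omega> \<Longrightarrow> \<bar>w x\<bar> \<le> B"
    using continuous_on_compact_bound[OF _ continuous_on_closure] by blast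
  then show ?thesis
    using closure_subset continuous_on_subset[OF continuous_on_closure closure_subset]
    by (intro continuous_bounded_imp_Linf[OF open_dom, of w B]) auto
qed

lemma gradient_Linf: "(\<lambda>x. gradient x $ i) \<in> Linf \<Omega>"
proof -
  have eq: "gradient x $ i = (\<Sum>K\<in>\<T>. indicator (interior K) x * a K $ i)" for x
    by (simp add: gradient_def)
  have "(\<lambda>x. indicator \<Omega> x *\<^sub>R gradient x $ i) \<in> borel_measurable borel"
    unfolding eq using open_dom
    by (intro borel_measurable_scaleR borel_measurable_sum borel_measurable_times borel_measurable_indicator
        borel_measurable_const borel_open) auto
  then have 1: "set_borel_measurable lebesgue \<Omega> (\<lambda>x. gradient x $ i)"
    unfolding set_borel_measurable_def by (intro measurable_completion) simp
  have "\<bar>gradient x $ i\<bar> \<le> (\<Sum>K\<in>\<T>. \<bar>a K $ i\<bar>)" for x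
    unfolding eq by (rule order_trans[OF sum_abs sum_mono]) (auto simp: indicator_def)
  then show ?thesis using 1 by (auto simp: Linf_def intro!: exI[of _ "\<Sum>K\<in>\<T>. \<bar>a K $ i\<bar>"])
qed

text \<open>Along segments \<open>w\<close> is Lipschitz, and off the null set
  \<open>skeleton\<close> it is locally affine, so the criterion for Lipschitz functions
  applies.\<close>

lemma weak_derivative_gradient: "weak_derivative \<Omega> [i] w (\<lambda>x. gradient x $ i)"
proof -
  define L where "L = (\<Sum>K\<in>\<T>. norm (a K))"
  have L: "norm (a K) \<le> L" if "K \<in> \<T>" for K
    unfolding L_def using that mesh(1) by (intro member_le_sum) auto
  have "L \<ge> 0" by (simp add: L_def sum_nonneg)
  have "compact (closure \<Omega>)" using bounded_dom by simp
  then obtain B where B: "\<And>x. x \<in> closure \<Omega> \<Longrightarrow> \<bar>w x\<bar> \<le> B"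
    using continuous_on_compact_bound[OF _ continuous_on_closure] by blast
  show ?thesis
  proof (rule weak_derivative_of_lipschitz[OF open_dom])
    show "\<bar>w x - w y\<bar> \<le> L * norm (x - y)" if "closed_segment x y \<subseteq> \<Omega>" for x y
      using that mesh(4) closure_subset[of \<Omega>] \<open>L \<ge> 0\<close> L w
      by (intro lipschitz_on_segment_piecewise_affine[OF mesh(1)]) (auto intro: simplex_facts(3) mesh(3))
    show "\<bar>w x\<bar> \<le> B" if "x \<in> \<Omega>" for x using that B closure_subset by blast
    show "negligible skeleton" by (rule negligible_skeleton)
    show "(w has_derivative (\<lambda>v. gradient x \<bullet> v)) (at x)" if x: "x \<in> \<Omega>" "x \<notin> skeleton" for x
    proof -
      obtain K where K: "K \<in> \<T>" "x \<in> interior K" using in_interior[OF x] by blast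
      have "((\<lambda>x. a K \<bullet> x + b K) has_derivative (\<lambda>v. a K \<bullet> v + 0)) (at x)"
        by (intro has_derivative_add has_derivative_const bounded_linear_imp_has_derivative bounded_linear_inner_right)
      then have "(w has_derivative (\<lambda>v. a K \<bullet> v + 0)) (at x)"
        by (rule has_derivative_transform_within_open[OF _ open_interior K(2)])
          (rule w[OF K(1) subsetD[OF interior_subset], symmetric])
      then show ?thesis using gradient_eq[OF K] by simp
    qed
    show "locally_integrable \<Omega> (\<lambda>x. gradient x $ i)" by (rule Linf_locally_integrable[OF gradient_Linf])
  qed
qed

lemma in_fe_space: "w \<in> fe_space \<Omega> \<T>"
proof -
  have "\<exists>g\<in>L2 \<Omega>. weak_derivative \<Omega> is w g" if len: "length is \<le> 1" for "is"
  proof (cases "is")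
    case Nil
    have "weak_derivative \<Omega> [] w w"
      using Linf_locally_integrable[OF w_Linf] by (simp add: weak_derivative_def)
    then show ?thesis using Nil Linf_imp_L2[OF open_dom bounded_dom w_Linf] by blast
  next
    case (Cons i js)
    then have "is = [i]" using len by simp
    then show ?thesis
      using weak_derivative_gradient Linf_imp_L2[OF open_dom bounded_dom gradient_Linf] by blast
  qed
  then have "w \<in> H1 \<Omega>"
    using Linf_imp_L2[OF open_dom bounded_dom w_Linf] by (simp add: sobolev_def)
  then show ?thesis
    using continuous_on_closure w unfolding fe_space_def by blast
qed

end

section \<open>Bounds for the H^1 seminorm\<close>

lemma norm_square_real2: "(norm (x :: real^2))\<^sup>2 = (\<Sum>i\<in>UNIV. (x $ i)\<^sup>2)"
  unfolding power2_norm_eq_inner inner_vec_def inner_real_def by (simp add: power2_eq_square)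

lemma H1_seminorm_nonneg: "0 \<le> H1_seminorm \<Omega> w"
  unfolding H1_seminorm_def set_lebesgue_integral_def
  by (intro real_sqrt_ge_zero integral_nonneg_AE AE_I2) (auto intro!: mult_nonneg_nonneg sum_nonneg)

text \<open>The seminorm involves an arbitrary choice of weak partial derivatives; uniqueness
  replaces it almost everywhere by the explicit \<open>D\<close>.\<close>

lemma H1_seminorm_square_le:
  fixes D :: "real^2 \<Rightarrow> real^2"
  assumes "open \<Omega>" "\<And>i. weak_derivative \<Omega> [i] w (\<lambda>x. D x $ i)"
    and E: "integrable lebesgue E" "\<And>x. 0 \<le> E x" "AE x in lebesgue. x \<in> \<Omega> \<longrightarrow> (norm (D x))\<^sup>2 \<le> E x"
  shows "(H1_seminorm \<Omega> w)\<^sup>2 \<le> (LINT x|lebesgue. E x)"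
proof -
  have eq: "AE x in lebesgue. x \<in> \<Omega> \<longrightarrow> weak_partial \<Omega> i w x = D x $ i" for i
  proof -
    have "weak_derivative \<Omega> [i] w (weak_partial \<Omega> i w)"
      unfolding weak_partial_def by (rule someI[of "weak_derivative \<Omega> [i] w", OF assms(2)])
    then show ?thesis by (rule weak_derivative_unique[OF assms(1) _ assms(2)])
  qed
  have "(LINT x:\<Omega>|lebesgue. (\<Sum>i\<in>UNIV. (weak_partial \<Omega> i w x)\<^sup>2)) \<le> (LINT x|lebesgue. E x)"
    unfolding set_lebesgue_integral_def
  proof (rule integral_mono_AE'[OF E(1)])
    show "AE x in lebesgue. indicator \<Omega> x *\<^sub>R (\<Sum>i\<in>UNIV. (weak_partial \<Omega> i w x)\<^sup>2) \<le> E x"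
      using eq[of 1] eq[of 2] E(3)
    proof eventually_elim
      case (elim x)
      then show ?case using E(2)[of x] by (cases "x \<in> \<Omega>") (auto simp: UNIV_2 norm_square_real2)
    qed
  qed (use E in auto)
  moreover have "0 \<le> (LINT x:\<Omega>|lebesgue. (\<Sum>i\<in>UNIV. (weak_partial \<Omega> i w x)\<^sup>2))"
    unfolding set_lebesgue_integral_def by (intro integral_nonneg_AE AE_I2) (auto intro!: mult_nonneg_nonneg sum_nonneg)
  ultimately show ?thesis by (simp add: H1_seminorm_def)
qed

lemma measure_ball_le:
  fixes z :: "real^2"
  assumes "r > 0"
  shows "measure lebesgue (ball z r) \<le> (2 * r)\<^sup>2"
proof -
  have "ball z r \<subseteq> cbox (z - vec r) (z + vec r)"
  proof
    fix y assume "y \<in> ball z r"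
    then show "y \<in> cbox (z - vec r) (z + vec r)"
      using component_le_norm_cart[of "y - z" 1] component_le_norm_cart[of "y - z" 2]
      by (auto simp: square_box dist_norm norm_minus_commute)
  qed
  then have "measure lebesgue (ball z r) \<le> measure lebesgue (cbox (z - vec r) (z + vec r))"
    by (intro measure_mono_fmeasurable) auto
  also have "\<dots> = (\<Prod>i\<in>UNIV. (z + vec r) $ i - (z - vec r) $ i)"
  proof -
    have "cbox (z - vec r) (z + vec r) \<noteq> {}" using assms by (auto simp: interval_ne_empty_cart)
    from content_cbox_cart[OF this] show ?thesis by simp
  qed
  also have "\<dots> = (2 * r)\<^sup>2" by (simp add: UNIV_2 power2_eq_square)
  finally show ?thesis .
qed

text \<open>The base point is taken in the interior of an element of the cluster, so that it lies in
  \<Omega> and not merely in the closure. Two distinct vertices of that element make the diameter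
  positive.\<close>

lemma cluster_base_point:
  assumes \<Omega>: "open \<Omega>" "bounded \<Omega>" "lipschitz_boundary \<Omega>" and tri: "conforming_triangulation \<Omega> \<T>"
    and C: "is_cluster \<T> \<alpha>0 C"
  obtains z where "z \<in> \<Omega>" "z \<in> C" "0 < diameter C" "\<And>x. x \<in> C \<Longrightarrow> norm (x - z) \<le> diameter C"
proof -
  obtain S K where S: "S \<subseteq> \<T>" "C = \<Union>S" "K \<in> S" using C unfolding is_cluster_def by blast
  have K: "2 simplex K" using tri S by (auto simp: conforming_triangulation_def)
  have "C \<subseteq> closure \<Omega>" using tri S by (auto simp: conforming_triangulation_def)
  then have bnd: "bounded C" using \<Omega>(2) bounded_closure bounded_subset by blast
  obtain z where z: "z \<in> interior K" using simplex_facts(4)[OF K] by blast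
  have "interior K \<subseteq> interior (closure \<Omega>)"
    using S \<open>C \<subseteq> closure \<Omega>\<close> by (intro interior_mono) auto
  then have "z \<in> \<Omega>" using z lipschitz_boundary_interior_closure[OF \<Omega>(1,3)] by blast
  obtain p0 p1 p2 where p: "p0 \<noteq> p1" "{x. x extreme_point_of K} = {p0, p1, p2}"
    by (rule simplex_vertices[OF K]) (rule that)
  have "p0 \<in> K" "p1 \<in> K" using p(2) by (auto simp: extreme_point_of_def)
  then have "p0 \<in> C" "p1 \<in> C" using S by auto
  then have "dist p0 p1 \<le> diameter C" by (rule diameter_bounded_bound[OF bnd])
  then have "0 < diameter C" using p(1) zero_less_dist_iff[of p0 p1] by linarith
  moreover have "z \<in> C" using z S interior_subset by blast
  moreover have "norm (x - z) \<le> diameter C" if "x \<in> C" for x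
    using diameter_bounded_bound[OF bnd that \<open>z \<in> C\<close>] by (simp add: dist_norm)
  ultimately show thesis using that \<open>z \<in> \<Omega>\<close> by blast
qed

lemma sum_power4_le:
  fixes r :: "'a \<Rightarrow> real"
  assumes "finite I"
  shows "(\<Sum>i\<in>I. (r i)\<^sup>2 * (r i)\<^sup>2) \<le> (\<Sum>i\<in>I. (r i)\<^sup>2)\<^sup>2"
proof -
  have "(\<Sum>i\<in>I. (r i)\<^sup>2 * (r i)\<^sup>2) \<le> (\<Sum>i\<in>I. (r i)\<^sup>2 * (\<Sum>j\<in>I. (r j)\<^sup>2))"
    using assms by (intro sum_mono mult_left_mono member_le_sum) auto
  then show ?thesis by (simp add: sum_distrib_right power2_eq_square[of "\<Sum>i\<in>I. (r i)\<^sup>2"])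
qed

section \<open>The approximation theorem\<close>

lemma weak_derivative_of_C1:
  fixes v :: "real^2 \<Rightarrow> real" and G :: "real^2 \<Rightarrow> real^2"
  assumes "open \<Omega>" "bounded \<Omega>" "continuous_on (closure \<Omega>) v"
    and der: "\<And>x. x \<in> \<Omega> \<Longrightarrow> (v has_derivative (\<lambda>w. G x \<bullet> w)) (at x)"
    and G: "A \<ge> 0" "\<And>x. x \<in> \<Omega> \<Longrightarrow> norm (G x) \<le> A"
      "\<And>x z. x \<in> \<Omega> \<Longrightarrow> z \<in> \<Omega> \<Longrightarrow> norm (G x - G z) \<le> A * norm (x - z)"
  shows "weak_derivative \<Omega> [i] v (\<lambda>x. G x $ i)"
proof -
  have "compact (closure \<Omega>)" using assms(2) by simp
  then obtain B where B: "\<And>x. x \<in> closure \<Omega> \<Longrightarrow> \<bar>v x\<bar> \<le> B"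
    using continuous_on_compact_bound[OF _ assms(3)] by blast
  have "A-lipschitz_on \<Omega> G"
    using G by (intro lipschitz_onI) (auto simp: dist_norm)
  then have "continuous_on \<Omega> (\<lambda>x. G x $ i)"
    by (intro continuous_intros lipschitz_on_continuous_on)
  moreover have "\<bar>G x $ i\<bar> \<le> A" if "x \<in> \<Omega>" for x
    using component_le_norm_cart[of "G x" i] G(2)[OF that] by linarith
  ultimately have "(\<lambda>x. G x $ i) \<in> Linf \<Omega>"
    by (intro continuous_bounded_imp_Linf[OF assms(1)])
  show ?thesis
  proof (rule weak_derivative_of_lipschitz[OF assms(1)])
    show "\<bar>v x - v y\<bar> \<le> A * norm (x - y)" if "closed_segment x y \<subseteq> \<Omega>" for x y
      using linearization_bound[of "closed_segment x y" v G 0 A y x] that der G(2) by auto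
    show "\<bar>v x\<bar> \<le> B" if "x \<in> \<Omega>" for x using that B closure_subset by blast
    show "negligible {}" by simp
    show "locally_integrable \<Omega> (\<lambda>x. G x $ i)" by (rule Linf_locally_integrable) fact
  qed (rule der)
qed

text \<open>The function \<open>v'\<close> is affine on every cluster, so its interpolation error vanishes there.\<close>

lemma corrected_interpolation_gradient:
  fixes v' :: "real^2 \<Rightarrow> real"
  assumes \<Omega>: "open \<Omega>" "lipschitz_boundary \<Omega>" and tri: "conforming_triangulation \<Omega> \<T>"
    and h: "mesh_size \<T> = h" and \<alpha>: "\<alpha> < pi"
    and angle: "\<And>K. K \<in> \<T> \<Longrightarrow> \<not> (\<exists>i\<in>I. K \<subseteq> C i) \<Longrightarrow> max_angle K \<le> \<alpha>"
    and z: "\<And>i x. i \<in> I \<Longrightarrow> x \<in> C i \<Longrightarrow> norm (x - z i) \<le> r i"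
    and v': "continuous_on (closure \<Omega>) v'" "\<And>x. x \<in> \<Omega> \<Longrightarrow> (v' has_derivative (\<lambda>w. G' x \<bullet> w)) (at x)"
    and G': "M \<ge> 0" "\<And>x y. x \<in> \<Omega> \<Longrightarrow> y \<in> \<Omega> \<Longrightarrow> norm (G' x - G' y) \<le> M * norm (x - y)"
    and aff: "\<And>j x. j \<in> I \<Longrightarrow> norm (x - z j) \<le> r j \<Longrightarrow> v' x = v (z j) + G (z j) \<bullet> (x - z j)"
    and a: "\<And>p. p extreme_point_of K \<Longrightarrow> a \<bullet> p + b = v' p"
    and K: "K \<in> \<T>" and x: "x \<in> interior K"
  shows "(norm (G' x - a))\<^sup>2 \<le> 4 * (M * h)\<^sup>2 / (1 - (max (1 / 2) (- cos \<alpha>))\<^sup>2)"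
proof -
  have sK: "2 simplex K" and KC: "K \<subseteq> closure \<Omega>" and fin: "finite \<T>"
    using tri K by (auto simp: conforming_triangulation_def triangulation_def)
  have "interior K \<subseteq> interior (closure \<Omega>)" using KC by (rule interior_mono)
  then have int: "interior K \<subseteq> \<Omega>" using lipschitz_boundary_interior_closure[OF \<Omega>] by blast
  show ?thesis
  proof (cases "\<exists>i\<in>I. K \<subseteq> C i")
    case True
    then obtain j where j: "j \<in> I" "K \<subseteq> C j" by blast
    have v'_aff: "v' y = G (z j) \<bullet> y + (v (z j) - G (z j) \<bullet> z j)" if "y \<in> K" for y
      using aff[OF j(1) z[OF j(1)]] that j(2) by (auto simp: inner_diff_right)
    have "a = G (z j)"
    proof (rule affine_interpolation_exact[OF sK _ x])
      show "a \<bullet> p + b = G (z j) \<bullet> p + (v (z j) - G (z j) \<bullet> z j)" if "p extreme_point_of K" for p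
        using a[OF that] v'_aff[of p] that by (simp add: extreme_point_of_def)
    qed
    moreover have "G' x = G (z j)"
    proof -
      have "((\<lambda>y. G (z j) \<bullet> y + (v (z j) - G (z j) \<bullet> z j)) has_derivative (\<lambda>w. G (z j) \<bullet> w + 0)) (at x)"
        by (intro has_derivative_add has_derivative_const bounded_linear_imp_has_derivative bounded_linear_inner_right)
      then have "(v' has_derivative (\<lambda>w. G (z j) \<bullet> w + 0)) (at x)"
        by (rule has_derivative_transform_within_open[OF _ open_interior x])
          (rule v'_aff[OF subsetD[OF interior_subset], symmetric])
      then have "(\<lambda>w. G (z j) \<bullet> w + 0) = (\<lambda>w. G' x \<bullet> w)"
        using v'(2) int x by (intro has_derivative_unique) auto
      then have "\<And>w. G (z j) \<bullet> w = G' x \<bullet> w" by (metis add.right_neutral)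
      then show ?thesis by (metis vector_eq_rdot)
    qed
    \<comment> \<open>The error is 0 on a cluster, so it remains to see that the right side is
      nonnegative, that is, that its denominator is.\<close>
    moreover have "\<bar>max (1 / 2) (- cos \<alpha>)\<bar> \<le> 1" using cos_ge_minus_one[of \<alpha>] by simp
    then have "(max (1 / 2) (- cos \<alpha>))\<^sup>2 \<le> 1" by (simp add: abs_square_le_1)
    ultimately show ?thesis by simp
  next
    case False
    have "diameter K \<le> h"
      unfolding h[symmetric] mesh_size_def using fin K by (intro Max_ge) auto
    then show ?thesis
      using int by (intro triangle_interpolation_gradient[OF sK angle[OF K False] \<alpha> _
          continuous_on_subset[OF v'(1) KC] v'(2) G'(1) G'(2) a x]) auto
  qed
qed

text \<open>\<open>E\<close> is fixed before the triangulation and the clusters, and the constant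
  \<open>c\<close> of the cluster condition enters explicitly. This order of quantifiers yields a
  constant independent of \<open>h\<close>.\<close>

lemma cluster_approximation:
  fixes u :: "real^2 \<Rightarrow> real"
  assumes \<Omega>: "open \<Omega>" "bounded \<Omega>" "lipschitz_boundary \<Omega>" and u: "u \<in> W2inf \<Omega>" and \<alpha>: "\<alpha> < pi"
  obtains E where "\<And>\<T> h (N :: nat) C c. conforming_triangulation \<Omega> \<T> \<Longrightarrow> mesh_size \<T> = h \<Longrightarrow>
     (\<And>i. i \<in> {1..N} \<Longrightarrow> is_cluster \<T> \<alpha> (C i)) \<Longrightarrow>
     (\<And>K. K \<in> \<T> \<Longrightarrow> \<not> (\<exists>i\<in>{1..N}. K \<subseteq> C i) \<Longrightarrow> max_angle K \<le> \<alpha>) \<Longrightarrow>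
     (\<Sum>i=1..N. (diameter (C i))\<^sup>2) \<le> c * h \<Longrightarrow>
     (\<And>i j. i \<in> {1..N} \<Longrightarrow> j \<in> {1..N} \<Longrightarrow> i \<noteq> j \<Longrightarrow>
        2 * (diameter (C i) + diameter (C j)) \<le> setdist (C i) (C j)) \<Longrightarrow>
     \<exists>w\<in>fe_space \<Omega> \<T>. (H1_seminorm \<Omega> (\<lambda>x. u x - w x))\<^sup>2 \<le> (E + E * c\<^sup>2) * h\<^sup>2"
proof -
  obtain v G A where v: "A \<ge> 0" "AE x in lebesgue. x \<in> \<Omega> \<longrightarrow> u x = v x" "continuous_on (closure \<Omega>) v"
    "\<And>x. x \<in> \<Omega> \<Longrightarrow> (v has_derivative (\<lambda>w. G x \<bullet> w)) (at x)" "\<And>x. x \<in> \<Omega> \<Longrightarrow> norm (G x) \<le> A"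
    "\<And>x z. x \<in> \<Omega> \<Longrightarrow> z \<in> \<Omega> \<Longrightarrow> norm (G x - G z) \<le> A * norm (x - z)"
    "\<And>x z. x \<in> \<Omega> \<Longrightarrow> z \<in> \<Omega> \<Longrightarrow> \<bar>v x - v z - G z \<bullet> (x - z)\<bar> \<le> A * (norm (x - z))\<^sup>2"
    by (rule W2inf_Whitney[OF \<Omega> u]) (rule that)
  show thesis
  proof (rule corrected_function[where \<Omega> = \<Omega>, OF v(3,4,1,6,7)])
    fix M :: real
    assume M: "M \<ge> 0" and corr: "\<And>(I :: nat set) z r. finite I \<Longrightarrow> (\<And>i. i \<in> I \<Longrightarrow> z i \<in> \<Omega>) \<Longrightarrow> (\<And>i. i \<in> I \<Longrightarrow> r i > 0) \<Longrightarrow>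
       (\<And>i j. i \<in> I \<Longrightarrow> j \<in> I \<Longrightarrow> i \<noteq> j \<Longrightarrow> 2 * (r i + r j) \<le> norm (z i - z j)) \<Longrightarrow>
       \<exists>v' G'. continuous_on (closure \<Omega>) v' \<and> (\<forall>x\<in>\<Omega>. (v' has_derivative (\<lambda>w. G' x \<bullet> w)) (at x)) \<and>
         (\<forall>x\<in>\<Omega>. \<forall>y\<in>\<Omega>. norm (G' x - G' y) \<le> M * norm (x - y)) \<and>
         (\<forall>x\<in>\<Omega>. (norm (G' x - G x))\<^sup>2 \<le> (\<Sum>i\<in>I. M * (r i)\<^sup>2 * indicator (ball (z i) (2 * r i)) x)) \<and>
         (\<forall>j\<in>I. \<forall>x. norm (x - z j) \<le> r j \<longrightarrow> v' x = v (z j) + G (z j) \<bullet> (x - z j))"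
    \<comment> \<open>\<open>Q h\<close> bounds the squared gradient error of interpolation at mesh
      size \<open>h\<close>; it is homogeneous of degree 2, so \<open>Q 1\<close> carries the
      constant.\<close>
    define Q where "Q h = 4 * (M * h)\<^sup>2 / (1 - (max (1 / 2) (- cos \<alpha>))\<^sup>2)" for h
    \<comment> \<open>The factor 2 comes from (s + t)^2 <= 2 s^2 + 2 t^2, and 32 is 2 times 16,
      where \<open>16 * r\<^sup>2\<close> is the area of a square containing the disc of radius
      \<open>2 * r\<close>.\<close>
    define E where "E = max (2 * Q 1 * measure lebesgue \<Omega>) (32 * M)"
    show thesis
    proof (rule that[of E])
      fix \<T> :: "(real^2) set set" and h c :: real and N :: nat and C :: "nat \<Rightarrow> (real^2) set"
      assume tri: "conforming_triangulation \<Omega> \<T>" and h: "mesh_size \<T> = h"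
        and clus: "\<And>i. i \<in> {1..N} \<Longrightarrow> is_cluster \<T> \<alpha> (C i)"
        and angle: "\<And>K. K \<in> \<T> \<Longrightarrow> \<not> (\<exists>i\<in>{1..N}. K \<subseteq> C i) \<Longrightarrow> max_angle K \<le> \<alpha>"
        and sum_le: "(\<Sum>i=1..N. (diameter (C i))\<^sup>2) \<le> c * h"
        and sep: "\<And>i j. i \<in> {1..N} \<Longrightarrow> j \<in> {1..N} \<Longrightarrow> i \<noteq> j \<Longrightarrow>
          2 * (diameter (C i) + diameter (C j)) \<le> setdist (C i) (C j)"
      define I where "I = {1..N}"
      define r where "r i = diameter (C i)" for i
      have "\<exists>z. i \<in> I \<longrightarrow> z \<in> \<Omega> \<and> z \<in> C i \<and> 0 < r i \<and> (\<forall>x\<in>C i. norm (x - z) \<le> r i)" for i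
      proof (cases "i \<in> I")
        case True
        then show ?thesis
          using cluster_base_point[OF \<Omega> tri clus[of i]] unfolding I_def r_def by metis
      qed simp
      then obtain z where z: "\<And>i. i \<in> I \<Longrightarrow> z i \<in> \<Omega>" "\<And>i. i \<in> I \<Longrightarrow> z i \<in> C i" "\<And>i. i \<in> I \<Longrightarrow> 0 < r i"
        "\<And>i x. i \<in> I \<Longrightarrow> x \<in> C i \<Longrightarrow> norm (x - z i) \<le> r i" by metis
      have sep': "2 * (r i + r j) \<le> norm (z i - z j)" if "i \<in> I" "j \<in> I" "i \<noteq> j" for i j
      proof -
        have "setdist (C i) (C j) \<le> dist (z i) (z j)" using z(2) that by (intro setdist_le_dist) auto
        then show ?thesis using sep[of i j] that by (simp add: I_def r_def dist_norm)
      qed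
      have "finite I" by (simp add: I_def)
      have "\<exists>v' G'. continuous_on (closure \<Omega>) v' \<and> (\<forall>x\<in>\<Omega>. (v' has_derivative (\<lambda>w. G' x \<bullet> w)) (at x)) \<and>
         (\<forall>x\<in>\<Omega>. \<forall>y\<in>\<Omega>. norm (G' x - G' y) \<le> M * norm (x - y)) \<and>
         (\<forall>x\<in>\<Omega>. (norm (G' x - G x))\<^sup>2 \<le> (\<Sum>i\<in>I. M * (r i)\<^sup>2 * indicator (ball (z i) (2 * r i)) x)) \<and>
         (\<forall>j\<in>I. \<forall>x. norm (x - z j) \<le> r j \<longrightarrow> v' x = v (z j) + G (z j) \<bullet> (x - z j))"
        by (rule corr[of I z r]) (fact \<open>finite I\<close> z(1) z(3) sep')+
      then obtain v' G' where v': "continuous_on (closure \<Omega>) v'" "\<forall>x\<in>\<Omega>. (v' has_derivative (\<lambda>w. G' x \<bullet> w)) (at x)"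
         "\<forall>x\<in>\<Omega>. \<forall>y\<in>\<Omega>. norm (G' x - G' y) \<le> M * norm (x - y)"
         "\<forall>x\<in>\<Omega>. (norm (G' x - G x))\<^sup>2 \<le> (\<Sum>i\<in>I. M * (r i)\<^sup>2 * indicator (ball (z i) (2 * r i)) x)"
         "\<forall>j\<in>I. \<forall>x. norm (x - z j) \<le> r j \<longrightarrow> v' x = v (z j) + G (z j) \<bullet> (x - z j)"
        by (elim exE conjE)
      have tri': "triangulation \<T>" "\<And>K. K \<in> \<T> \<Longrightarrow> 2 simplex K" using tri by (auto simp: conforming_triangulation_def)
      obtain a b w where ab: "\<And>K p. K \<in> \<T> \<Longrightarrow> p extreme_point_of K \<Longrightarrow> a K \<bullet> p + b K = v' p"
        and w: "\<And>K x. K \<in> \<T> \<Longrightarrow> x \<in> K \<Longrightarrow> w x = a K \<bullet> x + b K"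
        by (rule global_interpolant[OF tri'(1), where f = v']) (rule tri'(2), assumption, rule that)
      interpret pa: piecewise_affine \<Omega> \<T> a b w
        by unfold_locales (fact \<Omega>(1) \<Omega>(2) tri w)+
      have wd: "weak_derivative \<Omega> [i] (\<lambda>x. u x - w x) (\<lambda>x. (G x - pa.gradient x) $ i)" for i
      proof (rule weak_derivative_AE_cong)
        show "weak_derivative \<Omega> [i] (\<lambda>x. v x - w x) (\<lambda>x. (G x - pa.gradient x) $ i)"
          unfolding vector_minus_component
          by (rule weak_derivative_diff[OF weak_derivative_of_C1[OF \<Omega>(1,2) v(3,4,1,5,6)] pa.weak_derivative_gradient])
        have "u \<in> Linf \<Omega>" using u by (simp add: sobolev_def)
        then show "locally_integrable \<Omega> (\<lambda>x. u x - w x)"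
          by (intro locally_integrable_diff Linf_locally_integrable pa.w_Linf)
        show "AE x in lebesgue. x \<in> \<Omega> \<longrightarrow> u x - w x = v x - w x"
          using v(2) by eventually_elim auto
      qed
      have Q0: "0 \<le> Q t" for t
      proof -
        have "\<bar>max (1 / 2) (- cos \<alpha>)\<bar> \<le> 1" using cos_ge_minus_one[of \<alpha>] by simp
        then have "(max (1 / 2) (- cos \<alpha>))\<^sup>2 \<le> 1" by (simp add: abs_square_le_1)
        then show ?thesis by (simp add: Q_def)
      qed
      \<comment> \<open>An integrable majorant of the squared gradient error: the first term
        accounts for interpolating \<open>v'\<close>, the second for the change from
        \<open>v\<close> to \<open>v'\<close> near the clusters.\<close>
      define R where "R x = 2 * Q h * indicator \<Omega> x + (\<Sum>i\<in>I. 2 * M * (r i)\<^sup>2 * indicator (ball (z i) (2 * r i)) x)" for x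
      have lm: "\<Omega> \<in> lmeasurable" "ball y s \<in> lmeasurable" for y :: "real^2" and s
        using \<Omega>(1,2) by (auto intro: lmeasurable_open)
      have ind: "integrable lebesgue (indicat_real S)" if "S \<in> lmeasurable" for S :: "(real^2) set"
        using that by (intro integrable_real_indicator) (auto simp: fmeasurable_def)
      have "integrable lebesgue R"
        unfolding R_def[abs_def]
        by (intro Bochner_Integration.integrable_add Bochner_Integration.integrable_sum integrable_mult_right ind lm)
      moreover have R0: "0 \<le> R x" for x
        unfolding R_def using Q0 M by (intro add_nonneg_nonneg sum_nonneg mult_nonneg_nonneg) auto
      moreover have "AE x in lebesgue. x \<in> \<Omega> \<longrightarrow> (norm (G x - pa.gradient x))\<^sup>2 \<le> R x"
      proof -
        have "(norm (G x - pa.gradient x))\<^sup>2 \<le> R x" if x: "x \<in> \<Omega>" "x \<notin> pa.skeleton" for x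
        proof -
          obtain K where K: "K \<in> \<T>" "x \<in> interior K" using pa.in_interior[OF x] by blast
          have "(norm (G' x - a K))\<^sup>2 \<le> Q h"
            unfolding Q_def
            by (rule corrected_interpolation_gradient[where \<Omega> = \<Omega> and \<T> = \<T> and I = I and C = C and z = z and r = r
                  and v' = v' and v = v and G = G and G' = G' and x = x and K = K and b = "b K"])
                (fact \<Omega>(1) \<Omega>(3) tri h \<alpha> angle[folded I_def] z(4) v'(1) v'(2)[rule_format] M v'(3)[rule_format]
                  v'(5)[rule_format] ab[OF K(1)] K)+
          moreover have "(norm (G' x - G x))\<^sup>2 \<le> (\<Sum>i\<in>I. M * (r i)\<^sup>2 * indicator (ball (z i) (2 * r i)) x)"
            using v'(4) x(1) by blast
          moreover have "(norm (G x - a K))\<^sup>2 \<le> 2 * (norm (G' x - a K))\<^sup>2 + 2 * (norm (G' x - G x))\<^sup>2"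
          proof -
            have "norm (G x - a K) \<le> norm (G' x - a K) + norm (G' x - G x)"
              using norm_triangle_ineq4[of "G' x - a K" "G' x - G x"] by simp
            then have "(norm (G x - a K))\<^sup>2 \<le> (norm (G' x - a K) + norm (G' x - G x))\<^sup>2"
              by (intro power_mono) auto
            also have "\<dots> \<le> 2 * (norm (G' x - a K))\<^sup>2 + 2 * (norm (G' x - G x))\<^sup>2"
              using zero_le_power2[of "norm (G' x - a K) - norm (G' x - G x)"]
              by (simp add: power2_sum power2_diff)
            finally show ?thesis .
          qed
          ultimately have "(norm (G x - a K))\<^sup>2 \<le> 2 * Q h + 2 * (\<Sum>i\<in>I. M * (r i)\<^sup>2 * indicator (ball (z i) (2 * r i)) x)"
            by linarith
          also have "\<dots> = R x"
            using x(1) by (simp add: R_def sum_distrib_left mult.assoc)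
          finally show ?thesis using pa.gradient_eq[OF K] by simp
        qed
        then show ?thesis
          using pa.negligible_skeleton unfolding negligible_iff_null_sets by (intro AE_I') auto
      qed
      ultimately have "(H1_seminorm \<Omega> (\<lambda>x. u x - w x))\<^sup>2 \<le> (LINT x|lebesgue. R x)"
        by (rule H1_seminorm_square_le[OF \<Omega>(1) wd])
      also have "\<dots> = 2 * Q h * measure lebesgue \<Omega> + (\<Sum>i\<in>I. 2 * M * (r i)\<^sup>2 * measure lebesgue (ball (z i) (2 * r i)))"
        unfolding R_def
        by (subst Bochner_Integration.integral_add, (intro Bochner_Integration.integrable_sum integrable_mult_right ind lm)+,
            subst Bochner_Integration.integral_sum, intro integrable_mult_right ind lm) simp
      also have "\<dots> \<le> E * h\<^sup>2 + E * (c * h)\<^sup>2"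
      proof (rule add_mono)
        have "2 * Q h * measure lebesgue \<Omega> = (2 * Q 1 * measure lebesgue \<Omega>) * h\<^sup>2"
          by (simp add: Q_def power_mult_distrib)
        also have "\<dots> \<le> E * h\<^sup>2" by (intro mult_right_mono) (auto simp: E_def)
        finally show "2 * Q h * measure lebesgue \<Omega> \<le> E * h\<^sup>2" .
        have "(\<Sum>i\<in>I. 2 * M * (r i)\<^sup>2 * measure lebesgue (ball (z i) (2 * r i))) \<le> (\<Sum>i\<in>I. 2 * M * (r i)\<^sup>2 * (2 * (2 * r i))\<^sup>2)"
          using M z(3) by (intro sum_mono mult_left_mono measure_ball_le) auto
        also have "\<dots> = 32 * M * (\<Sum>i\<in>I. (r i)\<^sup>2 * (r i)\<^sup>2)"
          by (simp add: sum_distrib_left power_mult_distrib algebra_simps)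
        also have "\<dots> \<le> 32 * M * (c * h)\<^sup>2"
        proof (rule mult_left_mono)
          have "(\<Sum>i\<in>I. (r i)\<^sup>2 * (r i)\<^sup>2) \<le> (\<Sum>i\<in>I. (r i)\<^sup>2)\<^sup>2" by (rule sum_power4_le) fact
          also have "\<dots> \<le> (c * h)\<^sup>2"
            using sum_le unfolding I_def r_def by (intro power_mono sum_nonneg) auto
          finally show "(\<Sum>i\<in>I. (r i)\<^sup>2 * (r i)\<^sup>2) \<le> (c * h)\<^sup>2" .
        qed (use M in simp)
        also have "\<dots> \<le> E * (c * h)\<^sup>2" by (intro mult_right_mono) (auto simp: E_def)
        finally show "(\<Sum>i\<in>I. 2 * M * (r i)\<^sup>2 * measure lebesgue (ball (z i) (2 * r i))) \<le> E * (c * h)\<^sup>2" .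
      qed
      also have "\<dots> = (E + E * c\<^sup>2) * h\<^sup>2" by (simp add: power_mult_distrib algebra_simps)
      finally show "\<exists>w\<in>fe_space \<Omega> \<T>. (H1_seminorm \<Omega> (\<lambda>x. u x - w x))\<^sup>2 \<le> (E + E * c\<^sup>2) * h\<^sup>2"
        using pa.in_fe_space by blast
    qed
  qed
qed

theorem theorem6:
  fixes \<Omega> :: "(real^2) set"
    and h0 \<alpha>0 C :: real
    and \<T> :: "real \<Rightarrow> (real^2) set set"
    and N :: "real \<Rightarrow> nat"
    and \<C> :: "real \<Rightarrow> nat \<Rightarrow> (real^2) set"
  assumes "polygonal_lipschitz_domain \<Omega>"
    and "\<And>h. h \<in> {0<..<h0} \<Longrightarrow> conforming_triangulation \<Omega> (\<T> h)"
    and "\<And>h. h \<in> {0<..<h0} \<Longrightarrow> mesh_size (\<T> h) = h"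
    and "\<alpha>0 < pi"
    and "\<And>h i. h \<in> {0<..<h0} \<Longrightarrow> i \<in> {1..N h} \<Longrightarrow> is_cluster (\<T> h) \<alpha>0 (\<C> h i)"
    and "\<And>h K. h \<in> {0<..<h0} \<Longrightarrow> K \<in> \<T> h \<Longrightarrow> \<not> (\<exists>i\<in>{1..N h}. K \<subseteq> \<C> h i) \<Longrightarrow>
           max_angle K \<le> \<alpha>0"
    and "\<And>h. h \<in> {0<..<h0} \<Longrightarrow> (\<Sum>i=1..N h. (diameter (\<C> h i))\<^sup>2) \<le> C * h"
    and "\<And>h i j. h \<in> {0<..<h0} \<Longrightarrow> i \<in> {1..N h} \<Longrightarrow> j \<in> {1..N h} \<Longrightarrow> i \<noteq> j \<Longrightarrow>
           setdist (\<C> h i) (\<C> h j) \<ge> 2 * (diameter (\<C> h i) + diameter (\<C> h j))"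
  shows "\<forall>u \<in> W2inf \<Omega>. \<exists>Cu. \<forall>h \<in> {0<..<h0}. \<forall>U.
           fe_approximation \<Omega> (\<T> h) u U \<longrightarrow> H1_seminorm \<Omega> (\<lambda>x. u x - U x) \<le> Cu * h"
proof
  fix u assume u: "u \<in> W2inf \<Omega>"
  have \<Omega>: "open \<Omega>" "bounded \<Omega>" "lipschitz_boundary \<Omega>"
    using assms(1) by (auto simp: polygonal_lipschitz_domain_def)
  show "\<exists>Cu. \<forall>h \<in> {0<..<h0}. \<forall>U. fe_approximation \<Omega> (\<T> h) u U \<longrightarrow> H1_seminorm \<Omega> (\<lambda>x. u x - U x) \<le> Cu * h"
  proof (rule cluster_approximation[OF \<Omega> u assms(4)])
    fix E
    assume approx: "\<And>\<T> h (N :: nat) C c. conforming_triangulation \<Omega> \<T> \<Longrightarrow> mesh_size \<T> = h \<Longrightarrow>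
     (\<And>i. i \<in> {1..N} \<Longrightarrow> is_cluster \<T> \<alpha>0 (C i)) \<Longrightarrow>
     (\<And>K. K \<in> \<T> \<Longrightarrow> \<not> (\<exists>i\<in>{1..N}. K \<subseteq> C i) \<Longrightarrow> max_angle K \<le> \<alpha>0) \<Longrightarrow>
     (\<Sum>i=1..N. (diameter (C i))\<^sup>2) \<le> c * h \<Longrightarrow>
     (\<And>i j. i \<in> {1..N} \<Longrightarrow> j \<in> {1..N} \<Longrightarrow> i \<noteq> j \<Longrightarrow>
        2 * (diameter (C i) + diameter (C j)) \<le> setdist (C i) (C j)) \<Longrightarrow>
     \<exists>w\<in>fe_space \<Omega> \<T>. (H1_seminorm \<Omega> (\<lambda>x. u x - w x))\<^sup>2 \<le> (E + E * c\<^sup>2) * h\<^sup>2"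
    show ?thesis
    proof (intro exI ballI allI impI)
      fix h U assume h: "h \<in> {0<..<h0}" and U: "fe_approximation \<Omega> (\<T> h) u U"
      have "\<exists>w\<in>fe_space \<Omega> (\<T> h). (H1_seminorm \<Omega> (\<lambda>x. u x - w x))\<^sup>2 \<le> (E + E * C\<^sup>2) * h\<^sup>2"
        by (rule approx[of "\<T> h" h "N h" "\<C> h" C]) (fact assms(2,3,5-8)[OF h])+
      then obtain w where w: "w \<in> fe_space \<Omega> (\<T> h)" "(H1_seminorm \<Omega> (\<lambda>x. u x - w x))\<^sup>2 \<le> (E + E * C\<^sup>2) * h\<^sup>2"
        by blast
      \<comment> \<open>A best approximation is at least as good as the interpolant of the corrected
        function. The seminorm is bounded below by 0, so the infimum is a genuine lower
        bound.\<close>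
      have "H1_seminorm \<Omega> (\<lambda>x. u x - U x) = (INF v\<in>fe_space \<Omega> (\<T> h). H1_seminorm \<Omega> (\<lambda>x. u x - v x))"
        using U by (simp add: fe_approximation_def)
      also have "\<dots> \<le> H1_seminorm \<Omega> (\<lambda>x. u x - w x)"
        by (rule cINF_lower[OF _ w(1)]) (auto intro!: bdd_belowI2[where m = 0] H1_seminorm_nonneg)
      also have "\<dots> \<le> sqrt ((E + E * C\<^sup>2) * h\<^sup>2)"
        using w(2) by (rule real_le_rsqrt)
      also have "\<dots> = sqrt (E + E * C\<^sup>2) * h"
        using h by (simp add: real_sqrt_mult)
      finally show "H1_seminorm \<Omega> (\<lambda>x. u x - U x) \<le> sqrt (E + E * C\<^sup>2) * h" .
    qed
  qed
qed

end
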